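(* Let $M\in SL_2(\mathbb{Z})$ be hyperbolic and let $r>0$. Define the linear functional $$B_M:\mathcal{B}_r\to\mathbb{R},\qquad B_M(\psi)=N_M^{-1}\sum_{x\in\mathbb{T}^2,\ Mx=x}\operatorname{tr}\big((I-M)^{-1}D_x\psi\big),$$ where $N_M=|\det(I-M)|$ is the number of fixed points of $M$ on $\mathbb{T}^2$. Then there exist $c>0$ and an open dense set $\mathcal{G}\subseteq\mathcal{B}_r$ on which $B_M$ never vanishes, such that for every $\psi\in\mathcal{G}$ there is $\epsilon_0>0$ such that for all $0<\epsilon<\epsilon_0$ the Koopman operator $\mathcal{K}_{M+\epsilon\psi}$ acts as a nuclear operator of order $0$ on $\mathcal{H}_{A_{M,c}}$, its trace satisfies $$\operatorname{tr}\mathcal{K}_{M+\epsilon\psi}=1+\epsilon B_M(\psi)+O(\epsilon^2)\quad(\epsilon\to0),$$ and $\operatorname{sp}(\mathcal{K}_{M+\epsilon\psi})\setminus\{0,1\}\neq\emptyset$.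
   Context: $\mathbb{T}^2=\mathbb{R}^2/\mathbb{Z}^2$; $\varphi_n(x)=\exp(2\pi i\,n\cdot x)$, $n\in\mathbb{Z}^2$; for $z\in\mathbb{C}^2$, $\|z\|=|z_1|+|z_2|$. $M\in SL_2(\mathbb{Z})$ is hyperbolic if none of its eigenvalues has modulus $1$; $E^\pm$ are the eigenlines of $M^T$ for eigenvalues of modulus $\lambda_M^{\pm1}$ ($\lambda_M>1$), $y=y^+_M+y^-_M$ the corresponding decomposition and $|y|_M=\|y^+_M\|-\|y^-_M\|$. For $c>0$, $\mathcal{H}_{A_{M,c}}$ is the Hilbert space of formal Fourier series $g=\sum g_n\varphi_n$ with $\sum_n e^{-4\pi c|n|_M}|g_n|^2<\infty$, with orthonormal basis $\varrho_n=e^{2\pi c|n|_M}\varphi_n$. $\mathcal{B}_r$ is the real Banach space of $\mathbb{Z}^2$-periodic maps $\psi:\mathbb{R}^2\to\mathbb{R}^2$ extending holomorphically and boundedly to $\mathbb{R}^2+i(-r,r)^2$, with the sup norm there; $M+\epsilon\psi$ denotes the induced map $x\mapsto Mx+\epsilon\psi(x)\bmod\mathbb{Z}^2$ of $\mathbb{T}^2$. The Koopman operator is $\mathcal{K}_Tf=f\circ T$, extended by continuity from trigonometric polynomials to $\mathcal{H}_{A_{M,c}}$. An operator $\mathcal{L}$ on a Hilbert space is nuclear of order $0$ if $\mathcal{L}=\sum_n d_n\psi_{1,n}\psi_{2,n}^*$ with $\|\psi_{i,n}\|\le1$ and $\sum_n|d_n|^p<\infty$ for every $p>0$; its trace is $\sum_n\langle\varrho_n,\mathcal{L}\varrho_n\rangle$.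 *)

theory Defs
  imports "HOL-Analysis.Analysis" "HOL-Library.Landau_Symbols"
begin

definition rmat :: "int^2^2 \<Rightarrow> real^2^2" where
  "rmat M = (\<chi> i j. real_of_int (M$i$j))"

definition cmat :: "int^2^2 \<Rightarrow> complex^2^2" where
  "cmat M = (\<chi> i j. complex_of_int (M$i$j))"

definition ivec :: "int^2 \<Rightarrow> real^2" where
  "ivec k = (\<chi> i. real_of_int (k$i))"

definition cvec :: "real^2 \<Rightarrow> complex^2" where
  "cvec x = (\<chi> i. complex_of_real (x$i))"

definition icvec :: "int^2 \<Rightarrow> complex^2" where
  "icvec n = (\<chi> i. complex_of_int (n$i))"

definition hyperbolic :: "int^2^2 \<Rightarrow> bool" where
  "hyperbolic M \<longleftrightarrow>
     (\<forall>\<mu>::complex. (\<exists>v::complex^2. v \<noteq> 0 \<and> cmat M *v v = \<mu> *s v) \<longrightarrow> cmod \<mu> \<noteq> 1)"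

definition fixpts :: "int^2^2 \<Rightarrow> (real^2) set" where
  "fixpts M = {x. (\<forall>i. 0 \<le> x$i \<and> x$i < 1) \<and> (\<forall>i. (rmat M *v x - x)$i \<in> \<int>)}"

definition NM :: "int^2^2 \<Rightarrow> real" where
  "NM M = \<bar>det (mat 1 - rmat M)\<bar>"

definition BM :: "int^2^2 \<Rightarrow> (real^2 \<Rightarrow> real^2) \<Rightarrow> real" where
  "BM M \<psi> = (1 / NM M) *
     (\<Sum>x\<in>fixpts M. trace (matrix_inv (mat 1 - rmat M) ** matrix (frechet_derivative \<psi> (at x))))"

definition strip :: "real \<Rightarrow> (complex^2) set" where
  "strip r = {z. \<forall>i. \<bar>Im (z$i)\<bar> < r}"

definition cholo :: "(complex^2 \<Rightarrow> complex^2) \<Rightarrow> (complex^2) set \<Rightarrow> bool" where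
  "cholo F S \<longleftrightarrow> (\<forall>z\<in>S. \<exists>D. (F has_derivative D) (at z) \<and> (\<forall>(a::complex) v. D (a *s v) = a *s D v))"

definition is_ext :: "real \<Rightarrow> (real^2 \<Rightarrow> real^2) \<Rightarrow> (complex^2 \<Rightarrow> complex^2) \<Rightarrow> bool" where
  "is_ext r \<psi> \<Psi> \<longleftrightarrow> cholo \<Psi> (strip r) \<and> bounded (\<Psi> ` strip r) \<and> (\<forall>x. \<Psi> (cvec x) = cvec (\<psi> x))"

definition Bspace :: "real \<Rightarrow> (real^2 \<Rightarrow> real^2) set" where
  "Bspace r = {\<psi>. (\<forall>x k. \<psi> (x + ivec k) = \<psi> x) \<and> (\<exists>\<Psi>. is_ext r \<psi> \<Psi>)}"

text \<open>Sup norm on the complex strip (the holomorphic extension is unique).\<close>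
definition Bnorm :: "real \<Rightarrow> (real^2 \<Rightarrow> real^2) \<Rightarrow> real" where
  "Bnorm r \<psi> = (SUP z\<in>strip r. norm ((SOME \<Psi>. is_ext r \<psi> \<Psi>) z))"

definition Bopen :: "real \<Rightarrow> (real^2 \<Rightarrow> real^2) set \<Rightarrow> bool" where
  "Bopen r G \<longleftrightarrow> (\<forall>\<psi>\<in>G. \<exists>\<delta>>0. \<forall>\<phi>\<in>Bspace r. Bnorm r (\<phi> - \<psi>) < \<delta> \<longrightarrow> \<phi> \<in> G)"

definition Bdense :: "real \<Rightarrow> (real^2 \<Rightarrow> real^2) set \<Rightarrow> bool" where
  "Bdense r G \<longleftrightarrow> (\<forall>\<psi>\<in>Bspace r. \<forall>\<delta>>0. \<exists>\<phi>\<in>G. Bnorm r (\<phi> - \<psi>) < \<delta>)"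

definition l1 :: "complex^2 \<Rightarrow> real" where
  "l1 z = cmod (z$1) + cmod (z$2)"

definition Eplus :: "int^2^2 \<Rightarrow> (complex^2) set" where
  "Eplus M = {v. \<exists>\<mu>. cmod \<mu> > 1 \<and> transpose (cmat M) *v v = \<mu> *s v}"

definition Eminus :: "int^2^2 \<Rightarrow> (complex^2) set" where
  "Eminus M = {v. \<exists>\<mu>. cmod \<mu> < 1 \<and> transpose (cmat M) *v v = \<mu> *s v}"

definition yplus :: "int^2^2 \<Rightarrow> complex^2 \<Rightarrow> complex^2" where
  "yplus M y = (THE p. p \<in> Eplus M \<and> y - p \<in> Eminus M)"

definition normM :: "int^2^2 \<Rightarrow> complex^2 \<Rightarrow> real" where
  "normM M y = l1 (yplus M y) - l1 (y - yplus M y)"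

definition wt :: "int^2^2 \<Rightarrow> real \<Rightarrow> int^2 \<Rightarrow> real" where
  "wt M c n = exp (- 4 * pi * c * normM M (icvec n))"

text \<open>Formal Fourier series are coefficient functions on Z^2.\<close>
definition Hsp :: "int^2^2 \<Rightarrow> real \<Rightarrow> (int^2 \<Rightarrow> complex) set" where
  "Hsp M c = {g. (\<lambda>n. wt M c n * (cmod (g n))\<^sup>2) summable_on UNIV}"

definition Hinner :: "int^2^2 \<Rightarrow> real \<Rightarrow> (int^2 \<Rightarrow> complex) \<Rightarrow> (int^2 \<Rightarrow> complex) \<Rightarrow> complex" where
  "Hinner M c f g = (\<Sum>\<^sub>\<infinity>n. complex_of_real (wt M c n) * cnj (f n) * g n)"

definition Hnorm :: "int^2^2 \<Rightarrow> real \<Rightarrow> (int^2 \<Rightarrow> complex) \<Rightarrow> real" where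
  "Hnorm M c g = sqrt (\<Sum>\<^sub>\<infinity>n. wt M c n * (cmod (g n))\<^sup>2)"

definition rho :: "int^2^2 \<Rightarrow> real \<Rightarrow> int^2 \<Rightarrow> (int^2 \<Rightarrow> complex)" where
  "rho M c n = (\<lambda>k. if k = n then complex_of_real (exp (2 * pi * c * normM M (icvec n))) else 0)"

type_synonym op = "(int^2 \<Rightarrow> complex) \<Rightarrow> (int^2 \<Rightarrow> complex)"

definition bounded_op :: "int^2^2 \<Rightarrow> real \<Rightarrow> op \<Rightarrow> bool" where
  "bounded_op M c L \<longleftrightarrow>
     (\<forall>g\<in>Hsp M c. L g \<in> Hsp M c) \<and>
     (\<forall>f\<in>Hsp M c. \<forall>g\<in>Hsp M c. \<forall>a b. L (\<lambda>k. a * f k + b * g k) = (\<lambda>k. a * L f k + b * L g k)) \<and>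
     (\<exists>K. \<forall>g\<in>Hsp M c. Hnorm M c (L g) \<le> K * Hnorm M c g)"

definition nuclear0 :: "int^2^2 \<Rightarrow> real \<Rightarrow> op \<Rightarrow> bool" where
  "nuclear0 M c L \<longleftrightarrow>
     (\<exists>(d::nat \<Rightarrow> complex) \<psi>1 \<psi>2.
        (\<forall>n. \<psi>1 n \<in> Hsp M c \<and> \<psi>2 n \<in> Hsp M c \<and> Hnorm M c (\<psi>1 n) \<le> 1 \<and> Hnorm M c (\<psi>2 n) \<le> 1) \<and>
        (\<forall>p>0. summable (\<lambda>n. cmod (d n) powr p)) \<and>
        (\<forall>g\<in>Hsp M c. \<forall>k. (\<lambda>n. d n * Hinner M c (\<psi>2 n) g * \<psi>1 n k) sums (L g k)))"

definition Htrace :: "int^2^2 \<Rightarrow> real \<Rightarrow> op \<Rightarrow> complex" where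
  "Htrace M c L = (\<Sum>\<^sub>\<infinity>n. Hinner M c (rho M c n) (L (rho M c n)))"

definition Hspec :: "int^2^2 \<Rightarrow> real \<Rightarrow> op \<Rightarrow> complex set" where
  "Hspec M c L = {z. \<not> bij_betw (\<lambda>g k. L g k - z * g k) (Hsp M c) (Hsp M c)}"

definition ndot :: "int^2 \<Rightarrow> real^2 \<Rightarrow> real" where
  "ndot n x = (\<Sum>i\<in>UNIV. real_of_int (n$i) * x$i)"

definition trigpoly :: "(int^2 \<Rightarrow> complex) \<Rightarrow> bool" where
  "trigpoly a \<longleftrightarrow> finite {n. a n \<noteq> 0}"

definition tp_eval :: "(int^2 \<Rightarrow> complex) \<Rightarrow> real^2 \<Rightarrow> complex" where
  "tp_eval a x = (\<Sum>n\<in>{n. a n \<noteq> 0}. a n * cis (2 * pi * ndot n x))"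

definition fourier :: "(real^2 \<Rightarrow> complex) \<Rightarrow> (int^2 \<Rightarrow> complex)" where
  "fourier F k = integral (cbox 0 (vec 1)) (\<lambda>x. F x * cis (- 2 * pi * ndot k x))"

text \<open>The map M + eps psi, lifted to R^2.\<close>
definition Tmap :: "int^2^2 \<Rightarrow> real \<Rightarrow> (real^2 \<Rightarrow> real^2) \<Rightarrow> real^2 \<Rightarrow> real^2" where
  "Tmap M \<epsilon> \<psi> x = rmat M *v x + \<epsilon> *\<^sub>R \<psi> x"

definition koopman_ext :: "int^2^2 \<Rightarrow> real \<Rightarrow> (real^2 \<Rightarrow> real^2) \<Rightarrow> op \<Rightarrow> bool" where
  "koopman_ext M c T L \<longleftrightarrow> bounded_op M c L \<and>
     (\<forall>a. trigpoly a \<longrightarrow> L a = fourier (\<lambda>x. tp_eval a (T x)))"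

end

theory Submission
  imports Defs "HOL-Complex_Analysis.Complex_Analysis" "Jordan_Normal_Form.Determinant"
    "HOL-Library.Diagonal_Subsequence" "HOL-Real_Asymp.Real_Asymp"
begin

text \<open>In the orthonormal basis of weighted characters the Koopman operator of \<open>M + \<epsilon>\<psi>\<close> is an
  infinite matrix. Shifting the contour of its Fourier integrals into the strip shows that the entries
  decay exponentially in both indices, uniformly for small \<open>\<epsilon>\<close>; this gives nuclearity of order 0, and
  expanding the diagonal entries to second order gives
  \<open>tr = 1 + \<epsilon> \<Sum>n. 2\<pi>i n \<bullet> \<psi>^((I - M)\<^sup>T n) + O(\<epsilon>\<^sup>2)\<close>. By Fourier inversion and orthogonality of the
  characters on the group of fixed points, the sum is \<open>B\<^sub>M(\<psi>)\<close>.

  Removing the invariant line of constants leaves a matrix of trace \<open>tr - 1\<close>, which is nonzero for small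
  \<open>\<epsilon> > 0\<close>. If it had no nonzero eigenvalue, the determinants of \<open>1 - zA\<close> for its finite truncations
  would be zero-free on larger and larger discs while growing at most like \<open>exp (C \<surd>|z|)\<close>; the
  Borel-Caratheodory estimate would then force the trace, which is minus the derivative at 0, to vanish.
  Hence there is a nonzero eigenvalue, and it is not 1 because the reduced operator is a contraction.\<close>

section \<open>Nonzero trace forces a nonzero eigenvalue\<close>

text \<open>For \<open>\<epsilon> = 0\<close> the operator sends the character of \<open>n\<close>
  to that of \<open>M^T n\<close>. Without weights this permutation of an orthonormal basis is
  unitary, hence not compact, so all decay has to come from the weights: \<open>|n|_M\<close> grows
  along \<open>n -> M^T n\<close> by at least a fixed multiple of \<open>|n|\<close>. Since 0 is the
  only frequency fixed by \<open>M^T\<close>, the unperturbed trace is exactly 1, and a further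
  eigenvalue can only be forced by the first-order term. This explains the choice of the good set as
  the set where \<open>B_M\<close> does not vanish: it is open because \<open>B_M\<close> is
  continuous, and dense because \<open>B_M\<close> is linear and nonzero, as an explicit sine
  perturbation shows.

  The constant \<open>c\<close> comes from \<open>M\<close> and \<open>r\<close> alone; only the
  admissible range of \<open>\<epsilon>\<close> depends on \<open>\<psi>\<close>.

  The Borel-Caratheodory step tolerates any growth of order below 1 in \<open>|z|\<close>. The
  entries are dominated by products of exponentially small weights whose square roots are still
  summable, and this gives order 1/2.\<close>

lemma norm_deriv_le_of_Re_less:
  assumes g: "g holomorphic_on ball 0 R" and "R > 0" and g0: "g 0 = 0"
    and B: "\<And>z. z \<in> ball 0 R \<Longrightarrow> Re (g z) < B"
  shows "norm (deriv g 0) \<le> 2 * B / R"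
proof -
  have Bpos: "B > 0" using B[of 0] g0 \<open>R > 0\<close> by simp
  \<comment> \<open>The Moebius map \<open>w / (2 * B - w)\<close> fixes 0 and carries the
    half-plane \<open>Re w < B\<close> into the unit disc, so the Schwarz lemma applies to the
    rescaled function.\<close>
  define h where "h = (\<lambda>z. g (of_real R * z) / (2 * of_real B - g (of_real R * z)))"
  have inb: "of_real R * z \<in> ball 0 R" if "norm z < 1" for z :: complex
    using that \<open>R > 0\<close> by (simp add: norm_mult)
  have nz: "2 * of_real B - g (of_real R * z) \<noteq> 0" if "norm z < 1" for z :: complex
  proof
    assume "2 * of_real B - g (of_real R * z) = 0"
    hence "g (of_real R * z) = 2 * of_real B" by simp
    hence "Re (g (of_real R * z)) = 2 * B" by simp
    with B[OF inb[OF that]] Bpos show False by simp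
  qed
  have hol1: "(\<lambda>z. g (of_real R * z)) holomorphic_on ball 0 1"
    by (rule holomorphic_on_compose_gen[OF _ g, unfolded o_def])
       (use inb in \<open>auto intro!: holomorphic_intros\<close>)
  have hol: "h holomorphic_on ball 0 1"
    unfolding h_def by (intro holomorphic_intros hol1) (use nz in auto)
  have lt: "norm (h z) < 1" if "norm z < 1" for z
  proof -
    define w where "w = g (of_real R * z)"
    have re: "Re w < B" using B[OF inb[OF that]] by (simp add: w_def)
    have "(norm w)\<^sup>2 < (norm (2 * of_real B - w))\<^sup>2"
    proof -
      have "(norm (2 * of_real B - w))\<^sup>2 = (2 * B - Re w)\<^sup>2 + (Im w)\<^sup>2"
        by (simp add: cmod_power2)
      moreover have "(2 * B - Re w)\<^sup>2 - (Re w)\<^sup>2 = 4 * B * (B - Re w)"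
        by (simp add: power2_eq_square algebra_simps)
      moreover have "4 * B * (B - Re w) > 0" using re Bpos by simp
      ultimately show ?thesis by (simp add: cmod_power2)
    qed
    hence "norm w < norm (2 * of_real B - w)"
      by (rule power2_less_imp_less) simp
    thus ?thesis unfolding h_def w_def[symmetric] norm_divide
      by (simp add: divide_less_eq)
  qed
  have h0: "h 0 = 0" by (simp add: h_def g0)
  have "norm (deriv h 0) \<le> 1"
    by (rule Schwarz_Lemma(2)[OF hol h0 lt, of 0]) auto
  moreover have "(h has_field_derivative (of_real R * deriv g 0) / (2 * of_real B)) (at 0)"
  proof -
    have "(g has_field_derivative deriv g 0) (at 0)"
      using g \<open>R > 0\<close> by (auto intro: holomorphic_derivI)
    hence "((\<lambda>z. g (of_real R * z)) has_field_derivative deriv g 0 * of_real R) (at 0)"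
      by (intro DERIV_chain2[where f = g and g = "\<lambda>z. of_real R * z"]) (auto intro!: derivative_eq_intros)
    note d = this
    show ?thesis unfolding h_def
      by (rule derivative_eq_intros d refl)+ (use g0 Bpos in \<open>auto simp: field_simps power2_eq_square\<close>)
  qed
  hence "deriv h 0 = (of_real R * deriv g 0) / (2 * of_real B)" by (rule DERIV_imp_deriv)
  ultimately show ?thesis using Bpos \<open>R > 0\<close>
    by (simp add: norm_divide norm_mult field_simps)
qed

text \<open>A zero-free function on a disc has a holomorphic logarithm. Normalised to vanish at 0,
  it has real part \<open>ln |D|\<close>, which is below \<open>B\<close>, and its derivative at 0
  is that of \<open>D\<close> because \<open>D 0 = 1\<close>.\<close>

lemma norm_deriv_le_of_nonvanishing:
  assumes D: "D holomorphic_on ball 0 R" and "R > 0" and D0: "D 0 = 1"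
    and nz: "\<And>z. z \<in> ball 0 R \<Longrightarrow> D z \<noteq> 0"
    and B: "\<And>z. z \<in> ball 0 R \<Longrightarrow> norm (D z) < exp B"
  shows "norm (deriv D 0) \<le> 2 * B / R"
proof -
  have "\<exists>g. g holomorphic_on ball 0 R \<and> (\<forall>z\<in>ball 0 R. D z = exp (g z))"
    by (rule contractible_imp_holomorphic_log[OF D _ nz])
       (auto simp: convex_imp_contractible)
  then obtain g1 where g1: "g1 holomorphic_on ball 0 R" "\<And>z. z \<in> ball 0 R \<Longrightarrow> D z = exp (g1 z)" by blast
  define g where "g = (\<lambda>z. g1 z - g1 0)"
  have e0: "exp (g1 0) = 1" using g1(2)[of 0] D0 \<open>R > 0\<close> by simp
  have g: "g holomorphic_on ball 0 R" unfolding g_def by (intro holomorphic_intros g1)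
  have Dg: "D z = exp (g z)" if "z \<in> ball 0 R" for z
    using g1(2)[OF that] e0 by (simp add: g_def exp_diff)
  have "norm (deriv g 0) \<le> 2 * B / R"
  proof (rule norm_deriv_le_of_Re_less[OF g \<open>R > 0\<close>])
    show "Re (g z) < B" if "z \<in> ball 0 R" for z
      using B[OF that] Dg[OF that] by simp
  qed (simp add: g_def)
  moreover have "(D has_field_derivative deriv g 0) (at 0)"
  proof (rule has_field_derivative_transform_within_open[of "\<lambda>z. exp (g z)" _ _ "ball 0 R"])
    have "(g has_field_derivative deriv g 0) (at 0)"
      using g \<open>R > 0\<close> by (auto intro: holomorphic_derivI)
    moreover have "exp (g 0) = 1" by (simp add: g_def)
    ultimately show "((\<lambda>z. exp (g z)) has_field_derivative deriv g 0) (at 0)"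
      using DERIV_chain2[OF DERIV_exp, of g "deriv g 0" 0] by simp
  qed (use Dg \<open>R > 0\<close> in auto)
  ultimately show ?thesis using DERIV_imp_deriv by metis
qed

section \<open>Determinants of I - zA for the leading n x n blocks, as Leibniz sums\<close>

definition fredholm_det :: "(nat \<Rightarrow> nat \<Rightarrow> complex) \<Rightarrow> nat \<Rightarrow> complex \<Rightarrow> complex" where
  "fredholm_det A n z = (\<Sum>p | p permutes {0..<n}. signof p *
     (\<Prod>i = 0..<n. (if i = p i then 1 else 0) - z * A i (p i)))"

text \<open>Restriction embeds the permutations into the set of all self-maps of the index set, and
  the product of the row sums expands into a sum over all those maps. Summing over rows keeps the
  bound a product of one factor per index, which is what the growth estimate uses.\<close>

lemma norm_leibniz_le:
  fixes X :: "nat \<Rightarrow> nat \<Rightarrow> complex"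
  shows "norm (\<Sum>p | p permutes {0..<n}. signof p * (\<Prod>i = 0..<n. X i (p i)))
    \<le> (\<Prod>i = 0..<n. \<Sum>j = 0..<n. norm (X i j))"
proof -
  let ?P = "{p. p permutes {0..<n}}" and ?F = "\<lambda>g. \<Prod>i = 0..<n. norm (X i (g i))"
  have "norm (\<Sum>p | p permutes {0..<n}. signof p * (\<Prod>i = 0..<n. X i (p i))) \<le> (\<Sum>p\<in>?P. ?F p)"
  proof (rule order_trans[OF norm_sum], rule sum_mono)
    fix p
    have "norm (signof p :: complex) = 1" by (simp add: sign_def)
    thus "norm (signof p * (\<Prod>i = 0..<n. X i (p i))) \<le> ?F p"
      by (simp add: norm_mult prod_norm)
  qed
  also have "\<dots> = (\<Sum>p\<in>?P. ?F (restrict p {0..<n}))"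
    by (intro sum.cong prod.cong) auto
  also have "\<dots> = (\<Sum>g\<in>(\<lambda>p. restrict p {0..<n}) ` ?P. ?F g)"
  proof (rule sum.reindex[symmetric, unfolded o_def])
    show "inj_on (\<lambda>p. restrict p {0..<n}) ?P"
    proof (rule inj_onI, rule ext)
      fix p q i assume pq: "p \<in> ?P" "q \<in> ?P" "restrict p {0..<n} = restrict q {0..<n}"
      show "p i = q i"
      proof (cases "i \<in> {0..<n}")
        case True thus ?thesis using pq(3) by (metis restrict_apply')
      next
        case False thus ?thesis using pq(1,2) by (metis mem_Collect_eq permutes_not_in)
      qed
    qed
  qed
  also have "\<dots> \<le> (\<Sum>g\<in>PiE {0..<n} (\<lambda>_. {0..<n}). ?F g)"
  proof (rule sum_mono2)
    show "(\<lambda>p. restrict p {0..<n}) ` ?P \<subseteq> PiE {0..<n} (\<lambda>_. {0..<n})"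
      using permutes_in_image by (fastforce simp: PiE_def)
  qed (auto intro!: finite_PiE prod_nonneg)
  also have "\<dots> = (\<Prod>i = 0..<n. \<Sum>j = 0..<n. norm (X i j))"
    by (rule prod_sum_PiE[symmetric]) auto
  finally show ?thesis .
qed

lemma norm_fredholm_det_le:
  "norm (fredholm_det A n z) \<le> (\<Prod>i = 0..<n. 1 + norm z * (\<Sum>j = 0..<n. norm (A i j)))"
proof -
  have "norm (fredholm_det A n z)
      \<le> (\<Prod>i = 0..<n. \<Sum>j = 0..<n. norm ((if i = j then 1 else 0) - z * A i j))"
    unfolding fredholm_det_def by (rule norm_leibniz_le)
  also have "\<dots> \<le> (\<Prod>i = 0..<n. 1 + norm z * (\<Sum>j = 0..<n. norm (A i j)))"
  proof (intro prod_mono conjI sum_nonneg norm_ge_zero)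
    fix i assume i: "i \<in> {0..<n}"
    have "(\<Sum>j = 0..<n. norm ((if i = j then 1 else 0) - z * A i j))
        \<le> (\<Sum>j = 0..<n. (if i = j then 1 else 0) + norm z * norm (A i j))"
      by (intro sum_mono order_trans[OF norm_triangle_ineq4]) (auto simp: norm_mult)
    also have "\<dots> = 1 + norm z * (\<Sum>j = 0..<n. norm (A i j))"
      using i by (simp add: sum.distrib sum_distrib_left)
    finally show "(\<Sum>j = 0..<n. norm ((if i = j then 1 else 0) - z * A i j)) \<le> \<dots>" .
  qed
  finally show ?thesis .
qed

lemma fredholm_det_holomorphic: "fredholm_det A n holomorphic_on S"
  unfolding fredholm_det_def by (intro holomorphic_intros)

lemma fredholm_det_0: "fredholm_det A n 0 = 1"
proof -
  have "(\<Prod>i = 0..<n. (if i = p i then 1 else 0) - 0 * A i (p i)) = (if p = id then 1 else 0)"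
    if p: "p permutes {0..<n}" for p
  proof (cases "p = id")
    case False
    then obtain i where "i \<in> {0..<n}" "p i \<noteq> i" using p by (metis eq_id_iff permutes_not_in)
    thus ?thesis using False by (auto intro!: prod_zero bexI[of _ i])
  qed auto
  hence "fredholm_det A n 0 = (\<Sum>p | p permutes {0..<n}. if p = id then signof p else 0)"
    unfolding fredholm_det_def by (intro sum.cong) auto
  also have "\<dots> = 1" by (subst sum.delta) (auto simp: finite_permutations permutes_id)
  finally show ?thesis .
qed

text \<open>A permutation other than the identity moves at least two indices, \<open>i\<close> and
  \<open>p i\<close>. Differentiating one factor of its product leaves another factor that vanishes
  at 0, so only the identity contributes and yields minus the trace.\<close>

lemma fredholm_det_deriv:
  "(fredholm_det A n has_field_derivative - (\<Sum>i = 0..<n. A i i)) (at 0)"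
proof -
  define d where "d p = (\<Sum>k = 0..<n. - A k (p k) * (\<Prod>i\<in>{0..<n} - {k}. (if i = p i then 1 else 0)))"
    for p
  have d: "((\<lambda>z. \<Prod>i = 0..<n. (if i = p i then 1 else 0) - z * A i (p i)) has_field_derivative d p) (at 0)"
    for p
  proof -
    have "((\<lambda>z. \<Prod>i\<in>{0..<n}. (if i = p i then 1 else 0) - z * A i (p i)) has_field_derivative
      (\<Sum>k\<in>{0..<n}. - A k (p k) * (\<Prod>i\<in>{0..<n} - {k}. (if i = p i then 1 else 0) - 0 * A i (p i)))) (at 0)"
      by (rule has_field_derivative_prod) (auto intro!: derivative_eq_intros)
    thus ?thesis by (simp add: d_def)
  qed
  have d0: "d p = (if p = id then - (\<Sum>i = 0..<n. A i i) else 0)" if p: "p permutes {0..<n}" for p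
  proof (cases "p = id")
    case True
    thus ?thesis by (simp add: d_def sum_negf)
  next
    case False
    then obtain i where i: "i \<in> {0..<n}" "p i \<noteq> i" using p by (metis eq_id_iff permutes_not_in)
    have j: "p i \<in> {0..<n}" "p (p i) \<noteq> p i"
      using i p by (metis permutes_in_image, metis permutes_inj injD)
    have pr: "(\<Prod>l\<in>{0..<n} - {k}. (if l = p l then 1 else 0)) = (0::complex)" for k
    proof (cases "k = i")
      case True thus ?thesis using i j by (intro prod_zero bexI[of _ "p i"]) auto
    next
      case False thus ?thesis using i j by (intro prod_zero bexI[of _ "i"]) auto
    qed
    show ?thesis using False unfolding d_def pr by simp
  qed
  have "(fredholm_det A n has_field_derivative (\<Sum>p | p permutes {0..<n}. signof p * d p)) (at 0)"
    unfolding fredholm_det_def by (intro DERIV_sum DERIV_cmult d)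
  also have "(\<Sum>p | p permutes {0..<n}. signof p * d p)
     = (\<Sum>p | p permutes {0..<n}. if p = id then - (\<Sum>i = 0..<n. A i i) else 0)"
    by (intro sum.cong) (auto simp: d0)
  also have "\<dots> = - (\<Sum>i = 0..<n. A i i)"
    by (subst sum.delta) (auto simp: finite_permutations permutes_id)
  finally show ?thesis .
qed

text \<open>A kernel vector of the block, divided by its largest modulus and continued by zero. This
  normalisation does not depend on \<open>n\<close>: it bounds every coordinate by 1 and leaves one
  coordinate of modulus exactly 1, which a limit over \<open>n\<close> will need in order not to
  vanish.\<close>

lemma fredholm_det_eq_0:
  assumes "fredholm_det A n z = 0"
  obtains v where "\<And>i. i \<ge> n \<Longrightarrow> v i = 0" "\<And>i. norm (v i) \<le> 1" "\<exists>i<n. norm (v i) = 1"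
    "\<And>i. i < n \<Longrightarrow> v i = z * (\<Sum>j<n. A i j * v j)"
proof -
  let ?X = "Matrix.mat n n (\<lambda>(i,j). (if i = j then 1 else 0) - z * A i j)"
  have "Determinant.det ?X = fredholm_det A n z"
    unfolding fredholm_det_def
    by (subst det_def'[of _ n])
       (auto intro!: sum.cong prod.cong arg_cong2[of _ _ _ _ "(*)"] simp: permutes_in_image)
  with assms have "Determinant.det ?X = 0" by simp
  then obtain u where u: "u \<in> carrier_vec n" "u \<noteq> 0\<^sub>v n" "?X *\<^sub>v u = 0\<^sub>v n"
    using det_0_iff_vec_prod_zero_field[of ?X n] by auto
  define f where "f i = (if i < n then vec_index u i else 0)" for i
  have eq: "f i = z * (\<Sum>j<n. A i j * f j)" if "i < n" for i
  proof -
    have "0 = vec_index (?X *\<^sub>v u) i" using u(3) that by simp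
    also have "\<dots> = (\<Sum>j<n. ((if i = j then 1 else 0) - z * A i j) * f j)"
      using that u(1) by (auto simp: scalar_prod_def lessThan_atLeast0 f_def intro!: sum.cong)
    also have "\<dots> = (\<Sum>j<n. (if i = j then f j else 0)) - (\<Sum>j<n. z * (A i j * f j))"
      unfolding sum_subtractf[symmetric] by (intro sum.cong) (auto simp: left_diff_distrib)
    also have "(\<Sum>j<n. (if i = j then f j else 0)) = f i" using that by simp
    finally show ?thesis by (simp add: sum_distrib_left)
  qed
  have ne: "\<exists>i<n. f i \<noteq> 0"
  proof (rule ccontr)
    assume "\<not> ?thesis"
    hence "u = 0\<^sub>v n" using u(1) by (intro eq_vecI) (auto simp: f_def)
    thus False using u(2) by simp
  qed
  hence "n > 0" by auto
  define m where "m = Max ((\<lambda>i. norm (f i)) ` {..<n})"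
  have m: "norm (f i) \<le> m" if "i < n" for i unfolding m_def using that by (intro Max_ge) auto
  have "m \<in> (\<lambda>i. norm (f i)) ` {..<n}" unfolding m_def by (intro Max_in) (use \<open>n > 0\<close> in auto)
  then obtain i0 where i0: "i0 < n" "norm (f i0) = m" by auto
  have mpos: "m > 0" using ne m by (meson less_le_trans zero_less_norm_iff)
  show ?thesis
  proof (rule that[of "\<lambda>i. f i / of_real m"])
    show "f i / of_real m = z * (\<Sum>j<n. A i j * (f j / of_real m))" if "i < n" for i
      by (subst eq[OF that]) (simp add: sum_divide_distrib[symmetric])
    show "norm (f i / of_real m) \<le> 1" for i
      using m[of i] mpos by (cases "i < n") (auto simp: f_def norm_divide)
    show "\<exists>i<n. norm (f i / of_real m) = 1"
      using i0 mpos by (intro exI[of _ i0]) (auto simp: norm_divide)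
  qed (auto simp: f_def)
qed

section \<open>Compactness for the normalised kernel vectors\<close>

lemma diagonal_convergent_subseq:
  fixes x :: "nat \<Rightarrow> nat \<Rightarrow> complex"
  assumes bd: "\<And>i. bounded (range (\<lambda>k. x k i))"
  obtains r where "strict_mono r" "\<And>i. convergent (\<lambda>k. x (r k) i)"
proof -
  interpret d: subseqs "\<lambda>i s. convergent (\<lambda>k. x (s k) i)"
  proof
    fix i and s :: "nat \<Rightarrow> nat"
    have "bounded (range (\<lambda>k. x (s k) i))" by (rule bounded_subset[OF bd[of i]]) auto
    from bounded_imp_convergent_subsequence[OF this] obtain l r
      where "strict_mono (r :: nat \<Rightarrow> nat)" "((\<lambda>k. x (s k) i) \<circ> r) \<longlonglongrightarrow> l" by blast
    thus "\<exists>r'. strict_mono r' \<and> convergent (\<lambda>k. x ((s \<circ> r') k) i)"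
      by (auto simp: o_def convergent_def)
  qed
  show ?thesis
  proof (rule that[OF d.subseq_diagseq])
    fix i
    \<comment> \<open>The tail of the diagonal sequence that begins at index \<open>Suc i\<close> is
      a subsequence of the one chosen to make coordinate \<open>i\<close> converge.\<close>
    have "convergent (\<lambda>k. x ((d.diagseq \<circ> (+) (Suc i)) k) i)"
    proof (rule d.diagseq_holds)
      fix r s :: "nat \<Rightarrow> nat" and i assume "strict_mono r" "convergent (\<lambda>k. x (s k) i)"
      thus "convergent (\<lambda>k. x ((s \<circ> r) k) i)"
        using convergent_subseq_convergent[of "\<lambda>k. x (s k) i" r] by (simp add: o_def)
    qed
    hence "convergent (\<lambda>k. x (d.diagseq (k + Suc i)) i)" by (simp add: o_def add.commute)
    thus "convergent (\<lambda>k. x (d.diagseq k) i)"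
      by (subst (asm) convergent_ignore_initial_segment)
  qed
qed

text \<open>The equation \<open>v = z A v\<close> improves the bound 1 on the coordinates to
  \<open>R * W * w i\<close>, uniformly in the truncation. A limit along a diagonal subsequence
  therefore loses no mass at infinity, and dominated convergence carries the equation over to it.
  The eigenvalue is the reciprocal of the limit of the zeros.\<close>

lemma eigenvector_of_fredholm_zeros:
  fixes A :: "nat \<Rightarrow> nat \<Rightarrow> complex" and w :: "nat \<Rightarrow> real"
  assumes A: "\<And>i j. norm (A i j) \<le> w i * w j" and w0: "\<And>i. 0 \<le> w i" and sw: "summable w"
    and freq: "\<And>N. \<exists>n\<ge>N. \<exists>z. norm z \<le> R \<and> fredholm_det A n z = 0"
  obtains \<mu> v K where "\<mu> \<noteq> 0" "\<exists>i. v i \<noteq> 0" "\<And>i. norm (v i) \<le> K * w i"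
    "\<And>i. (\<lambda>j. A i j * v j) sums (\<mu> * v i)"
proof -
  have "\<exists>n z v. n \<ge> N \<and> norm z \<le> R \<and> (\<forall>i\<ge>n. v i = 0) \<and> (\<forall>i. norm (v i) \<le> 1) \<and>
     (\<exists>i<n. norm (v i) = 1) \<and> (\<forall>i<n. v i = z * (\<Sum>j<n. A i j * v j))" for N
  proof -
    obtain n z where "n \<ge> N" "norm z \<le> R" "fredholm_det A n z = 0" using freq by blast
    moreover from fredholm_det_eq_0[OF this(3)] obtain v where "\<And>i. i \<ge> n \<Longrightarrow> v i = 0"
      "\<And>i. norm (v i) \<le> 1" "\<exists>i<n. norm (v i) = 1"
      "\<And>i. i < n \<Longrightarrow> v i = z * (\<Sum>j<n. A i j * v j)" by blast
    ultimately show ?thesis by (intro exI[of _ n] exI[of _ z] exI[of _ v]) simp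
  qed
  hence "\<forall>N. \<exists>t. fst t \<ge> N \<and> norm (fst (snd t)) \<le> R \<and> (\<forall>i\<ge>fst t. snd (snd t) i = 0) \<and>
      (\<forall>i. norm (snd (snd t) i) \<le> 1) \<and> (\<exists>i<fst t. norm (snd (snd t) i) = 1) \<and>
      (\<forall>i<fst t. snd (snd t) i = fst (snd t) * (\<Sum>j<fst t. A i j * snd (snd t) j))"
    by simp
  from choice[OF this] obtain t where t: "\<forall>N. fst (t N) \<ge> N \<and> norm (fst (snd (t N))) \<le> R \<and>
      (\<forall>i\<ge>fst (t N). snd (snd (t N)) i = 0) \<and>
      (\<forall>i. norm (snd (snd (t N)) i) \<le> 1) \<and> (\<exists>i<fst (t N). norm (snd (snd (t N)) i) = 1) \<and>
      (\<forall>i<fst (t N). snd (snd (t N)) i = fst (snd (t N)) * (\<Sum>j<fst (t N). A i j * snd (snd (t N)) j))" ..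
  define n where "n = (\<lambda>N. fst (t N))"
  define z where "z = (\<lambda>N. fst (snd (t N)))"
  define v where "v = (\<lambda>N. snd (snd (t N)))"
  note t = t[rule_format, folded n_def z_def v_def]
  have nzv: "\<And>k. n k \<ge> k" "\<And>k. norm (z k) \<le> R" "\<And>k i. i \<ge> n k \<Longrightarrow> v k i = 0"
    "\<And>k i. norm (v k i) \<le> 1" "\<And>k. \<exists>i<n k. norm (v k i) = 1"
    "\<And>k i. i < n k \<Longrightarrow> v k i = z k * (\<Sum>j<n k. A i j * v k j)"
    using t by (simp_all add: n_def z_def v_def)
  define W where "W = suminf w"
  have R0: "R \<ge> 0" using nzv(2)[of 0] norm_ge_zero order_trans by blast
  have W0: "W \<ge> 0" unfolding W_def by (rule suminf_nonneg[OF sw w0])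
  have Av: "norm (A i j * v k j) \<le> w i * w j" for i j k
  proof -
    have "norm (A i j) * norm (v k j) \<le> (w i * w j) * 1"
      using A nzv(4) by (intro mult_mono) (auto simp: w0)
    thus ?thesis by (simp add: norm_mult)
  qed
  have vb: "norm (v k i) \<le> R * W * w i" for k i
  proof (cases "i < n k")
    case True
    have "norm (\<Sum>j<n k. A i j * v k j) \<le> (\<Sum>j<n k. w i * w j)"
      by (rule sum_norm_le) (use Av in auto)
    also have "\<dots> = w i * (\<Sum>j<n k. w j)" by (simp add: sum_distrib_left)
    also have "\<dots> \<le> w i * W" unfolding W_def
      by (intro mult_left_mono sum_le_suminf sw) (auto simp: w0)
    finally have "norm (z k) * norm (\<Sum>j<n k. A i j * v k j) \<le> R * (w i * W)"
      by (intro mult_mono nzv) (auto simp: R0)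
    thus ?thesis using arg_cong[OF nzv(6)[OF True], of norm] by (simp add: norm_mult mult_ac)
  next
    case False thus ?thesis using nzv(3) R0 W0 w0 by simp
  qed
  \<comment> \<open>Slot 0 holds the zero and slot \<open>Suc j\<close> holds coordinate
    \<open>j\<close> of the vector, so a single diagonal argument makes all of them
    converge.\<close>
  define x where "x k i = (case i of 0 \<Rightarrow> z k | Suc j \<Rightarrow> v k j)" for k i
  have "bounded (range (\<lambda>k. x k i))" for i
    unfolding bounded_iff x_def using nzv(2,4) by (cases i) (auto intro: exI[of _ R] exI[of _ 1])
  then obtain r where r: "strict_mono r" "\<And>i. convergent (\<lambda>k. x (r k) i)"
    using diagonal_convergent_subseq by metis
  obtain \<zeta> where \<zeta>: "(\<lambda>k. z (r k)) \<longlonglongrightarrow> \<zeta>" using r(2)[of 0] by (auto simp: x_def convergent_def)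
  have "\<exists>l. (\<lambda>k. v (r k) i) \<longlonglongrightarrow> l" for i using r(2)[of "Suc i"] by (auto simp: x_def convergent_def)
  then obtain l where l: "\<And>i. (\<lambda>k. v (r k) i) \<longlonglongrightarrow> l i" by metis
  have lb: "norm (l i) \<le> R * W * w i" for i
    by (rule LIMSEQ_le_const2[OF tendsto_norm[OF l]]) (use vb in auto)
  have sA: "summable (\<lambda>j. A i j * l j)" for i
  proof (rule summable_comparison_test)
    show "summable (\<lambda>j. w i * (w j))" by (intro summable_mult sw)
    have l1: "norm (l j) \<le> 1" for j
      by (rule LIMSEQ_le_const2[OF tendsto_norm[OF l]]) (use nzv in auto)
    have "norm (A i j) * norm (l j) \<le> (w i * w j) * 1" for j
      by (intro mult_mono A l1) (auto simp: w0)
    thus "\<exists>N. \<forall>j\<ge>N. norm (A i j * l j) \<le> w i * w j"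
      by (simp add: norm_mult)
  qed
  have eq: "l i = \<zeta> * (\<Sum>j. A i j * l j)" for i
  proof -
    have "(\<lambda>k. \<Sum>j. A i j * v (r k) j) \<longlonglongrightarrow> (\<Sum>j. A i j * l j)"
      by (rule tannerys_theorem[where M = "\<lambda>j. w i * w j", THEN conjunct2, THEN conjunct2])
         (auto intro!: tendsto_intros l summable_mult sw simp: Av split_def)
    hence "(\<lambda>k. z (r k) * (\<Sum>j. A i j * v (r k) j)) \<longlonglongrightarrow> \<zeta> * (\<Sum>j. A i j * l j)"
      by (intro tendsto_mult \<zeta>)
    moreover have "\<forall>\<^sub>F k in sequentially. z (r k) * (\<Sum>j. A i j * v (r k) j) = v (r k) i"
    proof (rule eventually_mono[OF eventually_gt_at_top[of i]])
      fix k assume "i < k"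
      also have "k \<le> n (r k)" using nzv(1)[of "r k"] seq_suble[OF r(1), of k] by simp
      finally have "v (r k) i = z (r k) * (\<Sum>j<n (r k). A i j * v (r k) j)" by (rule nzv)
      also have "(\<Sum>j<n (r k). A i j * v (r k) j) = (\<Sum>j. A i j * v (r k) j)"
        by (rule suminf_finite[symmetric]) (use nzv(3) in auto)
      finally show "z (r k) * (\<Sum>j. A i j * v (r k) j) = v (r k) i" ..
    qed
    ultimately have "(\<lambda>k. v (r k) i) \<longlonglongrightarrow> \<zeta> * (\<Sum>j. A i j * l j)"
      by (rule Lim_transform_eventually)
    thus ?thesis using l LIMSEQ_unique by blast
  qed
  \<comment> \<open>Beyond some \<open>I\<close> the uniform bound is below 1, so the coordinate of
    modulus 1 always has index less than \<open>I\<close>. The finite sum over these indices is at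
    least 1 for every \<open>k\<close>, hence also in the limit.\<close>
  have nz: "\<exists>i. l i \<noteq> 0"
  proof -
    have "(\<lambda>i. R * W * w i) \<longlonglongrightarrow> R * W * 0"
      by (intro tendsto_intros summable_LIMSEQ_zero sw)
    hence "\<forall>\<^sub>F i in sequentially. R * W * w i < 1" by (auto intro: order_tendstoD)
    then obtain I where I: "\<And>i. i \<ge> I \<Longrightarrow> R * W * w i < 1" by (auto simp: eventually_sequentially)
    have "1 \<le> (\<Sum>i<I. norm (v k i))" for k
    proof -
      obtain i where i: "norm (v k i) = 1" using nzv(5) by blast
      have "i < I" using I[of i] vb[of k i] i by force
      thus ?thesis using member_le_sum[of i "{..<I}" "\<lambda>i. norm (v k i)"] i by simp
    qed
    moreover have "(\<lambda>k. \<Sum>i<I. norm (v (r k) i)) \<longlonglongrightarrow> (\<Sum>i<I. norm (l i))"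
      by (intro tendsto_intros l)
    ultimately have "1 \<le> (\<Sum>i<I. norm (l i))" by (intro LIMSEQ_le_const) auto
    thus ?thesis by (metis norm_zero not_one_le_zero sum.neutral)
  qed
  have "\<zeta> \<noteq> 0" proof
    assume "\<zeta> = 0"
    hence "l i = 0" for i using eq[of i] by simp
    thus False using nz by simp
  qed
  show ?thesis
  proof (rule that[of "1 / \<zeta>" l "R * W"])
    show "(\<lambda>j. A i j * l j) sums (1 / \<zeta> * l i)" for i
      using summable_sums[OF sA[of i]] eq[of i] \<open>\<zeta> \<noteq> 0\<close> by (simp add: field_simps)
  qed (use \<open>\<zeta> \<noteq> 0\<close> nz lb in auto)
qed

text \<open>Both sides are compared with \<open>(1 + sqrt x)^2\<close>. Trading a factor
  \<open>1 + x\<close> for an exponential of \<open>sqrt x\<close> is what lowers the growth of the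
  determinants to order 1/2.\<close>

lemma ln_one_plus_le_sqrt: "x \<ge> 0 \<Longrightarrow> 1 + x \<le> exp (2 * sqrt x)"
proof -
  assume "x \<ge> 0"
  hence "1 + x \<le> (1 + sqrt x)\<^sup>2" by (simp add: power2_sum)
  also have "\<dots> \<le> (exp (sqrt x))\<^sup>2" by (intro power_mono exp_ge_add_one_self) (use \<open>x \<ge> 0\<close> in auto)
  finally show ?thesis by (simp add: exp_double)
qed

text \<open>The exponents of the factors add up to \<open>2 * sqrt (R * W) * S\<close>; this is
  where summability of \<open>sqrt (w i)\<close> enters. The derivative bound divides the exponent
  by \<open>R\<close>, leaving a quantity of size \<open>1 / sqrt R\<close>, so zero-free discs of
  every radius force the trace to be 0.\<close>

theorem eigenvalue_of_nonzero_trace: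
  fixes A :: "nat \<Rightarrow> nat \<Rightarrow> complex" and w :: "nat \<Rightarrow> real"
  assumes A: "\<And>i j. norm (A i j) \<le> w i * w j" and w0: "\<And>i. 0 \<le> w i" and w1: "\<And>i. w i \<le> 1"
    and sw: "summable (\<lambda>i. sqrt (w i))" and tr: "(\<Sum>i. A i i) \<noteq> 0"
  obtains \<mu> v K where "\<mu> \<noteq> 0" "\<exists>i. v i \<noteq> 0" "\<And>i. norm (v i) \<le> K * w i"
    "\<And>i. (\<lambda>j. A i j * v j) sums (\<mu> * v i)"
proof (rule ccontr)
  assume no: "\<not> thesis"
  note goal = that
  have w_sqrt: "w i \<le> sqrt (w i)" for i
  proof -
    have "sqrt (w i) * sqrt (w i) \<le> 1 * sqrt (w i)"
      by (intro mult_right_mono) (use w0 w1 in auto)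
    thus ?thesis using w0[of i] by simp
  qed
  have sw': "summable w"
    by (rule summable_comparison_test[OF _ sw]) (use w_sqrt w0 in auto)
  define W where "W = suminf w"
  define S where "S = (\<Sum>i. sqrt (w i))"
  have W0: "W \<ge> 0" unfolding W_def by (rule suminf_nonneg[OF sw' w0])
  have S0: "S \<ge> 0" unfolding S_def by (rule suminf_nonneg[OF sw]) (simp add: w0)
  have det_le: "norm (fredholm_det A n z) \<le> exp (2 * sqrt (R * W) * S)" if z: "norm z \<le> R" for n z R
  proof -
    have R0: "R \<ge> 0" using z norm_ge_zero order_trans by blast
    have "norm (fredholm_det A n z) \<le> (\<Prod>i = 0..<n. 1 + norm z * (\<Sum>j = 0..<n. norm (A i j)))"
      by (rule norm_fredholm_det_le)
    also have "\<dots> \<le> (\<Prod>i = 0..<n. exp (2 * sqrt (R * W) * sqrt (w i)))"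
    proof (intro prod_mono conjI)
      fix i
      have "(\<Sum>j = 0..<n. norm (A i j)) \<le> (\<Sum>j = 0..<n. w i * w j)" by (intro sum_mono A)
      also have "\<dots> = w i * (\<Sum>j = 0..<n. w j)" by (simp add: sum_distrib_left)
      also have "\<dots> \<le> w i * W" unfolding W_def
        by (intro mult_left_mono sum_le_suminf sw') (auto simp: w0)
      finally have "norm z * (\<Sum>j = 0..<n. norm (A i j)) \<le> R * (w i * W)"
        by (intro mult_mono z) (auto simp: R0 sum_nonneg)
      hence "1 + norm z * (\<Sum>j = 0..<n. norm (A i j)) \<le> 1 + R * (w i * W)" by simp
      also have "\<dots> \<le> exp (2 * sqrt (R * (w i * W)))"
        by (rule ln_one_plus_le_sqrt) (simp add: R0 w0 W0)
      finally show "1 + norm z * (\<Sum>j = 0..<n. norm (A i j)) \<le> exp (2 * sqrt (R * W) * sqrt (w i))"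
        by (simp add: real_sqrt_mult mult_ac)
    qed (auto intro!: add_nonneg_nonneg mult_nonneg_nonneg sum_nonneg)
    also have "\<dots> = exp (2 * sqrt (R * W) * (\<Sum>i<n. sqrt (w i)))"
      by (simp add: exp_sum sum_distrib_left lessThan_atLeast0)
    also have "\<dots> \<le> exp (2 * sqrt (R * W) * S)" unfolding S_def
      by (subst exp_le_cancel_iff, intro mult_left_mono sum_le_suminf sw) (auto simp: w0 R0 W0)
    finally show ?thesis .
  qed
  \<comment> \<open>The added 1 turns the bound on the determinants into a strict one, as the
    half-plane argument requires.\<close>
  have bound: "norm (\<Sum>i. A i i) \<le> 2 * (2 * sqrt (R * W) * S + 1) / R" if "R > 0" for R
  proof -
    \<comment> \<open>Dichotomy for fixed \<open>R\<close>: zeros in the disc for arbitrarily large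
      blocks would produce an eigenvector by compactness, so all large blocks are zero-free
      there.\<close>
    have "\<not> (\<forall>N. \<exists>n\<ge>N. \<exists>z. norm z \<le> R \<and> fredholm_det A n z = 0)"
    proof
      assume "\<forall>N. \<exists>n\<ge>N. \<exists>z. norm z \<le> R \<and> fredholm_det A n z = 0"
      hence "\<exists>n\<ge>N. \<exists>z. norm z \<le> R \<and> fredholm_det A n z = 0" for N by blast
      thus False
      proof (rule eigenvector_of_fredholm_zeros[OF A w0 sw'])
        fix \<mu> v K assume "\<mu> \<noteq> 0" "\<exists>i. v i \<noteq> 0" "\<And>i. norm (v i) \<le> K * w i"
          "\<And>i. (\<lambda>j. A i j * v j) sums (\<mu> * v i)"
        hence thesis by (rule goal)
        with no show False by simp
      qed
    qed
    then obtain N where N: "\<And>n z. n \<ge> N \<Longrightarrow> norm z \<le> R \<Longrightarrow> fredholm_det A n z \<noteq> 0" by blast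
    have fin: "norm (\<Sum>i<n. A i i) \<le> 2 * (2 * sqrt (R * W) * S + 1) / R" if n: "n \<ge> N" for n
    proof -
      have "norm (deriv (fredholm_det A n) 0) \<le> 2 * (2 * sqrt (R * W) * S + 1) / R"
      proof (rule norm_deriv_le_of_nonvanishing)
        fix z :: complex assume "z \<in> ball 0 R"
        hence z: "norm z \<le> R" by simp
        show "fredholm_det A n z \<noteq> 0" by (rule N[OF n z])
        show "norm (fredholm_det A n z) < exp (2 * sqrt (R * W) * S + 1)"
          by (rule le_less_trans[OF det_le[OF z]]) simp
      qed (auto simp: fredholm_det_holomorphic fredholm_det_0 \<open>R > 0\<close>)
      also have "deriv (fredholm_det A n) 0 = - (\<Sum>i<n. A i i)"
        using DERIV_imp_deriv[OF fredholm_det_deriv] by (simp add: lessThan_atLeast0)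
      finally show ?thesis by simp
    qed
    have "summable (\<lambda>i. A i i)"
    proof (rule summable_comparison_test[OF _ sw'])
      have "norm (A i i) \<le> w i" for i
        using A[of i i] mult_left_mono[OF w1[of i] w0[of i]] by simp
      thus "\<exists>N. \<forall>i\<ge>N. norm (A i i) \<le> w i" by auto
    qed
    hence "(\<lambda>n. \<Sum>i<n. A i i) \<longlonglongrightarrow> (\<Sum>i. A i i)" by (rule summable_LIMSEQ)
    from LIMSEQ_le_const2[OF tendsto_norm[OF this]] fin show ?thesis by blast
  qed
  have "((\<lambda>R. 2 * (2 * sqrt (R * W) * S + 1) / R) \<longlongrightarrow> 0) at_top"
  proof -
    have "((\<lambda>R. 4 * sqrt W * S * (sqrt R / R) + 2 / R) \<longlongrightarrow> 4 * sqrt W * S * 0 + 0) at_top"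
    proof (intro tendsto_intros)
      show "((\<lambda>R. sqrt R / R) \<longlongrightarrow> 0) at_top" by real_asymp
      show "((\<lambda>R::real. 2 / R) \<longlongrightarrow> 0) at_top" by real_asymp
    qed
    thus ?thesis by (simp add: real_sqrt_mult algebra_simps add_divide_distrib)
  qed
  moreover have "\<forall>\<^sub>F R in at_top. norm (\<Sum>i. A i i) \<le> 2 * (2 * sqrt (R * W) * S + 1) / R"
    using bound by (intro eventually_mono[OF eventually_gt_at_top[of 0]]) auto
  ultimately have "norm (\<Sum>i. A i i) \<le> 0"
    by (intro tendsto_lowerbound) auto
  thus False using tr by simp
qed

no_notation Matrix.vec_index (infixl "$" 100)
no_notation fps_nth (infixl "$" 75)
hide_fact (open) Matrix.vec_eq_iff
hide_const (open) Matrix.mat Matrix.vec Determinant.det Matrix.row Matrix.col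

section \<open>Fourier series on the torus\<close>

abbreviation ubox :: "(real^2) set" where "ubox \<equiv> cbox 0 1"

lemma mem_ubox: "x \<in> ubox \<longleftrightarrow> (\<forall>i. 0 \<le> x$i \<and> x$i \<le> 1)"
  by (simp add: mem_box_cart)

lemma content_ubox: "measure lborel ubox = 1"
proof -
  have "ubox \<noteq> {}" using mem_ubox[of 0] by auto
  thus ?thesis by (simp add: content_cbox_cart)
qed

text \<open>Cut and paste: the translated cube is cut along \<open>x $ j = 1\<close>, and the part
  beyond the cut, moved back by one period, fills the slab \<open>x $ j \<le> t\<close> that the
  translation has left free.\<close>

lemma integral_ubox_shift:
  fixes f :: "real^2 \<Rightarrow> 'a::euclidean_space"
  assumes f: "continuous_on UNIV f" and per: "\<And>x. f (x + axis j 1) = f x" and t: "0 \<le> t" "t \<le> 1"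
  shows "integral ubox (\<lambda>x. f (x + t *\<^sub>R axis j 1)) = integral ubox f"
proof -
  let ?e = "t *\<^sub>R axis j 1 :: real^2" and ?b = "(\<chi> i. if i = j then t else 1) :: real^2"
  have e: "?e $ i = (if i = j then t else 0)" for i by (simp add: axis_def)
  have a: "(axis j 1 :: real^2) $ i = (if i = j then 1 else 0)" for i by (simp add: axis_def)
  have int: "f integrable_on cbox a b" for a b
    using f by (intro integrable_continuous) (auto intro: continuous_on_subset)
  have in_ax: "x \<bullet> axis j 1 = x $ j" for x :: "real^2" by (simp add: inner_axis)
  have B: "(axis j 1 :: real^2) \<in> Basis" by (simp add: axis_in_Basis_iff)
  have "integral ubox (\<lambda>x. f (x + ?e)) = integral (cbox (0 + ?e) (1 + ?e)) f"
    using integral_shift_cbox_plus[of 0 "1" f ?e] by (simp add: o_def add.commute)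
  also have "\<dots> = integral (cbox (0 + ?e) (1 + ?e) \<inter> {x. x $ j \<le> 1}) f
      + integral (cbox (0 + ?e) (1 + ?e) \<inter> {x. x $ j \<ge> 1}) f"
    using integral_split[OF int B, of "0 + ?e" "1 + ?e" 1] by (simp add: in_ax)
  also have "cbox (0 + ?e) (1 + ?e) \<inter> {x. x $ j \<le> 1} = ubox \<inter> {x. x $ j \<ge> t}"
    using t exhaust_2[of j] by (auto simp: mem_box_cart e forall_2 axis_def)
  also have "cbox (0 + ?e) (1 + ?e) \<inter> {x. x $ j \<ge> 1} = cbox (0 + axis j 1) (?b + axis j 1)"
    using t exhaust_2[of j] by (auto simp: mem_box_cart e a forall_2 axis_def)
  also have "integral \<dots> f = integral (cbox 0 ?b) f"
    using integral_shift_cbox_plus[of 0 ?b f "axis j 1"] per by (simp add: o_def add.commute)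
  also have "cbox 0 ?b = ubox \<inter> {x. x $ j \<le> t}"
    using t exhaust_2[of j] by (auto simp: mem_box_cart forall_2 axis_def)
  also have "integral (ubox \<inter> {x. x $ j \<ge> t}) f + integral (ubox \<inter> {x. x $ j \<le> t}) f = integral ubox f"
    using integral_split[OF int B, of "0" "1" t] by (simp add: in_ax)
  finally show ?thesis .
qed

text \<open>Averaging over the translates along a coordinate circle leaves the integral unchanged.
  After exchanging the integrals, the inner one is a one-variable integral over a full period, to
  which a contour shift can be applied.\<close>

lemma integral_ubox_average:
  fixes f :: "real^2 \<Rightarrow> 'a::euclidean_space"
  assumes f: "continuous_on UNIV f" and per: "\<And>x. f (x + axis j 1) = f x"
  shows "integral ubox f = integral ubox (\<lambda>x. integral {0..1} (\<lambda>t. f (x + t *\<^sub>R axis j 1)))"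
proof -
  have "continuous_on (cbox (0, 0) (1, 1)) (\<lambda>(t::real, x). f (x + t *\<^sub>R axis j 1))"
    unfolding split_def
    by (rule continuous_on_compose2[OF f]) (auto intro!: continuous_intros)
  from integral_swap_continuous[OF this]
  have "integral (cbox 0 1) (\<lambda>t. integral ubox (\<lambda>x. f (x + t *\<^sub>R axis j 1)))
     = integral ubox (\<lambda>x. integral (cbox 0 1) (\<lambda>t. f (x + t *\<^sub>R axis j 1)))" .
  moreover have "integral (cbox 0 1) (\<lambda>t. integral ubox (\<lambda>x. f (x + t *\<^sub>R axis j 1)))
     = integral (cbox 0 (1::real)) (\<lambda>t. integral ubox f)"
    by (intro integral_cong integral_ubox_shift f per) auto
  ultimately show ?thesis by simp
qed

section \<open>Characters of the torus and their orthogonality\<close>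

lemma ndot_2: "ndot n x = real_of_int (n$1) * x$1 + real_of_int (n$2) * x$2"
  by (simp add: ndot_def sum_2)

lemma ndot_0 [simp]: "ndot 0 x = 0"
  by (simp add: ndot_2)

lemma ndot_add: "ndot n (x + y) = ndot n x + ndot n y"
  by (simp add: ndot_2 algebra_simps)

lemma ndot_add_left: "ndot (m + n) x = ndot m x + ndot n x"
  by (simp add: ndot_2 algebra_simps)

lemma ndot_diff_left: "ndot (m - n) x = ndot m x - ndot n x"
  by (simp add: ndot_2 algebra_simps)

lemma ndot_minus_left: "ndot (- n) x = - ndot n x"
  by (simp add: ndot_2 algebra_simps)

lemma ndot_scale_axis: "ndot n (t *\<^sub>R axis j 1) = real_of_int (n$j) * t"
  by (cases j rule: exhaust_2[THEN disjE]) (auto simp: ndot_2 axis_def exhaust_2)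

lemma ndot_axis: "ndot n (axis j 1) = real_of_int (n$j)"
  using ndot_scale_axis[of n 1 j] by simp

lemma ndot_axis_left: "ndot (axis j 1) x = x$j"
  using exhaust_2[of j] by (auto simp: ndot_2 axis_def)

lemma continuous_on_ndot [continuous_intros]:
  "continuous_on S f \<Longrightarrow> continuous_on S (\<lambda>x. ndot n (f x))"
  unfolding ndot_2 by (intro continuous_intros)

definition echar :: "int^2 \<Rightarrow> real^2 \<Rightarrow> complex" where
  "echar n x = cis (2 * pi * ndot n x)"

lemma echar_add_left: "echar (m + n) x = echar m x * echar n x"
  by (simp add: echar_def ndot_add_left cis_mult algebra_simps)

lemma echar_add: "echar n (x + y) = echar n x * echar n y"
  by (simp add: echar_def ndot_add cis_mult algebra_simps)

lemma echar_0 [simp]: "echar 0 x = 1"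
  by (simp add: echar_def ndot_2)

lemma norm_echar [simp]: "norm (echar n x) = 1"
  by (simp add: echar_def)

lemma echar_eq_1: "ndot n x \<in> \<int> \<Longrightarrow> echar n x = 1"
  by (auto simp: echar_def cis_multiple_2pi)

lemma echar_axis [simp]: "echar n (x + axis j 1) = echar n x"
  by (simp add: echar_add echar_eq_1 ndot_axis)

lemma continuous_on_echar [continuous_intros]:
  "continuous_on S f \<Longrightarrow> continuous_on S (\<lambda>x. echar n (f x))"
  unfolding echar_def by (intro continuous_intros)

lemma fourier_echar: "fourier F k = integral ubox (\<lambda>x. F x * echar (- k) x)"
  by (simp add: fourier_def echar_def ndot_minus_left)

lemma integral_echar: "integral ubox (echar n) = (if n = 0 then 1 else 0)"
proof (cases "n = 0")
  case True
  have "integral ubox (\<lambda>x. 1::complex) = 1" by (simp add: content_ubox)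
  thus ?thesis using True by (simp add: echar_0[abs_def] cong: integral_cong)
next
  case False
  then obtain j where j: "n $ j \<noteq> 0" by (metis vec_eq_iff zero_index)
  \<comment> \<open>Half a period of the character in direction \<open>j\<close>: translation by it
    changes the sign of the character but not the integral.\<close>
  define t where "t = 1 / (2 * \<bar>real_of_int (n$j)\<bar>)"
  have t: "0 \<le> t" "t \<le> 1" using j by (auto simp: t_def field_simps)
  have "cis (2 * pi * (real_of_int (n$j) * t)) = -1"
  proof (cases "n$j > 0")
    case True
    hence "2 * pi * (real_of_int (n$j) * t) = pi" by (simp add: t_def)
    thus ?thesis by (simp only: cis_pi)
  next
    case False
    hence "2 * pi * (real_of_int (n$j) * t) = - pi" using j by (simp add: t_def)
    thus ?thesis by (simp only:) (simp add: complex_eq_iff)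
  qed
  hence "echar n (x + t *\<^sub>R axis j 1) = - echar n x" for x
    by (simp add: echar_add) (simp add: echar_def ndot_scale_axis)
  moreover have "integral ubox (\<lambda>x. echar n (x + t *\<^sub>R axis j 1)) = integral ubox (echar n)"
    by (intro integral_ubox_shift t) (auto intro!: continuous_intros continuous_on_echar[of _ "\<lambda>x. x", simplified])
  ultimately have "integral ubox (echar n) = 0" by simp
  thus ?thesis using False by simp
qed

lemma fourier_of_echar: "fourier (echar n) k = (if n = k then 1 else 0)"
proof -
  have "fourier (echar n) k = integral ubox (echar (n - k))"
    unfolding fourier_echar echar_add_left[symmetric] by simp
  thus ?thesis by (simp add: integral_echar)
qed

section \<open>Uniqueness of Fourier coefficients by peak functions, and inversion\<close>

lemma integral_peak_nonzero:
  fixes u T :: "real^2 \<Rightarrow> real"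
  assumes u: "continuous_on UNIV u" and T: "continuous_on UNIV T" and ua: "u a > 0" and Ta: "T a = 1"
    and a: "a \<in> box 0 (1)" and T0: "\<And>x. x \<in> ubox \<Longrightarrow> 0 \<le> T x"
    and peak: "\<And>e. e > 0 \<Longrightarrow> \<exists>q<1. \<forall>x\<in>ubox. dist x a \<ge> e \<longrightarrow> T x \<le> q"
  shows "\<exists>N. integral ubox (\<lambda>x. u x * T x ^ N) \<noteq> 0"
proof (rule ccontr)
  assume "\<not> ?thesis"
  hence z: "integral ubox (\<lambda>x. u x * T x ^ N) = 0" for N by blast
  have cu: "isCont u a" and cT: "isCont T a" using u T by (auto simp: continuous_on_eq_continuous_at)
  have "\<forall>\<^sub>F x in nhds a. u x > u a / 2"
    using cu ua unfolding isCont_def tendsto_at_iff_tendsto_nhds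
    by (intro order_tendstoD) auto
  then obtain e where e: "e > 0" "\<And>x. dist x a < e \<Longrightarrow> u x > u a / 2"
    by (auto simp: eventually_nhds_metric)
  obtain q0 where q0: "q0 < 1" "\<And>x. x \<in> ubox \<Longrightarrow> dist x a \<ge> e \<Longrightarrow> T x \<le> q0" using peak[OF e(1)] by blast
  \<comment> \<open>Raising \<open>q0\<close> to at least 1/2 keeps \<open>q\<close> positive;
    \<open>p\<close> is then the midpoint of \<open>q\<close> and 1, so that powers of
    \<open>p\<close> eventually dominate those of \<open>q\<close>.\<close>
  define q where "q = max q0 (1/2)"
  have q: "q < 1" "q > 0" "\<And>x. x \<in> ubox \<Longrightarrow> dist x a \<ge> e \<Longrightarrow> T x \<le> q"
    using q0 by (auto simp: q_def le_max_iff_disj)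
  define p where "p = (1 + q) / 2"
  have p: "q < p" "p < 1" using q by (auto simp: p_def)
  have "\<forall>\<^sub>F x in nhds a. T x > p"
    using cT Ta p unfolding isCont_def tendsto_at_iff_tendsto_nhds
    by (intro order_tendstoD) auto
  then obtain e1 where e1: "e1 > 0" "\<And>x. dist x a < e1 \<Longrightarrow> T x > p"
    by (auto simp: eventually_nhds_metric)
  have "open (box 0 (1) \<inter> ball a (min e e1))" by (intro open_Int open_box open_ball)
  moreover have "a \<in> box 0 (1) \<inter> ball a (min e e1)" using a e e1 by simp
  ultimately obtain c d where cd: "a \<in> box c d" "cbox c d \<subseteq> box 0 (1) \<inter> ball a (min e e1)"
    using open_contains_cbox by metis
  define v where "v = measure lborel (cbox c d)"
  have v: "v > 0" unfolding v_def using cd(1) content_pos_lt_eq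
    by (metis box_ne_empty(2) empty_iff content_pos_lt_eq)
  have "compact (u ` ubox)" by (intro compact_continuous_image continuous_on_subset[OF u]) auto
  then obtain U where "\<forall>y\<in>u ` ubox. \<bar>y\<bar> \<le> U"
    using compact_imp_bounded bounded_real by blast
  hence U: "\<bar>u x\<bar> \<le> U" if "x \<in> ubox" for x using that by blast
  have U0: "U \<ge> 0" using U[of 0] by (simp add: mem_ubox) 
  \<comment> \<open>The integrand is at least \<open>u a / 2 * p ^ N\<close> on a small box around
    \<open>a\<close>, nonnegative elsewhere within distance \<open>e\<close>, and at least
    \<open>- U * q ^ N\<close> farther away. If the integral vanishes for every \<open>N\<close>,
    then \<open>p ^ N\<close> is bounded by a multiple of \<open>q ^ N\<close>, although
    \<open>q < p\<close>.\<close>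
  have low: "u a / 2 * v * p ^ N \<le> U * q ^ N" for N
  proof -
    have i1: "((\<lambda>x. indicat_real (cbox c d) x * (u a / 2 * p ^ N)) has_integral v * (u a / 2 * p ^ N)) ubox"
    proof (rule has_integral_mult_left)
      have "((\<lambda>x. 1::real) has_integral v) (cbox c d)"
        unfolding v_def using has_integral_const[of "1::real" c d] by simp
      moreover have "cbox c d \<subseteq> ubox" using cd(2) box_subset_cbox by blast
      moreover have "indicat_real (cbox c d) = (\<lambda>x. if x \<in> cbox c d then 1 else 0)"
        by (auto simp: indicator_def)
      ultimately show "(indicat_real (cbox c d) has_integral v) ubox"
        by (simp only: has_integral_restrict)
    qed
    have i2: "((\<lambda>x. U * q ^ N) has_integral U * q ^ N) ubox"
      using has_integral_const[of "U * q ^ N" "0::real^2" "1"] by (simp add: content_ubox)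
    have "(\<lambda>x. u x * T x ^ N) integrable_on ubox"
      by (intro integrable_continuous continuous_intros continuous_on_subset[OF u] continuous_on_subset[OF T]) auto
    hence i3: "((\<lambda>x. u x * T x ^ N) has_integral 0) ubox" using z[of N] by (metis integrable_integral)
    have "v * (u a / 2 * p ^ N) - U * q ^ N \<le> 0"
    proof (rule has_integral_le[OF has_integral_diff[OF i1 i2] i3])
      fix x assume x: "x \<in> ubox"
      have Uq: "0 \<le> U * q ^ N" using U0 q by simp
      show "indicat_real (cbox c d) x * (u a / 2 * p ^ N) - U * q ^ N \<le> u x * T x ^ N"
      proof (cases "dist x a < e")
        case True
        hence ux: "u x > u a / 2" by (rule e)
        hence nn: "0 \<le> u x * T x ^ N" using ua T0[OF x] by simp
        show ?thesis
        proof (cases "x \<in> cbox c d")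
          case True
          hence "T x > p" using cd(2) by (intro e1) (auto simp: dist_commute)
          hence "p ^ N \<le> T x ^ N" using p q by (intro power_mono) auto
          hence "u a / 2 * p ^ N \<le> u x * T x ^ N" using ux ua p q by (intro mult_mono) auto
          thus ?thesis using Uq True by (simp add: indicator_def)
        qed (use nn Uq in \<open>simp add: indicator_def\<close>)
      next
        case False
        hence "x \<notin> cbox c d" using cd(2) by (auto simp: dist_commute)
        moreover have "\<bar>u x * T x ^ N\<bar> \<le> U * q ^ N"
          unfolding abs_mult power_abs
          using U[OF x] q(3)[OF x] False T0[OF x] U0 by (intro mult_mono power_mono) auto
        ultimately show ?thesis by (simp add: indicator_def)
      qed
    qed
    thus ?thesis by (simp add: algebra_simps)
  qed
  have "(\<lambda>N. U * (q / p) ^ N) \<longlonglongrightarrow> U * 0"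
    using p q by (intro tendsto_intros LIMSEQ_power_zero) auto
  moreover have "u a / 2 * v \<le> U * (q / p) ^ N" for N
    using low[of N] p q by (simp add: field_simps power_divide)
  ultimately have "u a / 2 * v \<le> U * 0" by (intro LIMSEQ_le_const) auto
  thus False using mult_pos_pos[OF ua v] by simp
qed

text \<open>A nonnegative trigonometric polynomial in the coordinate \<open>j\<close> that attains
  its maximum 1 exactly where \<open>x$j - a$j\<close> is an integer. The product over both
  coordinates is the peak function, and its powers remain trigonometric polynomials.\<close>

definition bump :: "real^2 \<Rightarrow> 2 \<Rightarrow> real^2 \<Rightarrow> real" where
  "bump a j x = (1 + cos (2 * pi * (x$j - a$j))) / 2"

lemma bump_echar:
  "complex_of_real (bump a j x) = 1/2 * echar 0 x + cis (- 2 * pi * a$j) / 4 * echar (axis j 1) x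
     + cis (2 * pi * a$j) / 4 * echar (- axis j 1) x"
  by (simp add: bump_def echar_def ndot_axis_left ndot_minus_left complex_eq_iff cos_diff algebra_simps diff_divide_distrib)

lemma cos_le_cos_of_far:
  assumes "0 < d" "d \<le> 1/2" "d \<le> \<bar>s\<bar>" "\<bar>s\<bar> \<le> 1 - d"
  shows "cos (2 * pi * s) \<le> cos (2 * pi * d)"
proof (cases "\<bar>s\<bar> \<le> 1/2")
  case True
  have "cos (2 * pi * \<bar>s\<bar>) \<le> cos (2 * pi * d)"
    using assms True by (intro cos_monotone_0_pi_le) auto
  thus ?thesis by (cases "s \<ge> 0") auto
next
  case False
  have "cos (2 * pi * (1 - \<bar>s\<bar>)) \<le> cos (2 * pi * d)"
    using assms False by (intro cos_monotone_0_pi_le) auto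
  moreover have "cos (2 * pi * (1 - \<bar>s\<bar>)) = cos (2 * pi * \<bar>s\<bar>)"
    by (simp add: right_diff_distrib cos_diff)
  ultimately show ?thesis by (cases "s \<ge> 0") auto
qed

text \<open>If all coefficients vanish, then \<open>g\<close> integrates to zero against every
  trigonometric polynomial, in particular against the powers of a peak at \<open>a\<close>. Were
  \<open>g a\<close> nonzero, the real part of \<open>cnj (g a) * g\<close> would be positive at
  \<open>a\<close>, contradicting the peak estimate. Taking \<open>a\<close> inside the open cube
  keeps its periodic copies out of the closed cube.\<close>

lemma fourier_unique_interior:
  assumes g: "continuous_on UNIV g" and z: "\<And>k. fourier g k = 0" and a: "a \<in> box 0 (1)"
  shows "g a = 0"
proof (rule ccontr)
  assume ga: "g a \<noteq> 0"
  define u where "u x = Re (cnj (g a) * g x)" for x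
  define T where "T x = bump a 1 x * bump a 2 x" for x
  \<comment> \<open>Multiplication by a bump turns a character into a combination of three
    characters, so vanishing against all of them is preserved. The induction therefore has to carry
    an arbitrary \<open>k\<close>.\<close>
  have zP: "integral ubox (\<lambda>x. g x * of_real (T x ^ N) * echar k x) = 0" for N k
  proof (induction N arbitrary: k)
    case 0
    show ?case using z[of "- k"] by (simp add: fourier_echar)
  next
    case (Suc N)
    have step: "integral ubox (\<lambda>x. P x * of_real (bump a j x) * echar k x) = 0"
      if P: "continuous_on UNIV P" and P0: "\<And>k. integral ubox (\<lambda>x. P x * echar k x) = 0" for P j k
    proof -
      have "(\<lambda>x. P x * echar k x) integrable_on ubox" for k
        by (intro integrable_continuous continuous_intros continuous_on_subset[OF P]) auto
      hence int: "((\<lambda>x. P x * echar k x) has_integral 0) ubox" for k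
        using P0 by (metis integrable_integral)
      have "P x * of_real (bump a j x) * echar k x = 1/2 * (P x * echar k x)
         + cis (- 2 * pi * a$j) / 4 * (P x * echar (axis j 1 + k) x)
         + cis (2 * pi * a$j) / 4 * (P x * echar (- axis j 1 + k) x)" for x
        unfolding bump_echar echar_add_left by (simp add: algebra_simps)
      moreover have "((\<lambda>x. 1/2 * (P x * echar k x)
         + cis (- 2 * pi * a$j) / 4 * (P x * echar (axis j 1 + k) x)
         + cis (2 * pi * a$j) / 4 * (P x * echar (- axis j 1 + k) x)) has_integral
         1/2 * 0 + cis (- 2 * pi * a$j) / 4 * 0 + cis (2 * pi * a$j) / 4 * 0) ubox"
        by (intro has_integral_add has_integral_mult_right int)
      ultimately show ?thesis by (simp add: integral_unique)
    qed
    have cb: "continuous_on UNIV (bump a j)" for j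
      unfolding bump_def by (intro continuous_intros) auto
    have c1: "continuous_on UNIV (\<lambda>x. g x * of_real (T x ^ N))"
      unfolding T_def by (intro continuous_intros g cb)
    have c2: "continuous_on UNIV (\<lambda>x. g x * of_real (T x ^ N) * of_real (bump a 1 x))"
      by (intro continuous_intros c1 cb)
    have "integral ubox (\<lambda>x. g x * of_real (T x ^ N) * of_real (bump a 1 x) * of_real (bump a 2 x) * echar k x) = 0"
      by (rule step[OF c2 step[OF c1 Suc]])
    thus ?case by (simp add: T_def mult_ac)
  qed
  have cT: "continuous_on UNIV T"
    unfolding T_def bump_def by (intro continuous_intros) auto
  have cu: "continuous_on UNIV u" unfolding u_def by (intro continuous_intros g)
  have bump01: "0 \<le> bump a j x" "bump a j x \<le> 1" for j x
  proof -
    define t where "t = cos (2 * pi * (x$j - a$j))"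
    have t: "-1 \<le> t" "t \<le> 1" "bump a j x = (1 + t) / 2" by (simp_all add: t_def bump_def)
    show "0 \<le> bump a j x" using t by simp
    show "bump a j x \<le> 1" using t by simp
  qed
  have "\<exists>N. integral ubox (\<lambda>x. u x * T x ^ N) \<noteq> 0"
  proof (rule integral_peak_nonzero[OF cu cT _ _ a])
    show "u a > 0" using ga by (auto simp: u_def sum_power2_gt_zero_iff complex_eq_iff simp flip: power2_eq_square)
    show "T a = 1" by (simp add: T_def bump_def)
    show "0 \<le> T x" for x by (simp add: T_def bump01)
  next
    fix e :: real assume e: "e > 0"
    have a01: "0 < a$j" "a$j < 1" for j using a by (auto simp: mem_box_cart)
    \<comment> \<open>The bound \<open>e / 2\<close> ensures that a point at distance
      \<open>e\<close> from \<open>a\<close> differs by at least \<open>d\<close> in one of the two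
      coordinates; the distance to the faces keeps this difference at most \<open>1 - d\<close>,
      away from the next period.\<close>
    define d where "d = min (e / 2) (Min (range (\<lambda>j. min (a$j) (1 - a$j))))"
    have d2: "d \<le> a$j" "d \<le> 1 - a$j" for j
      using Min_le[of "range (\<lambda>j. min (a$j) (1 - a$j))" "min (a$j) (1 - a$j)"] by (auto simp: d_def)
    have d: "d > 0" "d \<le> e / 2" "d \<le> 1/2" using e a01 d2[of 1] by (auto simp: d_def)
    let ?q = "(1 + cos (2 * pi * d)) / 2"
    have "cos (2 * pi * d) < cos 0" using d by (intro cos_monotone_0_pi) auto
    hence "?q < 1" by simp
    moreover have "T x \<le> ?q" if x: "x \<in> ubox" and xe: "dist x a \<ge> e" for x
    proof -
      have "\<exists>j. \<bar>x$j - a$j\<bar> \<ge> d"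
      proof (rule ccontr)
        assume "\<not> ?thesis"
        hence "\<bar>x$1 - a$1\<bar> < d" "\<bar>x$2 - a$2\<bar> < d" by (auto simp: not_le)
        moreover have "dist x a \<le> \<bar>x$1 - a$1\<bar> + \<bar>x$2 - a$2\<bar>"
          unfolding dist_norm using norm_le_l1_cart[of "x - a"] by (simp add: sum_2)
        ultimately show False using d xe by linarith
      qed
      then obtain j where j: "\<bar>x$j - a$j\<bar> \<ge> d" ..
      have "\<bar>x$j - a$j\<bar> \<le> 1 - d" using x d2[of j] by (auto simp: mem_ubox abs_le_iff; smt (verit, best))
      hence "bump a j x \<le> ?q" using cos_le_cos_of_far[of d "x$j - a$j"] j d by (simp add: bump_def)
      moreover have "T x \<le> bump a j x"
        using exhaust_2[of j] bump01
        by (auto simp: T_def mult_left_le mult_left_le_one_le)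
      ultimately show ?thesis by simp
    qed
    ultimately show "\<exists>q<1. \<forall>x\<in>ubox. dist x a \<ge> e \<longrightarrow> T x \<le> q" by blast
  qed
  then obtain N where N: "integral ubox (\<lambda>x. u x * T x ^ N) \<noteq> 0" by blast
  have i: "(\<lambda>x. cnj (g a) * (g x * of_real (T x ^ N))) integrable_on ubox"
    by (intro integrable_continuous continuous_intros continuous_on_subset[OF g] continuous_on_subset[OF cT]) auto
  have "integral ubox (\<lambda>x. u x * T x ^ N) = integral ubox (\<lambda>x. Re (cnj (g a) * (g x * of_real (T x ^ N))))"
    by (intro integral_cong) (simp add: u_def algebra_simps)
  also have "\<dots> = Re (integral ubox (\<lambda>x. cnj (g a) * (g x * of_real (T x ^ N))))"
    using integral_linear[OF i bounded_linear_Re] by (simp add: o_def)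
  also have "\<dots> = 0" using zP[of N 0] by simp
  finally show False using N by simp
qed

text \<open>Continuity extends the vanishing from the open to the closed cube, and integer
  translations bring every point into the latter.\<close>

lemma fourier_unique:
  assumes g: "continuous_on UNIV g" and per: "\<And>x j. g (x + axis j 1) = g x" and z: "\<And>k. fourier g k = 0"
  shows "g x = 0"
proof -
  have box: "g x = 0" if "x \<in> ubox" for x
  proof -
    have "ubox = closure (box 0 (1 :: real^2))"
    proof (rule closure_box[symmetric])
      have "vec (1/2) \<in> box 0 (1::real^2)" by (simp add: mem_box_cart)
      thus "box 0 (1::real^2) \<noteq> {}" by blast
    qed
    moreover have "box 0 (1) \<subseteq> {x. g x = 0}" using fourier_unique_interior[OF g z] by blast
    moreover have "closed {x. g x = 0}" using g by (intro closed_Collect_eq) auto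
    ultimately have "ubox \<subseteq> {x. g x = 0}" by (metis closure_minimal)
    thus ?thesis using that by blast
  qed
  have per_n: "g (x + of_nat n *\<^sub>R axis j 1) = g x" for n j x
  proof (induction n)
    case (Suc n)
    have "x + of_nat (Suc n) *\<^sub>R axis j 1 = (x + of_nat n *\<^sub>R axis j 1) + axis j 1"
      by (simp add: algebra_simps)
    thus ?case using Suc per by metis
  qed simp
  have per_i: "g (x + of_int k *\<^sub>R axis j 1) = g x" for k j x
  proof (cases "k \<ge> 0")
    case True
    thus ?thesis using per_n[of x "nat k" j] by simp
  next
    case False
    thus ?thesis using per_n[of "x + of_int k *\<^sub>R axis j 1" "nat (- k)" j] by simp
  qed
  let ?y = "x + of_int (- \<lfloor>x$1\<rfloor>) *\<^sub>R axis 1 1 + of_int (- \<lfloor>x$2\<rfloor>) *\<^sub>R axis 2 1"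
  have "g x = g ?y" by (simp only: per_i)
  also have "?y \<in> ubox" by (auto simp: mem_ubox forall_2 axis_def) linarith+
  hence "g ?y = 0" by (rule box)
  finally show ?thesis .
qed

text \<open>Absolute convergence makes the series a continuous periodic function \<open>h\<close>,
  whose coefficients can be computed termwise and agree with those of \<open>f\<close>. Uniqueness
  applied to \<open>f - h\<close> finishes the argument.\<close>

lemma fourier_inversion:
  assumes f: "continuous_on UNIV f" and per: "\<And>x j. f (x + axis j 1) = f x"
    and sum: "(\<lambda>k. norm (fourier f k)) summable_on UNIV"
  shows "((\<lambda>k. fourier f k * echar k x) has_sum f x) UNIV"
proof -
  define h where "h x = (\<Sum>\<^sub>\<infinity>k. fourier f k * echar k x)" for x
  have ul: "uniform_limit UNIV (\<lambda>X x. \<Sum>k\<in>X. fourier f k * echar k x) h (finite_subsets_at_top UNIV)"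
    unfolding h_def by (rule Weierstrass_m_test_general[OF _ sum]) (simp add: norm_mult)
  have h: "continuous_on UNIV h"
    by (rule uniform_limit_theorem[OF _ ul])
       (auto intro!: always_eventually continuous_intros continuous_on_echar[of _ "\<lambda>x. x"])
  have fh: "fourier h m = fourier f m" for m
  proof -
    have ul': "uniform_limit ubox (\<lambda>X x. (\<Sum>k\<in>X. fourier f k * echar k x) * echar (- m) x)
      (\<lambda>x. h x * echar (- m) x) (finite_subsets_at_top UNIV)"
    proof -
      have b: "norm (fourier f k * echar k x * echar (-m) x) \<le> norm (fourier f k)" for k x
        by (simp add: norm_mult)
      have hs: "((\<lambda>k. fourier f k * echar k x * echar (-m) x) has_sum h x * echar (-m) x) UNIV" for x
      proof (rule has_sum_cmult_left)
        have "(\<lambda>k. fourier f k * echar k x) summable_on UNIV"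
          by (rule abs_summable_summable) (simp add: norm_mult sum)
        thus "((\<lambda>k. fourier f k * echar k x) has_sum h x) UNIV" unfolding h_def by simp
      qed
      show ?thesis unfolding sum_distrib_right
        by (rule Weierstrass_m_test_general'[OF b hs sum])
    qed
    obtain I J where IJ: "\<And>X. ((\<lambda>x. (\<Sum>k\<in>X. fourier f k * echar k x) * echar (- m) x) has_integral I X) ubox"
      "((\<lambda>x. h x * echar (- m) x) has_integral J) ubox" "(I \<longlongrightarrow> J) (finite_subsets_at_top UNIV)"
      by (rule uniform_limit_integral_cbox[OF ul'])
         (auto intro!: continuous_intros continuous_on_echar[of _ "\<lambda>x. x"])
    have "I X = (if m \<in> X then fourier f m else 0)" if X: "finite X" for X
    proof -
      have "I X = integral ubox (\<lambda>x. \<Sum>k\<in>X. fourier f k * (echar (k - m) x))"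
        using integral_unique[OF IJ(1)[of X]]
        by (simp add: sum_distrib_right mult.assoc flip: echar_add_left)
      also have "\<dots> = (\<Sum>k\<in>X. fourier f k * integral ubox (echar (k - m)))"
        by (subst integral_sum)
           (auto intro!: X integrable_continuous continuous_intros continuous_on_echar[of _ "\<lambda>x. x"])
      also have "\<dots> = (if m \<in> X then fourier f m else 0)"
        using X by (simp add: integral_echar if_distrib cong: if_cong)
      finally show ?thesis .
    qed
    hence "\<forall>\<^sub>F X in finite_subsets_at_top UNIV. I X = fourier f m"
      unfolding eventually_finite_subsets_at_top by (intro exI[of _ "{m}"]) auto
    hence "(I \<longlongrightarrow> fourier f m) (finite_subsets_at_top UNIV)" by (rule tendsto_eventually)
    hence "J = fourier f m" by (rule tendsto_unique[OF _ IJ(3), rotated]) simp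
    thus ?thesis using integral_unique[OF IJ(2)] by (simp add: fourier_echar)
  qed
  have ce: "continuous_on ubox (echar k)" for k by (intro continuous_on_echar[of _ "\<lambda>x. x"] continuous_intros)
  have "f x - h x = 0"
  proof (rule fourier_unique[of "\<lambda>x. f x - h x"])
    show "continuous_on UNIV (\<lambda>x. f x - h x)" by (intro continuous_intros f h)
    show "f (x + axis j 1) - h (x + axis j 1) = f x - h x" for x j by (simp add: per h_def)
    show "fourier (\<lambda>x. f x - h x) k = 0" for k
    proof -
      have "fourier (\<lambda>x. f x - h x) k = fourier f k - fourier h k"
        unfolding fourier_echar left_diff_distrib
        by (intro integral_diff integrable_continuous continuous_intros ce
            continuous_on_subset[OF f] continuous_on_subset[OF h]) auto
      thus ?thesis by (simp add: fh)
    qed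
  qed
  moreover have "((\<lambda>k. fourier f k * echar k x) has_sum h x) UNIV"
    unfolding h_def by (rule has_sum_infsum, rule abs_summable_summable) (simp add: norm_mult sum)
  ultimately show ?thesis by simp
qed

section \<open>Decay of Fourier coefficients\<close>

text \<open>Joint continuity together with holomorphy along each complex coordinate line, where
  \<open>\<zeta>\<close> is the offset from \<open>z\<close>. Contours are moved and identities
  continued one coordinate at a time, and stability under products and exponentials comes from one
  variable.\<close>

definition sepholo :: "real \<Rightarrow> (complex^2 \<Rightarrow> complex) \<Rightarrow> bool" where
  "sepholo r F \<longleftrightarrow> continuous_on (strip r) F \<and>
     (\<forall>z\<in>strip r. \<forall>j. (\<lambda>\<zeta>. F (z + \<zeta> *s axis j 1)) holomorphic_on {\<zeta>. \<bar>Im (z$j + \<zeta>)\<bar> < r})"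

definition kdot :: "int^2 \<Rightarrow> complex^2 \<Rightarrow> complex" where
  "kdot k z = of_int (k$1) * z$1 + of_int (k$2) * z$2"

lemma scale_axis_nth: "((\<zeta>::complex) *s axis j 1) $ i = (if i = j then \<zeta> else 0)"
  by (simp add: axis_def)

lemma strip_line: "z \<in> strip r \<Longrightarrow> z + \<zeta> *s axis j 1 \<in> strip r \<longleftrightarrow> \<bar>Im (z$j + \<zeta>)\<bar> < r"
  using exhaust_2[of j] by (auto simp: strip_def forall_2 scale_axis_nth axis_def)

lemma sepholo_const [intro]: "sepholo r (\<lambda>z. c)"
  by (simp add: sepholo_def)

lemma sepholo_nth [intro]: "sepholo r (\<lambda>z. z $ i)"
proof -
  have "(\<lambda>\<zeta>. (z + \<zeta> *s axis j 1) $ i) holomorphic_on S" for z :: "complex^2" and j S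
  proof (cases "i = j")
    case True
    thus ?thesis by (auto simp: scale_axis_nth axis_def intro!: holomorphic_intros)
  next
    case False
    thus ?thesis by (auto simp: scale_axis_nth axis_def)
  qed
  thus ?thesis unfolding sepholo_def by (intro conjI ballI allI continuous_intros) auto
qed

lemma sepholo_add [intro]: "sepholo r F \<Longrightarrow> sepholo r G \<Longrightarrow> sepholo r (\<lambda>z. F z + G z)"
  unfolding sepholo_def by (auto intro!: continuous_intros holomorphic_intros)

lemma sepholo_diff [intro]: "sepholo r F \<Longrightarrow> sepholo r G \<Longrightarrow> sepholo r (\<lambda>z. F z - G z)"
  unfolding sepholo_def by (auto intro!: continuous_intros holomorphic_intros)

lemma sepholo_mult [intro]: "sepholo r F \<Longrightarrow> sepholo r G \<Longrightarrow> sepholo r (\<lambda>z. F z * G z)"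
  unfolding sepholo_def by (auto intro!: continuous_intros holomorphic_intros)

lemma sepholo_exp [intro]: "sepholo r F \<Longrightarrow> sepholo r (\<lambda>z. exp (F z))"
  unfolding sepholo_def by (auto intro!: continuous_intros holomorphic_intros)

lemma sepholo_kdot [intro]: "sepholo r (kdot k)"
  unfolding kdot_def[abs_def] by (intro sepholo_add sepholo_mult sepholo_const sepholo_nth)

lemma sepholo_of_cholo:
  assumes "cholo \<Psi> (strip r)"
  shows "sepholo r (\<lambda>z. \<Psi> z $ i)"
proof -
  have D: "\<exists>D. (\<Psi> has_derivative D) (at z) \<and> (\<forall>(a::complex) v. D (a *s v) = a *s D v)"
    if "z \<in> strip r" for z using assms that by (auto simp: cholo_def)
  have "continuous_on (strip r) \<Psi>"
    using D has_derivative_continuous by (intro continuous_at_imp_continuous_on) blast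
  moreover have "(\<lambda>\<zeta>. \<Psi> (z + \<zeta> *s axis j 1) $ i) holomorphic_on {\<zeta>. \<bar>Im (z$j + \<zeta>)\<bar> < r}"
    if z: "z \<in> strip r" for z j
  proof (rule holomorphic_onI)
    fix \<zeta> assume "\<zeta> \<in> {\<zeta>. \<bar>Im (z$j + \<zeta>)\<bar> < r}"
    hence "z + \<zeta> *s axis j 1 \<in> strip r" using strip_line[OF z] by simp
    then obtain D where D: "(\<Psi> has_derivative D) (at (z + \<zeta> *s axis j 1))"
      "\<And>(a::complex) v. D (a *s v) = a *s D v" using D by blast
    have lin: "((\<lambda>\<zeta>. z + \<zeta> *s axis j 1) has_derivative (\<lambda>h. h *s axis j 1)) (at \<zeta>)"
    proof -
      have "((\<lambda>\<zeta>. (\<chi> k. z$k + \<zeta> * axis j 1 $ k)) has_derivative (\<lambda>h. (\<chi> k. h * axis j 1 $ k))) (at \<zeta>)"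
        by (subst has_derivative_componentwise_within)
           (auto simp: Basis_vec_def inner_axis intro!: derivative_eq_intros)
      moreover have "(\<lambda>\<zeta>. (\<chi> k. z$k + \<zeta> * axis j 1 $ k)) = (\<lambda>\<zeta>. z + \<zeta> *s axis j 1)"
        by (auto simp: vec_eq_iff)
      moreover have "(\<lambda>h. (\<chi> k. h * axis j 1 $ k)) = (\<lambda>h::complex. h *s axis j 1)"
        by (auto simp: vec_eq_iff)
      ultimately show ?thesis by simp
    qed
    have "((\<lambda>\<zeta>. \<Psi> (z + \<zeta> *s axis j 1)) has_derivative (\<lambda>h. D (h *s axis j 1))) (at \<zeta>)"
      by (rule has_derivative_compose[OF lin D(1)])
    from bounded_linear.has_derivative[OF bounded_linear_vec_nth this, of i]
    have "((\<lambda>\<zeta>. \<Psi> (z + \<zeta> *s axis j 1) $ i) has_derivative (\<lambda>h. D (h *s axis j 1) $ i)) (at \<zeta>)" .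
    \<comment> \<open>Complex linearity of \<open>D\<close> is what turns the real derivative along
      the line into multiplication by a complex number.\<close>
    moreover have "(\<lambda>h. D (h *s axis j 1) $ i) = (*) (D (axis j 1) $ i)"
      by (auto simp: D(2) mult.commute)
    ultimately have "((\<lambda>\<zeta>. \<Psi> (z + \<zeta> *s axis j 1) $ i) has_field_derivative D (axis j 1) $ i) (at \<zeta>)"
      by (simp add: has_field_derivative_def)
    thus "(\<lambda>\<zeta>. \<Psi> (z + \<zeta> *s axis j 1) $ i) field_differentiable at \<zeta> within {\<zeta>. \<bar>Im (z$j + \<zeta>)\<bar> < r}"
      using field_differentiable_at_within field_differentiable_def by blast
  qed
  ultimately show ?thesis unfolding sepholo_def by (auto intro!: continuous_intros)
qed

lemma cvec_nth [simp]: "cvec x $ i = of_real (x $ i)" by (simp add: cvec_def)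

lemma cvec_line: "cvec (x + t *\<^sub>R axis j 1) = cvec x + of_real t *s axis j 1"
  by (simp add: vec_eq_iff axis_def)

lemma cvec_axis: "cvec (x + axis j 1) = cvec x + axis j 1"
  by (simp add: vec_eq_iff axis_def)

lemma cvec_in_strip: "r > 0 \<Longrightarrow> cvec x \<in> strip r"
  by (simp add: strip_def)

lemma continuous_on_cvec [continuous_intros]:
  "continuous_on S f \<Longrightarrow> continuous_on S (\<lambda>x. cvec (f x))"
  unfolding cvec_def by (intro continuous_intros)

section \<open>Shifting contours inside the strip\<close>

lemma open_hstrip: "open {\<zeta>. \<bar>Im (c + \<zeta>)\<bar> < r}"
  by (intro open_Collect_less continuous_intros)

lemma convex_hstrip: "convex {\<zeta>. \<bar>Im (c + \<zeta>)\<bar> < r}"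
proof -
  have "{\<zeta>. \<bar>Im (c + \<zeta>)\<bar> < r} = {\<zeta>. Im \<zeta> < r - Im c} \<inter> {\<zeta>. Im \<zeta> > - r - Im c}"
    by (auto simp: abs_less_iff)
  thus ?thesis by (simp add: convex_Int convex_halfspace_Im_lt convex_halfspace_Im_gt)
qed

text \<open>Let \<open>G\<close> be a primitive of \<open>g\<close> on the convex strip. Periodicity
  makes \<open>G (\<zeta> + 1) - G \<zeta>\<close> constant, and each integral over a horizontal
  segment of length 1 equals this constant, at whatever height.\<close>

lemma integral_periodic_strip:
  assumes g: "g holomorphic_on {\<zeta>. \<bar>Im (c + \<zeta>)\<bar> < r}"
    and per: "\<And>\<zeta>. \<bar>Im (c + \<zeta>)\<bar> < r \<Longrightarrow> g (\<zeta> + 1) = g \<zeta>"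
    and "\<bar>Im c\<bar> < r" "\<bar>Im c + y\<bar> < r"
  shows "integral {0..1} (\<lambda>t. g (of_real t)) = integral {0..1} (\<lambda>t. g (of_real t + \<i> * of_real y))"
proof -
  let ?S = "{\<zeta>. \<bar>Im (c + \<zeta>)\<bar> < r}"
  obtain G where "\<And>\<zeta>. \<zeta> \<in> ?S \<Longrightarrow> (G has_field_derivative g \<zeta>) (at \<zeta> within ?S)"
    using holomorphic_convex_primitive'[OF convex_hstrip open_hstrip g] by blast
  hence G: "(G has_field_derivative g \<zeta>) (at \<zeta>)" if "\<zeta> \<in> ?S" for \<zeta>
    using that at_within_open[OF _ open_hstrip] by (metis (no_types, lifting))
  have "\<exists>d. \<forall>\<zeta>\<in>?S. G (\<zeta> + 1) - G \<zeta> = d"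
  proof (rule has_field_derivative_zero_constant[OF convex_hstrip])
    fix \<zeta> assume z: "\<zeta> \<in> ?S"
    hence "\<zeta> + 1 \<in> ?S" by simp
    hence "((\<lambda>\<zeta>. G (\<zeta> + 1)) has_field_derivative g (\<zeta> + 1)) (at \<zeta>)"
      using DERIV_shift[of G "g (\<zeta> + 1)" \<zeta> 1] G[of "\<zeta> + 1"] by simp
    hence "((\<lambda>\<zeta>. G (\<zeta> + 1) - G \<zeta>) has_field_derivative g (\<zeta> + 1) - g \<zeta>) (at \<zeta>)"
      by (intro DERIV_diff G z)
    hence "((\<lambda>\<zeta>. G (\<zeta> + 1) - G \<zeta>) has_field_derivative 0) (at \<zeta>)"
      using per[of \<zeta>] z by simp
    thus "((\<lambda>\<zeta>. G (\<zeta> + 1) - G \<zeta>) has_field_derivative 0) (at \<zeta> within ?S)"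
      by (rule has_field_derivative_at_within)
  qed
  then obtain d where d: "\<And>\<zeta>. \<zeta> \<in> ?S \<Longrightarrow> G (\<zeta> + 1) - G \<zeta> = d" by blast
  have int: "integral {0..1} (\<lambda>t. g (of_real t + \<i> * of_real y)) = d" if "\<bar>Im c + y\<bar> < r" for y
  proof -
    have "((\<lambda>t. g (of_real t + \<i> * of_real y)) has_integral
       (G (of_real 1 + \<i> * of_real y) - G (of_real 0 + \<i> * of_real y))) {0..1}"
    proof (rule fundamental_theorem_of_calculus)
      fix t :: real
      have "of_real t + \<i> * of_real y \<in> ?S" using that by simp
      note G[OF this]
      moreover have "((\<lambda>t. of_real t + \<i> * of_real y) has_vector_derivative 1) (at t within {0..1})"
        by (auto intro!: derivative_eq_intros)
      ultimately have "(G \<circ> (\<lambda>t. of_real t + \<i> * of_real y) has_vector_derivative 1 * g (of_real t + \<i> * of_real y))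
        (at t within {0..1})"
        using field_vector_diff_chain_within has_field_derivative_at_within by blast
      thus "((\<lambda>t. G (of_real t + \<i> * of_real y)) has_vector_derivative g (of_real t + \<i> * of_real y))
        (at t within {0..1})" by (simp add: o_def)
    qed simp
    moreover have "\<i> * of_real y \<in> ?S" using that by simp
    ultimately show ?thesis using d[of "\<i> * of_real y"] integral_unique
      by (simp add: add.commute)
  qed
  show ?thesis using int[of 0] int[of y] assms(3,4) by simp
qed

text \<open>Once the integral is averaged along the circle in direction \<open>j\<close>, the inner
  one-variable integral can be moved to another height without change.\<close>

lemma integral_ubox_imag_shift:
  assumes G: "sepholo r G" and per: "\<And>z. z \<in> strip r \<Longrightarrow> G (z + axis j 1) = G z"
    and z0: "z0 \<in> strip r" and y: "\<bar>Im (z0$j) + y\<bar> < r"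
  shows "integral ubox (\<lambda>x. G (cvec x + z0)) = integral ubox (\<lambda>x. G (cvec x + (z0 + (\<i> * of_real y) *s axis j 1)))"
proof -
  have cG: "continuous_on (strip r) G" using G by (simp add: sepholo_def)
  have st: "cvec x + z \<in> strip r" if "z \<in> strip r" for x z using that by (simp add: strip_def)
  have av: "integral ubox (\<lambda>x. G (cvec x + z)) =
      integral ubox (\<lambda>x. integral {0..1} (\<lambda>t. G (cvec x + z + of_real t *s axis j 1)))" if z: "z \<in> strip r" for z
  proof -
    have "continuous_on UNIV (\<lambda>x. G (cvec x + z))"
      by (rule continuous_on_compose2[OF cG]) (auto intro!: continuous_intros st z)
    moreover have "G (cvec (x + axis j 1) + z) = G (cvec x + z)" for x
      using per[OF st[OF z], of x] by (simp add: cvec_axis algebra_simps)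
    ultimately show ?thesis
      by (subst integral_ubox_average) (simp_all add: cvec_line algebra_simps)
  qed
  have z1: "z0 + (\<i> * of_real y) *s axis j 1 \<in> strip r"
    using strip_line[OF z0] y by simp
  have "integral {0..1} (\<lambda>t. G (cvec x + z0 + of_real t *s axis j 1))
      = integral {0..1} (\<lambda>t. G (cvec x + (z0 + (\<i> * of_real y) *s axis j 1) + of_real t *s axis j 1))" for x
  proof -
    let ?w = "cvec x + z0"
    have w: "?w \<in> strip r" by (rule st[OF z0])
    have "integral {0..1} (\<lambda>t. (\<lambda>\<zeta>. G (?w + \<zeta> *s axis j 1)) (of_real t))
        = integral {0..1} (\<lambda>t. (\<lambda>\<zeta>. G (?w + \<zeta> *s axis j 1)) (of_real t + \<i> * of_real y))"
    proof (rule integral_periodic_strip[of _ "?w$j" r])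
      show "(\<lambda>\<zeta>. G (?w + \<zeta> *s axis j 1)) holomorphic_on {\<zeta>. \<bar>Im (?w$j + \<zeta>)\<bar> < r}"
        using G w unfolding sepholo_def by blast
      show "G (?w + (\<zeta> + 1) *s axis j 1) = G (?w + \<zeta> *s axis j 1)" if "\<bar>Im (?w$j + \<zeta>)\<bar> < r" for \<zeta>
        using per[of "?w + \<zeta> *s axis j 1"] strip_line[OF w] that
        by (simp add: vector_sadd_rdistrib algebra_simps)
      show "\<bar>Im (?w $ j)\<bar> < r" using w by (simp add: strip_def)
      show "\<bar>Im (?w $ j) + y\<bar> < r" using y by simp
    qed
    thus ?thesis by (simp add: vector_sadd_rdistrib algebra_simps)
  qed
  thus ?thesis using av[OF z0] av[OF z1] by presburger
qed

text \<open>Coordinate \<open>j\<close> is shifted by \<open>- \<rho>\<close> times the sign of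
  \<open>k$j\<close> in the imaginary direction. The oscillating factor then has modulus
  \<open>exp (- 2 * pi * \<rho> * |k|)\<close> for the 1-norm of \<open>k\<close>, while
  \<open>F\<close> remains bounded by \<open>B\<close>; \<open>\<rho> < r\<close> keeps both shifts
  inside the open strip.\<close>

lemma norm_fourier_le:
  assumes F: "sepholo r F" and per: "\<And>z j. z \<in> strip r \<Longrightarrow> F (z + axis j 1) = F z"
    and B: "\<And>z. z \<in> strip r \<Longrightarrow> norm (F z) \<le> B" and rho: "0 \<le> \<rho>" "\<rho> < r"
  shows "norm (fourier (\<lambda>x. F (cvec x)) k) \<le> B * exp (- 2 * pi * \<rho> * (\<bar>real_of_int (k$1)\<bar> + \<bar>real_of_int (k$2)\<bar>))"
proof -
  define G where "G z = F z * exp (- 2 * pi * \<i> * kdot k z)" for z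
  define y where "y j = - \<rho> * sgn (real_of_int (k$j))" for j
  have r: "r > 0" using rho by simp
  have G: "sepholo r G" unfolding G_def
    by (intro sepholo_mult sepholo_exp sepholo_const F sepholo_kdot)
  have Gper: "G (z + axis j 1) = G z" if "z \<in> strip r" for z j
  proof -
    have "kdot k (z + axis j 1) = kdot k z + of_int (k$j)"
      using exhaust_2[of j] by (auto simp: kdot_def axis_def algebra_simps)
    hence "exp (- 2 * pi * \<i> * kdot k (z + axis j 1)) = exp (- 2 * pi * \<i> * kdot k z) * exp (2 * of_int (- k$j) * pi * \<i>)"
      by (simp add: algebra_simps flip: exp_add)
    also have "exp (2 * of_int (- k$j) * pi * \<i>) = 1" by (rule exp_integer_2pi) simp
    finally show ?thesis using per[OF that] by (simp add: G_def)
  qed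
  have yr: "\<bar>y j\<bar> < r" for j using rho by (auto simp: y_def sgn_if)
  let ?w = "0 + (\<i> * of_real (y 1)) *s axis 1 1 + (\<i> * of_real (y 2)) *s axis 2 1 :: complex^2"
  have s0: "0 \<in> strip r" using r by (simp add: strip_def)
  have s1: "0 + (\<i> * of_real (y 1)) *s axis 1 1 \<in> strip r"
    using strip_line[OF s0, of "\<i> * of_real (y 1)" 1] yr[of 1] by simp
  have "fourier (\<lambda>x. F (cvec x)) k = integral ubox (\<lambda>x. G (cvec x + 0))"
    unfolding fourier_echar G_def
    by (intro integral_cong) (simp add: echar_def ndot_2 kdot_def cis_conv_exp algebra_simps)
  also have "\<dots> = integral ubox (\<lambda>x. G (cvec x + (0 + (\<i> * of_real (y 1)) *s axis 1 1)))"
    by (rule integral_ubox_imag_shift[OF G Gper s0]) (use yr[of 1] in auto)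
  also have "\<dots> = integral ubox (\<lambda>x. G (cvec x + ?w))"
    by (rule integral_ubox_imag_shift[OF G Gper s1]) (use yr[of 2] in \<open>auto simp: axis_def\<close>)
  finally have eq: "fourier (\<lambda>x. F (cvec x)) k = integral ubox (\<lambda>x. G (cvec x + ?w))" .
  have wst: "cvec x + ?w \<in> strip r" for x
    using yr by (auto simp: strip_def forall_2 axis_def)
  have bd: "norm (G (cvec x + ?w)) \<le> B * exp (- 2 * pi * \<rho> * (\<bar>real_of_int (k$1)\<bar> + \<bar>real_of_int (k$2)\<bar>))" for x
  proof -
    have "Im (kdot k (cvec x + ?w)) = real_of_int (k$1) * y 1 + real_of_int (k$2) * y 2"
      by (simp add: kdot_def axis_def)
    also have "\<dots> = - \<rho> * (\<bar>real_of_int (k$1)\<bar> + \<bar>real_of_int (k$2)\<bar>)"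
      by (simp add: y_def abs_sgn algebra_simps)
    finally have "norm (exp (- 2 * pi * \<i> * kdot k (cvec x + ?w)))
        = exp (- 2 * pi * \<rho> * (\<bar>real_of_int (k$1)\<bar> + \<bar>real_of_int (k$2)\<bar>))"
      by simp
    thus ?thesis unfolding G_def norm_mult using B[OF wst[of x]]
      by (simp only:) (rule mult_right_mono, simp_all)
  qed
  have "continuous_on ubox (\<lambda>x. G (cvec x + ?w))"
    by (rule continuous_on_compose2[of "strip r" G]) (use G wst in \<open>auto simp: sepholo_def intro!: continuous_intros\<close>)
  hence "((\<lambda>x. G (cvec x + ?w)) has_integral integral ubox (\<lambda>x. G (cvec x + ?w))) ubox"
    by (intro integrable_integral integrable_continuous)
  from has_integral_bound[OF order_trans[OF norm_ge_zero bd[of 0]] this bd]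
  have "norm (integral ubox (\<lambda>x. G (cvec x + ?w)))
    \<le> B * exp (- 2 * pi * \<rho> * (\<bar>real_of_int (k$1)\<bar> + \<bar>real_of_int (k$2)\<bar>)) * measure lborel ubox" .
  thus ?thesis by (simp add: eq content_ubox)
qed

section \<open>The real plane as a set of uniqueness\<close>

lemma holomorphic_zero_of_real_zero:
  assumes f: "f holomorphic_on {\<zeta>. \<bar>Im (c + \<zeta>)\<bar> < r}" and c: "\<bar>Im c\<bar> < r"
    and z: "\<And>t. f (of_real t) = 0" and w: "\<bar>Im (c + w)\<bar> < r"
  shows "f w = 0"
proof (rule analytic_continuation[OF f open_hstrip convex_connected[OF convex_hstrip], where U = "range of_real" and \<xi> = 0])
  show "range of_real \<subseteq> {\<zeta>. \<bar>Im (c + \<zeta>)\<bar> < r}" using c by auto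
  show "0 \<in> {\<zeta>. \<bar>Im (c + \<zeta>)\<bar> < r}" using c by auto
  show "(0::complex) islimpt range of_real"
    unfolding islimpt_approachable
  proof (intro allI impI)
    fix e :: real assume "e > 0"
    thus "\<exists>x'\<in>range of_real. x' \<noteq> 0 \<and> dist x' (0::complex) < e"
      by (intro bexI[OF _ rangeI[of of_real "e / 2"]]) auto
  qed
  show "w \<in> {\<zeta>. \<bar>Im (c + \<zeta>)\<bar> < r}" using w by simp
qed (use z in auto)

lemma sepholo_zero:
  assumes F: "sepholo r F" and z: "\<And>x. F (cvec x) = 0" and zr: "z \<in> strip r"
  shows "F z = 0"
proof -
  have r: "r > 0" using zr by (auto simp: strip_def forall_2)
  have hol: "(\<lambda>\<zeta>. F (z + \<zeta> *s axis j 1)) holomorphic_on {\<zeta>. \<bar>Im (z$j + \<zeta>)\<bar> < r}" if "z \<in> strip r" for z j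
    using F that by (auto simp: sepholo_def)
  have one: "F (cvec x + \<zeta> *s axis 1 1) = 0" if "\<bar>Im \<zeta>\<bar> < r" for x \<zeta>
  proof (rule holomorphic_zero_of_real_zero[OF hol[OF cvec_in_strip[OF r]]])
    show "F (cvec x + of_real t *s axis 1 1) = 0" for t using z by (simp flip: cvec_line)
  qed (use that r in auto)
  \<comment> \<open>The first coordinate starts at 0 and receives all of \<open>z$1\<close> as its
    offset; the second starts at the real part of \<open>z$2\<close>, and its imaginary part is
    added last. The identity theorem is used once for each coordinate.\<close>
  let ?x = "(\<chi> i. if i = 1 then 0 else Re (z$2)) :: real^2"
  let ?w = "cvec ?x + (z$1) *s axis 1 1"
  have w: "?w \<in> strip r" using zr r by (auto simp: strip_def forall_2 axis_def)
  have "F (?w + (\<i> * of_real (Im (z$2))) *s axis 2 1) = 0"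
  proof (rule holomorphic_zero_of_real_zero[OF hol[OF w]])
    fix t
    have eq: "?w + of_real t *s axis 2 1 = cvec (?x + t *\<^sub>R axis 2 1) + (z$1) *s axis 1 1"
      by (subst cvec_line) (simp only: add_ac)
    show "F (?w + of_real t *s axis 2 1) = 0"
      unfolding eq by (rule one) (use zr in \<open>auto simp: strip_def\<close>)
  qed (use zr r in \<open>auto simp: strip_def axis_def forall_2\<close>)
  moreover have "?w + (\<i> * of_real (Im (z$2))) *s axis 2 1 = z"
    by (auto simp: vec_eq_iff forall_2 axis_def complex_eq_iff)
  ultimately show ?thesis by simp
qed

section \<open>The hyperbolic splitting and the escape function\<close>

definition nn :: "int^2 \<Rightarrow> real" where
  "nn n = l1 (icvec n)"

lemma nn_2: "nn n = \<bar>real_of_int (n$1)\<bar> + \<bar>real_of_int (n$2)\<bar>"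
  by (simp add: nn_def l1_def icvec_def)

lemma nn_nonneg [simp]: "0 \<le> nn n"
  by (simp add: nn_2)

lemma nn_0 [simp]: "nn 0 = 0"
  by (simp add: nn_2)

lemma nn_ge_1: "n \<noteq> 0 \<Longrightarrow> 1 \<le> nn n"
proof -
  assume "n \<noteq> 0"
  hence "n$1 \<noteq> 0 \<or> n$2 \<noteq> 0" by (auto simp: vec_eq_iff forall_2)
  hence "1 \<le> \<bar>n$1\<bar> + \<bar>n$2\<bar>" by auto
  hence "real_of_int 1 \<le> real_of_int (\<bar>n$1\<bar> + \<bar>n$2\<bar>)" by (subst of_int_le_iff)
  thus ?thesis by (simp add: nn_2)
qed

lemma nn_le_diff: "nn m \<le> nn n + nn (m - n)"
  by (simp add: nn_2)

lemma summable_on_exp_int: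
  assumes "a > 0"
  shows "(\<lambda>i::int. exp (- a * \<bar>real_of_int i\<bar>)) summable_on UNIV"
proof -
  have nat: "(\<lambda>n::nat. exp (- a * real n)) summable_on UNIV"
  proof (rule summable_nonneg_imp_summable_on)
    have "summable (\<lambda>n. exp (- a) ^ n)" by (rule summable_geometric) (use assms in auto)
    thus "summable (\<lambda>n. exp (- a * real n))"
      by (simp add: exp_of_nat_mult[symmetric] mult.commute)
  qed simp
  have "(\<lambda>i::int. exp (- a * \<bar>real_of_int i\<bar>)) summable_on range int"
    using nat by (subst summable_on_reindex) (auto simp: o_def)
  moreover have "(\<lambda>i::int. exp (- a * \<bar>real_of_int i\<bar>)) summable_on range (\<lambda>n. - int n)"
    using nat by (subst summable_on_reindex) (auto simp: o_def inj_on_def)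
  ultimately have "(\<lambda>i::int. exp (- a * \<bar>real_of_int i\<bar>)) summable_on (range int \<union> range (\<lambda>n. - int n))"
    by (rule summable_on_union)
  moreover have "range int \<union> range (\<lambda>n. - int n) = UNIV"
    using int_cases2 by (auto simp: image_iff) metis
  ultimately show ?thesis by simp
qed

text \<open>The exponential splits into a product over the coordinates, so every finite sum is at
  most the product of two one-dimensional geometric sums.\<close>

lemma summable_on_exp_nn:
  assumes "a > 0"
  shows "(\<lambda>n. exp (- a * nn n)) summable_on UNIV"
proof (rule nonneg_bdd_above_summable_on)
  define S where "S = (\<Sum>\<^sub>\<infinity>i::int. exp (- a * \<bar>real_of_int i\<bar>))"
  have fin: "(\<Sum>i\<in>I. exp (- a * \<bar>real_of_int i\<bar>)) \<le> S" if "finite I" for I :: "int set"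
    unfolding S_def by (intro finite_sum_le_infsum summable_on_exp_int assms that) auto
  have S0: "S \<ge> 0" using fin[of "{}"] by simp
  show "bdd_above (sum (\<lambda>n. exp (- a * nn n)) ` {F. F \<subseteq> UNIV \<and> finite F})"
  proof (rule bdd_aboveI2)
    fix F :: "(int^2) set" assume "F \<in> {F. F \<subseteq> UNIV \<and> finite F}"
    hence F: "finite F" by simp
    let ?I = "(\<lambda>n. n$1) ` F" and ?J = "(\<lambda>n. n$2) ` F"
    have inj: "inj_on (\<lambda>n::int^2. (n$1, n$2)) F"
      by (auto simp: inj_on_def vec_eq_iff forall_2)
    have "(\<Sum>n\<in>F. exp (- a * nn n))
      = (\<Sum>n\<in>F. (\<lambda>(i,j). exp (- a * \<bar>real_of_int i\<bar>) * exp (- a * \<bar>real_of_int j\<bar>)) (n$1, n$2))"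
      by (intro sum.cong) (auto simp: nn_2 algebra_simps simp flip: exp_add)
    also have "\<dots> = (\<Sum>(i,j)\<in>(\<lambda>n. (n$1, n$2)) ` F. exp (- a * \<bar>real_of_int i\<bar>) * exp (- a * \<bar>real_of_int j\<bar>))"
      by (subst sum.reindex[OF inj]) (simp add: o_def)
    also have "\<dots> \<le> (\<Sum>(i,j)\<in>?I \<times> ?J. exp (- a * \<bar>real_of_int i\<bar>) * exp (- a * \<bar>real_of_int j\<bar>))"
      by (rule sum_mono2) (use F in auto)
    also have "\<dots> = (\<Sum>i\<in>?I. exp (- a * \<bar>real_of_int i\<bar>)) * (\<Sum>j\<in>?J. exp (- a * \<bar>real_of_int j\<bar>))"
      by (simp add: sum_product sum.cartesian_product)
    also have "\<dots> \<le> S * S" using F by (intro mult_mono fin sum_nonneg S0) auto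
    finally show "(\<Sum>n\<in>F. exp (- a * nn n)) \<le> S * S" .
  qed
qed simp

text \<open>Used to absorb factors that are linear in the frequency, such as those produced by
  differentiation, at the price of half of an exponential rate \<open>b\<close>.\<close>

lemma linear_le_exp: "x \<le> (2 / b) * exp (b * x / 2)" if "b > 0" for x b :: real
proof -
  have "b * x / 2 \<le> exp (b * x / 2)" using exp_ge_add_one_self[of "b * x / 2"] by linarith
  thus ?thesis using that by (simp add: field_simps)
qed

section \<open>Eigenlines of the transposed matrix\<close>

declare transpose_matrix_vector [simp del]

lemma tmul_nth:
  "(transpose (cmat M) *v y) $ 1 = of_int (M$1$1) * y$1 + of_int (M$2$1) * y$2"
  "(transpose (cmat M) *v y) $ 2 = of_int (M$1$2) * y$1 + of_int (M$2$2) * y$2"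
  by (simp_all add: matrix_vector_mult_def transpose_def cmat_def sum_2)

lemma tmul_int_nth:
  "(transpose M *v n) $ 1 = M$1$1 * n$1 + M$2$1 * n$2"
  "(transpose M *v n) $ 2 = M$1$2 * n$1 + M$2$2 * n$2" for M :: "int^2^2"
  by (simp_all add: matrix_vector_mult_def transpose_def sum_2)

lemma icvec_tmul: "icvec (transpose M *v n) = transpose (cmat M) *v icvec n"
  by (simp only: vec_eq_iff forall_2 icvec_def tmul_nth tmul_int_nth
      vec_lambda_beta of_int_add of_int_mult simp_thms)

text \<open>If the trace \<open>\<tau>\<close> is at most 2 in modulus, the characteristic
  polynomial \<open>x^2 - \<tau> x + 1\<close> has a root on the unit circle. An eigenvector is read
  off from the first row when \<open>M$1$2\<close> is nonzero; otherwise the matrix is triangular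
  with diagonal entries 1 or -1.\<close>

lemma hyperbolic_trace:
  assumes det: "det M = 1" and hyp: "hyperbolic M"
  shows "\<bar>M$1$1 + M$2$2\<bar> \<ge> 3"
proof (rule ccontr)
  assume "\<not> ?thesis"
  hence le: "\<bar>M$1$1 + M$2$2\<bar> \<le> 2" by simp
  have d: "M$1$1 * M$2$2 - M$1$2 * M$2$1 = 1" using det by (simp add: det_2)
  define \<tau> where "\<tau> = real_of_int (M$1$1 + M$2$2)"
  have tau: "\<bar>\<tau>\<bar> \<le> 2" using le unfolding \<tau>_def by linarith
  have t4: "\<tau>\<^sup>2 \<le> 4" using abs_le_square_iff[of \<tau> 2] tau by simp
  define \<mu> where "\<mu> = Complex (\<tau> / 2) (sqrt (4 - \<tau>\<^sup>2) / 2)"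
  have "(cmod \<mu>)\<^sup>2 = 1" using t4 by (simp add: \<mu>_def cmod_power2 power_divide field_simps)
  hence n1: "cmod \<mu> = 1" using norm_ge_zero[of \<mu>] by (auto simp: power2_eq_1_iff)
  have char: "\<mu> * \<mu> = of_real \<tau> * \<mu> - 1"
  proof -
    have "sqrt (4 - \<tau>\<^sup>2) * sqrt (4 - \<tau>\<^sup>2) = 4 - \<tau> * \<tau>" using t4 by (simp add: power2_eq_square)
    thus ?thesis by (simp add: \<mu>_def complex_eq_iff field_simps)
  qed
  have cm: "(cmat M *v v) $ 1 = of_int (M$1$1) * v$1 + of_int (M$1$2) * v$2"
    "(cmat M *v v) $ 2 = of_int (M$2$1) * v$1 + of_int (M$2$2) * v$2" for v
    by (simp_all add: matrix_vector_mult_def cmat_def sum_2)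
  have dc: "of_int (M$1$1) * of_int (M$2$2) - of_int (M$1$2) * of_int (M$2$1) = (1::complex)"
    using arg_cong[OF d, of "of_int :: int \<Rightarrow> complex"] by simp
  show False
  proof (cases "M$1$2 = 0")
    case False
    define v :: "complex^2" where "v = (\<chi> i. if i = 1 then of_int (M$1$2) else \<mu> - of_int (M$1$1))"
    have v: "v$1 = of_int (M$1$2)" "v$2 = \<mu> - of_int (M$1$1)" by (simp_all add: v_def)
    have "v \<noteq> 0" using False v(1) by (auto simp: vec_eq_iff intro!: exI[of _ 1])
    moreover have "cmat M *v v = \<mu> *s v"
    proof -
      have "of_int (M$2$1) * of_int (M$1$2) + of_int (M$2$2) * (\<mu> - of_int (M$1$1)) = \<mu> * (\<mu> - of_int (M$1$1))"
        using char dc by (simp add: \<tau>_def algebra_simps)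
      thus ?thesis
        by (simp add: vec_eq_iff forall_2 cm v algebra_simps)
    qed
    ultimately show False using hyp n1 unfolding hyperbolic_def by blast
  next
    case True
    hence "M$1$1 * M$2$2 = 1" using d by simp
    hence "\<bar>M$2$2\<bar> = 1" using abs_zmult_eq_1[of "M$2$2" "M$1$1"] by (simp add: mult.commute)
    hence n1: "cmod (of_int (M$2$2)) = 1" by (simp flip: of_int_abs)
    have "cmat M *v axis 2 1 = of_int (M$2$2) *s axis 2 1"
      by (simp add: vec_eq_iff forall_2 cm axis_def True)
    moreover have "(axis 2 1 :: complex^2) \<noteq> 0" by (simp add: axis_eq_0_iff)
    ultimately show False using hyp n1 unfolding hyperbolic_def by blast
  qed
qed

lemma l1_add: "l1 (x + y) \<le> l1 x + l1 y"
  by (simp add: l1_def) (smt (verit) norm_triangle_ineq)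

lemma l1_diff: "l1 (x - y) \<le> l1 x + l1 y"
  using norm_triangle_ineq4[of "x$1" "y$1"] norm_triangle_ineq4[of "x$2" "y$2"] by (simp add: l1_def)

lemma l1_scale: "l1 (c *s x) = cmod c * l1 x"
  by (simp add: l1_def norm_mult algebra_simps)

lemma l1_nonneg [simp]: "0 \<le> l1 x" by (simp add: l1_def)

text \<open>A trace of modulus at least 3 gives two real eigenvalues \<open>\<mu>\<close> and
  \<open>1 / \<mu>\<close>, neither of modulus 1. The spectral projection onto the expanding line is
  a polynomial in the matrix, so it commutes with it, is linear and bounded, and equals
  \<open>yplus\<close> by uniqueness of the decomposition.\<close>

lemma hyperbolic_splitting:
  assumes det: "det M = 1" and hyp: "hyperbolic M"
  obtains \<mu> :: complex where "cmod \<mu> > 1"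
    "\<And>y. transpose (cmat M) *v yplus M y = \<mu> *s yplus M y"
    "\<And>y. transpose (cmat M) *v (y - yplus M y) = (1 / \<mu>) *s (y - yplus M y)"
    "\<And>y. yplus M (transpose (cmat M) *v y) = \<mu> *s yplus M y"
    "\<And>x y. yplus M (x - y) = yplus M x - yplus M y"
    "\<exists>K\<ge>0. \<forall>y. l1 (yplus M y) \<le> K * l1 y"
proof -
  define \<tau> where "\<tau> = real_of_int (M$1$1 + M$2$2)"
  have tau: "\<bar>\<tau>\<bar> \<ge> 3" using hyperbolic_trace[OF assms] unfolding \<tau>_def by linarith
  have t4: "\<tau>\<^sup>2 \<ge> 9" using abs_le_square_iff[of 3 \<tau>] tau by simp
  \<comment> \<open>The sign of the trace selects the root of larger modulus.\<close>
  define m where "m = (\<tau> + sgn \<tau> * sqrt (\<tau>\<^sup>2 - 4)) / 2"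
  have m1: "\<bar>m\<bar> > 1"
  proof -
    define s where "s = sqrt (\<tau>\<^sup>2 - 4)"
    have s: "s \<ge> 0" "m = (\<tau> + sgn \<tau> * s) / 2" using t4 by (simp_all add: s_def m_def)
    show ?thesis
    proof (cases "\<tau> > 0")
      case True thus ?thesis using tau s by simp
    next
      case False
      hence "\<tau> \<le> -3" using tau by auto
      thus ?thesis using s by (simp add: sgn_if)
    qed
  qed
  have "sgn \<tau> * sgn \<tau> = 1" using tau by (auto simp: sgn_if)
  hence sq: "(sgn \<tau> * sqrt (\<tau>\<^sup>2 - 4))\<^sup>2 = \<tau>\<^sup>2 - 4"
    using t4 by (simp add: power2_eq_square[of "sgn \<tau>"] power_mult_distrib)
  have "m * m - \<tau> * m + 1 = ((sgn \<tau> * sqrt (\<tau>\<^sup>2 - 4))\<^sup>2 - \<tau>\<^sup>2 + 4) / 4"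
    unfolding m_def by (simp add: field_simps power2_eq_square)
  hence char: "m * m = \<tau> * m - 1" using sq by simp
  define \<mu> where "\<mu> = complex_of_real m"
  have mu1: "cmod \<mu> > 1" using m1 by (simp add: \<mu>_def)
  hence mu0: "\<mu> \<noteq> 0" by auto
  have charc: "\<mu> * \<mu> = of_real \<tau> * \<mu> - 1"
    unfolding \<mu>_def using char by (metis of_real_1 of_real_diff of_real_mult)
  have inv: "1 / \<mu> = of_real \<tau> - \<mu>" using charc mu0 by (simp add: field_simps)
  define \<nu> where "\<nu> = 1 / \<mu>"
  have nu: "\<nu> = of_real \<tau> - \<mu>" "\<mu> * \<nu> = 1" "cmod \<nu> < 1"
  proof -
    show "\<nu> = of_real \<tau> - \<mu>" using inv by (simp add: \<nu>_def)
    show "\<mu> * \<nu> = 1" using mu0 by (simp add: \<nu>_def)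
    show "cmod \<nu> < 1" using mu1 mu0 by (simp add: \<nu>_def norm_divide divide_less_eq_1_pos)
  qed
  have ne: "\<mu> - \<nu> \<noteq> 0" using mu1 nu(3) by auto
  let ?N = "\<lambda>y. transpose (cmat M) *v y"
  have d: "M$1$1 * M$2$2 - M$1$2 * M$2$1 = 1" using det by (simp add: det_2)
  have dc: "of_int (M$1$1) * of_int (M$2$2) - of_int (M$1$2) * of_int (M$2$1) = (1::complex)"
    using arg_cong[OF d, of "of_int :: int \<Rightarrow> complex"] by simp
  have CH: "?N (?N y) = of_real \<tau> *s ?N y - y" for y
  proof -
    have "(?N (?N y)) $ 1 = (of_real \<tau> *s ?N y - y) $ 1 + (1 - (of_int (M$1$1) * of_int (M$2$2) - of_int (M$1$2) * of_int (M$2$1))) * y$1"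
      by (simp add: tmul_nth \<tau>_def algebra_simps)
    moreover have "(?N (?N y)) $ 2 = (of_real \<tau> *s ?N y - y) $ 2 + (1 - (of_int (M$1$1) * of_int (M$2$2) - of_int (M$1$2) * of_int (M$2$1))) * y$2"
      by (simp add: tmul_nth \<tau>_def algebra_simps)
    ultimately show ?thesis unfolding dc by (simp add: vec_eq_iff forall_2)
  qed
  have Nsub: "?N (x - y) = ?N x - ?N y" and Nsc: "?N (c *s y) = c *s ?N y" for x y c
    by (simp_all add: vec_eq_iff forall_2 tmul_nth algebra_simps)
  \<comment> \<open>The interpolation polynomial that is 1 at \<open>\<mu>\<close> and 0 at
    \<open>\<nu>\<close>, evaluated at the matrix; Cayley-Hamilton makes it the projection onto the
    \<open>\<mu>\<close> eigenline.\<close>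
  define P where "P y = (1 / (\<mu> - \<nu>)) *s (?N y - \<nu> *s y)" for y
  have NP: "?N (P y) = \<mu> *s P y" for y
  proof -
    have "(of_real \<tau> * a - b) - \<nu> * a = \<mu> * (a - \<nu> * b)" for a b
    proof -
      have "(of_real \<tau> * a - b) - \<nu> * a = \<mu> * a - 1 * b" by (simp add: nu(1) algebra_simps)
      also have "\<dots> = \<mu> * a - (\<mu> * \<nu>) * b" by (simp only: nu(2))
      finally show ?thesis by (simp add: algebra_simps)
    qed
    hence "(of_real \<tau> *s ?N y - y) - \<nu> *s ?N y = \<mu> *s (?N y - \<nu> *s y)"
      by (simp only: vec_eq_iff vector_minus_component vector_smult_component) blast
    hence "?N (P y) = (1 / (\<mu> - \<nu>)) *s (\<mu> *s (?N y - \<nu> *s y))"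
      unfolding P_def Nsub Nsc CH by (rule arg_cong)
    thus ?thesis unfolding P_def by (simp only: vector_smult_assoc mult.commute)
  qed
  have yP: "y - P y = (1 / (\<mu> - \<nu>)) *s (\<mu> *s y - ?N y)" for y
    unfolding P_def using ne by (simp add: vec_eq_iff field_simps)
  have NQ: "?N (y - P y) = \<nu> *s (y - P y)" for y
  proof -
    have "\<mu> * a - (of_real \<tau> * a - b) = \<nu> * (\<mu> * b - a)" for a b
    proof -
      have "\<mu> * a - (of_real \<tau> * a - b) = 1 * b - \<nu> * a" by (simp add: nu(1) algebra_simps)
      also have "\<dots> = (\<mu> * \<nu>) * b - \<nu> * a" by (simp only: nu(2))
      finally show ?thesis by (simp add: algebra_simps)
    qed
    hence "\<mu> *s ?N y - (of_real \<tau> *s ?N y - y) = \<nu> *s (\<mu> *s y - ?N y)"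
      by (simp only: vec_eq_iff vector_minus_component vector_smult_component) blast
    hence "?N (y - P y) = (1 / (\<mu> - \<nu>)) *s (\<nu> *s (\<mu> *s y - ?N y))"
      unfolding yP Nsub Nsc CH by (rule arg_cong)
    thus ?thesis unfolding yP by (simp only: vector_smult_assoc mult.commute)
  qed
  \<comment> \<open>The sets \<open>Eplus\<close> and \<open>Eminus\<close> allow the eigenvalue to
    vary with the vector. Cayley-Hamilton shows that only \<open>\<mu>\<close> and
    \<open>\<nu>\<close> can occur for a nonzero vector, which makes both sets eigenlines of fixed
    eigenvalues.\<close>
  have eig: "v = 0 \<or> \<mu>' = \<mu> \<or> \<mu>' = \<nu>" if "?N v = \<mu>' *s v" for v \<mu>'
  proof -
    have "\<mu>' *s (\<mu>' *s v) = of_real \<tau> *s (\<mu>' *s v) - v"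
      using CH[of v] that by (simp add: Nsc)
    hence ev: "\<mu>' * (\<mu>' * v $ i) = of_real \<tau> * (\<mu>' * v $ i) - v $ i" for i
      by (metis vector_minus_component vector_smult_component)
    have "(\<mu>' - \<mu>) * (\<mu>' - \<nu>) * v $ i = 0" for i
    proof -
      have "(\<mu>' - \<mu>) * (\<mu>' - \<nu>) * v $ i
          = \<mu>' * (\<mu>' * v $ i) - (\<mu> + \<nu>) * (\<mu>' * v $ i) + (\<mu> * \<nu>) * v $ i"
        by (simp add: algebra_simps)
      also have "\<mu> + \<nu> = of_real \<tau>" by (simp add: nu(1))
      finally show ?thesis by (simp add: nu(2) ev)
    qed
    thus ?thesis by (auto simp: vec_eq_iff)
  qed
  have plus: "?N p = \<mu> *s p" if "p \<in> Eplus M" for p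
  proof -
    from that obtain \<mu>' where "cmod \<mu>' > 1" "?N p = \<mu>' *s p" by (auto simp: Eplus_def)
    thus ?thesis using eig[of p \<mu>'] nu(3) by (auto simp: Nsub)
  qed
  have minus: "?N p = \<nu> *s p" if "p \<in> Eminus M" for p
  proof -
    from that obtain \<mu>' where "cmod \<mu>' < 1" "?N p = \<mu>' *s p" by (auto simp: Eminus_def)
    thus ?thesis using eig[of p \<mu>'] mu1 by auto
  qed
  have yplus: "yplus M y = P y" for y
    unfolding yplus_def
  proof (rule the_equality)
    show "P y \<in> Eplus M \<and> y - P y \<in> Eminus M"
      using NP NQ mu1 nu(3) unfolding Eplus_def Eminus_def by blast
  next
    fix p assume p: "p \<in> Eplus M \<and> y - p \<in> Eminus M"
    have "?N y - \<mu> *s p = \<nu> *s (y - p)" using plus minus p by (metis Nsub)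
    hence e: "?N y - \<nu> *s y = (\<mu> - \<nu>) *s p"
      by (simp add: vec_eq_iff algebra_simps)
    have "1 / (\<mu> - \<nu>) * (\<mu> - \<nu>) = 1" using ne by simp
    thus "p = P y" unfolding P_def e by (simp only: vector_smult_assoc vector_smult_lid)
  qed
  define K where "K = (1 / cmod (\<mu> - \<nu>)) * (cmod (of_int (M$1$1)) + cmod (of_int (M$2$1)) + cmod (of_int (M$1$2)) + cmod (of_int (M$2$2)) + cmod \<nu>)"
  have K: "l1 (P y) \<le> K * l1 y" for y
  proof -
    have "l1 (?N y - \<nu> *s y) \<le> l1 (?N y) + cmod \<nu> * l1 y"
      using l1_diff[of "?N y" "\<nu> *s y"] by (simp add: l1_scale)
    also have "l1 (?N y) \<le> (cmod (of_int (M$1$1)) + cmod (of_int (M$2$1)) + cmod (of_int (M$1$2)) + cmod (of_int (M$2$2))) * l1 y"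
    proof -
      have "l1 (?N y) \<le> (cmod (of_int (M$1$1)) * cmod (y$1) + cmod (of_int (M$2$1)) * cmod (y$2)) +
         (cmod (of_int (M$1$2)) * cmod (y$1) + cmod (of_int (M$2$2)) * cmod (y$2))"
        unfolding l1_def tmul_nth by (intro add_mono order_trans[OF norm_triangle_ineq]) (simp_all add: norm_mult)
      also have "\<dots> \<le> (cmod (of_int (M$1$1)) * l1 y + cmod (of_int (M$2$1)) * l1 y) +
         (cmod (of_int (M$1$2)) * l1 y + cmod (of_int (M$2$2)) * l1 y)"
        by (intro add_mono mult_left_mono) (auto simp: l1_def)
      finally show ?thesis by (simp add: algebra_simps)
    qed
    finally have "l1 (?N y - \<nu> *s y) \<le> (cmod (of_int (M$1$1)) + cmod (of_int (M$2$1)) + cmod (of_int (M$1$2)) + cmod (of_int (M$2$2)) + cmod \<nu>) * l1 y"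
      by (simp add: algebra_simps)
    thus ?thesis unfolding P_def l1_scale K_def
      by (simp add: norm_divide divide_right_mono)
  qed
  have K0: "K \<ge> 0" unfolding K_def by (intro mult_nonneg_nonneg add_nonneg_nonneg) auto
  show ?thesis
  proof (rule that[OF mu1])
    show "?N (yplus M y) = \<mu> *s yplus M y" for y by (simp add: yplus NP)
    show "?N (y - yplus M y) = (1 / \<mu>) *s (y - yplus M y)" for y
      using NQ[of y] by (simp add: yplus \<nu>_def)
    show "yplus M (?N y) = \<mu> *s yplus M y" for y
      unfolding yplus NP[symmetric] unfolding P_def Nsub Nsc ..
    show "yplus M (x - y) = yplus M x - yplus M y" for x y
      unfolding yplus P_def Nsub by (simp add: vec_eq_iff algebra_simps)
    show "\<exists>K\<ge>0. \<forall>y. l1 (yplus M y) \<le> K * l1 y" using K0 K yplus by auto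
  qed
qed

text \<open>The escape function \<open>|.|\<^sub>M\<close> decreases along the dual dynamics; the second term is the Lipschitz
  error incurred when \<open>m\<close> is not the exact image of \<open>n\<close>.\<close>

lemma normM_drop:
  assumes det: "det M = 1" and hyp: "hyperbolic M"
  obtains \<kappa> K where "0 < \<kappa>" "\<kappa> \<le> 1" "0 < K"
    "\<And>m n. normM M (icvec n) - normM M (icvec m) \<le> - \<kappa> * nn n + K * nn (m - transpose M *v n)"
proof -
  obtain \<mu> where mu: "cmod \<mu> > 1"
    "\<And>y. transpose (cmat M) *v yplus M y = \<mu> *s yplus M y"
    "\<And>y. transpose (cmat M) *v (y - yplus M y) = (1 / \<mu>) *s (y - yplus M y)"
    "\<And>y. yplus M (transpose (cmat M) *v y) = \<mu> *s yplus M y"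
    "\<And>x y. yplus M (x - y) = yplus M x - yplus M y"
    "\<exists>K\<ge>0. \<forall>y. l1 (yplus M y) \<le> K * l1 y"
    by (rule hyperbolic_splitting[OF assms]) (rule that, assumption+)
  obtain K where K: "K \<ge> 0" "\<And>y. l1 (yplus M y) \<le> K * l1 y" using mu(6) by blast
  let ?N = "\<lambda>y. transpose (cmat M) *v y"
  define lm where "lm = cmod \<mu>"
  have lam: "lm > 1" using mu(1) by (simp add: lm_def)
  \<comment> \<open>Here \<open>lm\<close> is the expansion factor. The contracted component
    contributes the rate \<open>1 - 1 / lm\<close> and the expanded one the rate
    \<open>lm - 1\<close>, which is no smaller, so \<open>\<kappa>\<close> serves for both.\<close>
  define \<kappa> where "\<kappa> = 1 - 1 / lm"
  have kap: "0 < \<kappa>" "\<kappa> \<le> 1" "\<kappa> \<le> lm - 1"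
  proof -
    have "1 / lm < 1" "1 / lm > 0" using lam by auto
    thus "0 < \<kappa>" "\<kappa> \<le> 1" by (auto simp: \<kappa>_def)
    have "0 \<le> (lm - 1) * (lm - 1) / lm" using lam by simp
    also have "\<dots> = (lm - 1) - \<kappa>" using lam by (simp add: \<kappa>_def field_simps)
    finally show "\<kappa> \<le> lm - 1" by simp
  qed
  have drop: "normM M y - normM M (?N y) \<le> - \<kappa> * l1 y" for y
  proof -
    have "?N y - yplus M (?N y) = ?N y - ?N (yplus M y)" by (simp only: mu(2,4))
    also have "\<dots> = ?N (y - yplus M y)"
      by (simp add: vec_eq_iff forall_2 tmul_nth algebra_simps)
    finally have e: "?N y - yplus M (?N y) = (1 / \<mu>) *s (y - yplus M y)" by (simp only: mu(3))
    have "normM M (?N y) = lm * l1 (yplus M y) - 1 / lm * l1 (y - yplus M y)"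
      by (simp only: normM_def e) (simp only: mu(4) l1_scale, simp add: lm_def norm_divide)
    hence "normM M y - normM M (?N y) = - ((lm - 1) * l1 (yplus M y) + \<kappa> * l1 (y - yplus M y))"
      by (simp add: normM_def \<kappa>_def algebra_simps)
    moreover have "\<kappa> * l1 y \<le> \<kappa> * (l1 (yplus M y) + l1 (y - yplus M y))"
      using kap l1_add[of "yplus M y" "y - yplus M y"] by (intro mult_left_mono) auto
    moreover have "\<kappa> * l1 (yplus M y) \<le> (lm - 1) * l1 (yplus M y)"
      using kap by (intro mult_right_mono) auto
    ultimately show ?thesis by (simp add: algebra_simps)
  qed
  \<comment> \<open>The plus component costs \<open>K\<close>, the bound of the projection, and the
    complementary component costs \<open>1 + K\<close>.\<close>
  have lip: "normM M u - normM M v \<le> (2 * K + 1) * l1 (v - u)" for u v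
  proof -
    have l1m: "l1 (u - v) = l1 (v - u)" for u v by (simp add: l1_def norm_minus_commute)
    have 1: "l1 (yplus M u) \<le> l1 (yplus M v) + K * l1 (v - u)"
      using l1_add[of "yplus M v" "yplus M (u - v)"] K(2)[of "u - v"] l1m[of u v] by (simp add: mu(5))
    have "l1 (v - yplus M v) \<le> l1 (u - yplus M u) + l1 ((v - u) - yplus M (v - u))"
      using l1_add[of "u - yplus M u" "(v - u) - yplus M (v - u)"] by (simp add: mu(5) algebra_simps)
    also have "l1 ((v - u) - yplus M (v - u)) \<le> l1 (v - u) + K * l1 (v - u)"
      using l1_diff[of "v - u" "yplus M (v - u)"] K(2)[of "v - u"] by linarith
    finally show ?thesis using 1 by (simp add: normM_def algebra_simps)
  qed
  show ?thesis
  proof (rule that[OF kap(1,2), of "2 * K + 1"])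
    show "0 < 2 * K + 1" using K by simp
    fix m n
    have e: "l1 (icvec m - icvec (transpose M *v n)) = nn (m - transpose M *v n)"
      by (simp add: nn_def l1_def icvec_def)
    show "normM M (icvec n) - normM M (icvec m) \<le> - \<kappa> * nn n + (2 * K + 1) * nn (m - transpose M *v n)"
      using drop[of "icvec n"] lip[of "?N (icvec n)" "icvec m"]
      unfolding icvec_tmul[symmetric] e nn_def by linarith
  qed
qed

section \<open>The group of fixed points\<close>

text \<open>By Bezout the integer matrix with rows \<open>(u, v)\<close> and
  \<open>(- s div g, p div g)\<close> has determinant 1. Applied to the two linear forms it makes
  the system triangular, and its inverse is integral too, so integrality is preserved in both
  directions.\<close>

lemma torus_kernel_reduce:
  fixes p q s t u v g :: int and x y :: real
  assumes g: "g = gcd p s" "g > 0" and uv: "u * p + v * s = g"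
  shows "(p * x + q * y \<in> \<int> \<and> s * x + t * y \<in> \<int>) \<longleftrightarrow>
    (g * x + (u * q + v * t) * y \<in> \<int> \<and> ((p div g) * t - (s div g) * q) * y \<in> \<int>)"
proof -
  define p' s' where "p' = p div g" and "s' = s div g"
  have p: "p = g * p'" and s: "s = g * s'" using g by (simp_all add: p'_def s'_def)
  have "g * (u * p' + v * s') = g * 1" using uv p s by (simp add: algebra_simps)
  hence "u * p' + v * s' = 1" using g(2) by (metis mult_cancel_left less_irrefl)
  hence uv': "real_of_int u * p' + real_of_int v * s' = 1"
    by (metis of_int_1 of_int_add of_int_mult)
  have pr: "real_of_int p = g * p'" "real_of_int s = g * s'" using p s by simp_all
  have gr: "real_of_int g = real_of_int u * p + real_of_int v * s"
    using uv by (metis of_int_add of_int_mult)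
  define R1 R2 where "R1 = p * x + q * y" and "R2 = s * x + t * y"
  define S1 S2 where "S1 = g * x + (u * q + v * t) * y" and "S2 = (p' * t - s' * q) * y"
  have 1: "S1 = u * R1 + v * R2" by (simp add: S1_def R1_def R2_def gr algebra_simps)
  have 2: "S2 = p' * R2 - s' * R1" by (simp add: S2_def R1_def R2_def pr algebra_simps)
  have 3: "R1 = p' * S1 - v * S2"
  proof -
    have "p' * S1 - v * S2 = (u * p' + v * s') * R1 + p' * v * R2 - v * p' * R2"
      unfolding 1 2 by (simp add: algebra_simps)
    thus ?thesis by (simp add: uv')
  qed
  have 4: "R2 = s' * S1 + u * S2"
  proof -
    have "s' * S1 + u * S2 = (u * p' + v * s') * R2" unfolding 1 2 by (simp add: algebra_simps)
    thus ?thesis by (simp add: uv')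
  qed
  have "R1 \<in> \<int> \<and> R2 \<in> \<int> \<longleftrightarrow> S1 \<in> \<int> \<and> S2 \<in> \<int>"
  proof
    assume "R1 \<in> \<int> \<and> R2 \<in> \<int>"
    thus "S1 \<in> \<int> \<and> S2 \<in> \<int>" unfolding 1 2 by (auto intro!: Ints_add Ints_mult Ints_diff)
  next
    assume "S1 \<in> \<int> \<and> S2 \<in> \<int>"
    thus "R1 \<in> \<int> \<and> R2 \<in> \<int>" unfolding 3 4 by (auto intro!: Ints_add Ints_mult Ints_diff)
  qed
  thus ?thesis by (simp add: R1_def R2_def S1_def S2_def p'_def s'_def)
qed

text \<open>In triangular form \<open>d * y\<close> must be an integer, which leaves
  \<open>d\<close> values of \<open>y\<close> in the unit interval, and each of them admits
  \<open>g\<close> values of \<open>x\<close>. The product \<open>g * d\<close> is the absolute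
  value of the determinant.\<close>

lemma card_torus_kernel:
  fixes p q s t :: int
  assumes D: "p * t - q * s \<noteq> 0"
  defines "F \<equiv> {(x::real, y::real). 0 \<le> x \<and> x < 1 \<and> 0 \<le> y \<and> y < 1 \<and>
    of_int p * x + of_int q * y \<in> \<int> \<and> of_int s * x + of_int t * y \<in> \<int>}"
  shows "finite F \<and> int (card F) = \<bar>p * t - q * s\<bar>"
proof -
  define g where "g = gcd p s"
  have g0: "g > 0" unfolding g_def using D by (auto simp: gcd_pos_int)
  obtain u v where uv: "u * p + v * s = g" unfolding g_def using bezout_int by blast
  define \<beta> where "\<beta> = u * q + v * t"
  define \<delta> where "\<delta> = (p div g) * t - (s div g) * q"
  have gd: "g * \<delta> = p * t - q * s"
  proof -
    have "g * (p div g) = p" "g * (s div g) = s" by (simp_all add: g_def)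
    thus ?thesis unfolding \<delta>_def by (metis (no_types, opaque_lifting) mult.assoc mult.commute right_diff_distrib)
  qed
  hence d0: "\<delta> \<noteq> 0" using D by auto
  define d where "d = \<bar>\<delta>\<bar>"
  have d: "d > 0" using d0 by (simp add: d_def)
  have F: "(x, y) \<in> F \<longleftrightarrow> 0 \<le> x \<and> x < 1 \<and> 0 \<le> y \<and> y < 1 \<and> g * x + \<beta> * y \<in> \<int> \<and> d * y \<in> \<int>" for x y :: real
  proof -
    have "d * y \<in> \<int> \<longleftrightarrow> \<delta> * y \<in> \<int>" by (cases "\<delta> \<ge> 0") (auto simp: d_def)
    moreover have "(x, y) \<in> F \<longleftrightarrow> (0 \<le> x \<and> x < 1 \<and> 0 \<le> y \<and> y < 1) \<and> (p * x + q * y \<in> \<int> \<and> s * x + t * y \<in> \<int>)"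
      by (simp add: F_def)
    moreover have "(p * x + q * y \<in> \<int> \<and> s * x + t * y \<in> \<int>) \<longleftrightarrow> (g * x + \<beta> * y \<in> \<int> \<and> \<delta> * y \<in> \<int>)"
      using torus_kernel_reduce[OF g_def g0 uv, of x q y t] by (simp add: \<beta>_def \<delta>_def)
    ultimately show ?thesis by blast
  qed
  \<comment> \<open>The second coordinate is \<open>j / d\<close>. The first solves
    \<open>g * x = - \<beta> * y\<close> modulo 1: \<open>frac\<close> supplies one representative
    and \<open>i\<close> runs through its translates by integers.\<close>
  let ?f = "\<lambda>(i::int, j::int). ((i + frac (- \<beta> * (j / d))) / g, j / d)"
  have bij: "bij_betw ?f ({0..<g} \<times> {0..<d}) F"
  proof (rule bij_betwI')
    fix a b assume ab: "a \<in> {0..<g} \<times> {0..<d}" "b \<in> {0..<g} \<times> {0..<d}"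
    show "?f a = ?f b \<longleftrightarrow> a = b" using g0 d by (auto simp: split_def prod_eq_iff)
  next
    fix a assume "a \<in> {0..<g} \<times> {0..<d}"
    then obtain i j where a: "a = (i, j)" and ij: "0 \<le> i" "i < g" "0 \<le> j" "j < d" by auto
    define y where "y = real_of_int j / d"
    define x where "x = (i + frac (- \<beta> * y)) / g"
    have y: "0 \<le> y" "y < 1" using ij d by (simp_all add: y_def)
    have "real_of_int i + 1 \<le> real_of_int g" using ij by linarith
    hence "real_of_int i + frac (- \<beta> * y) < real_of_int g" using frac_lt_1[of "- \<beta> * y"] by linarith
    hence "x < 1" using g0 by (simp add: x_def)
    moreover have "0 \<le> x" using ij g0 by (simp add: x_def)
    moreover have "d * y \<in> \<int>" using d by (simp add: y_def)
    moreover have "g * x + \<beta> * y = i - \<lfloor>- \<beta> * y\<rfloor>" using g0 by (simp add: x_def frac_def)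
    hence "g * x + \<beta> * y \<in> \<int>" by simp
    ultimately have "(x, y) \<in> F" using y F by blast
    thus "?f a \<in> F" by (simp add: a x_def y_def)
  next
    fix b assume "b \<in> F"
    then obtain x y where b: "b = (x, y)" and xy: "(x, y) \<in> F" by (cases b) auto
    hence xy: "0 \<le> x" "x < 1" "0 \<le> y" "y < 1" "g * x + \<beta> * y \<in> \<int>" "d * y \<in> \<int>" using F by auto
    obtain j where j: "d * y = of_int j" using xy(6) by (auto elim: Ints_cases)
    hence yj: "y = j / d" using d by (simp add: field_simps)
    obtain k where k: "g * x + \<beta> * y = of_int k" using xy(5) by (auto elim: Ints_cases)
    define i where "i = k + \<lfloor>- \<beta> * y\<rfloor>"
    have i: "g * x = i + frac (- \<beta> * y)" using k by (simp add: i_def frac_def)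
    hence xi: "x = (i + frac (- \<beta> * y)) / g" using g0 by (simp add: field_simps)
    have "0 \<le> real_of_int d * y" "real_of_int d * y < d * 1"
      using xy d by (auto intro!: mult_strict_left_mono)
    hence "0 \<le> j" "j < d" using j by auto
    moreover have "0 \<le> real_of_int g * x" "real_of_int g * x < g * 1"
      using xy g0 by (auto intro!: mult_strict_left_mono)
    hence "real_of_int i > -1" "real_of_int i < g"
      using i frac_lt_1[of "- \<beta> * y"] frac_ge_0[of "- \<beta> * y"] by linarith+
    hence "0 \<le> i" "i < g" by linarith+
    ultimately show "\<exists>a\<in>{0..<g} \<times> {0..<d}. b = ?f a"
      by (intro bexI[of _ "(i, j)"]) (auto simp: b xi yj)
  qed
  have "finite F" using bij_betw_finite[OF bij] by simp
  moreover have "card F = card ({0..<g} \<times> {0..<d})" using bij_betw_same_card[OF bij] by simp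
  moreover have "\<dots> = nat g * nat d" by (simp add: card_cartesian_product)
  moreover have "int (nat g * nat d) = \<bar>p * t - q * s\<bar>"
    using g0 d gd[symmetric] by (simp add: d_def abs_mult)
  ultimately show ?thesis by simp
qed

section \<open>Fixed points and resonant frequencies\<close>

abbreviation defect :: "int^2^2 \<Rightarrow> real^2^2" where
  "defect M \<equiv> mat 1 - rmat M"

lemma mat1_nth: "(mat 1 :: real^2^2) $ i $ j = (if i = j then 1 else 0)"
  by (simp add: Finite_Cartesian_Product.mat_def)

lemma rmat_nth: "rmat M $ i $ j = of_int (M$i$j)"
  by (simp add: rmat_def)

lemma det_defect: "det (defect M) = of_int ((1 - M$1$1) * (1 - M$2$2) - M$1$2 * M$2$1)"
  by (simp add: det_2 mat1_nth rmat_nth)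

lemma det_defect_nz:
  assumes "det M = 1" "hyperbolic M"
  shows "det (defect M) \<noteq> 0"
proof -
  have "(1 - M$1$1) * (1 - M$2$2) - M$1$2 * M$2$1 = 2 - (M$1$1 + M$2$2)"
    using assms(1) by (simp add: det_2 algebra_simps)
  moreover have "2 - (M$1$1 + M$2$2) \<noteq> 0" using hyperbolic_trace[OF assms] by auto
  ultimately show ?thesis unfolding det_defect by (subst of_int_eq_0_iff) simp
qed

lemma fixpts_iff:
  "x \<in> fixpts M \<longleftrightarrow> (\<forall>i. 0 \<le> x$i \<and> x$i < 1) \<and> (\<forall>i. (defect M *v x)$i \<in> \<int>)"
proof -
  have "(rmat M *v x - x) = - (defect M *v x)" by (simp add: matrix_vector_mult_diff_rdistrib)
  hence "(rmat M *v x - x) $ i \<in> \<int> \<longleftrightarrow> (defect M *v x) $ i \<in> \<int>" for i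
    by (metis minus_in_Ints_iff vector_uminus_component)
  thus ?thesis by (auto simp: fixpts_def)
qed

lemma defect_mul_nth:
  "(defect M *v x) $ 1 = of_int (1 - M$1$1) * x$1 + of_int (- M$1$2) * x$2"
  "(defect M *v x) $ 2 = of_int (- M$2$1) * x$1 + of_int (1 - M$2$2) * x$2"
  by (simp_all add: matrix_vector_mult_def sum_2 mat1_nth rmat_nth)

lemma card_fixpts:
  assumes "det (defect M) \<noteq> 0"
  shows "finite (fixpts M)" "real (card (fixpts M)) = NM M"
proof -
  let ?D = "(1 - M$1$1) * (1 - M$2$2) - (- M$1$2) * (- M$2$1)"
  have D: "real_of_int ?D = det (defect M)" by (simp add: det_defect)
  hence D: "?D \<noteq> 0" "real_of_int ?D = det (defect M)" using assms by (metis of_int_0, simp)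
  let ?F = "{(x::real, y::real). 0 \<le> x \<and> x < 1 \<and> 0 \<le> y \<and> y < 1 \<and>
    of_int (1 - M$1$1) * x + of_int (- M$1$2) * y \<in> \<int> \<and> of_int (- M$2$1) * x + of_int (1 - M$2$2) * y \<in> \<int>}"
  have bij: "bij_betw (\<lambda>x::real^2. (x$1, x$2)) (fixpts M) ?F"
  proof (rule bij_betwI[where g = "\<lambda>(a, b). (\<chi> i. if i = 1 then a else b)"])
    show "(\<lambda>x::real^2. (x$1, x$2)) \<in> fixpts M \<rightarrow> ?F"
      unfolding Pi_iff by (intro ballI) (simp only: fixpts_iff forall_2 defect_mul_nth mem_Collect_eq prod.case simp_thms)
    show "(\<lambda>(a, b). (\<chi> i. if i = 1 then a else b)) \<in> ?F \<rightarrow> fixpts M"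
      by (simp only: fixpts_iff forall_2 defect_mul_nth Pi_iff) auto
  qed (auto simp: vec_eq_iff forall_2)
  from card_torus_kernel[OF D(1)] have F: "finite ?F" "int (card ?F) = \<bar>?D\<bar>" by auto
  show "finite (fixpts M)" using bij_betw_finite[OF bij] F(1) by blast
  have "real (card (fixpts M)) = of_int (int (card ?F))"
    using bij_betw_same_card[OF bij] by simp
  also have "\<dots> = \<bar>det (defect M)\<bar>" unfolding F(2) D(2)[symmetric] by simp
  finally show "real (card (fixpts M)) = NM M" by (simp add: NM_def)
qed

lemma ndot_defect: "ndot n (defect M *v x) = ndot (n - transpose M *v n) x"
  unfolding ndot_2 defect_mul_nth vector_minus_component tmul_int_nth by (simp add: algebra_simps)

lemma ndot_Ints: "(\<And>i. x$i \<in> \<int>) \<Longrightarrow> ndot n x \<in> \<int>"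
  by (auto simp: ndot_2 intro!: Ints_add Ints_mult)

lemma echar_of_Ints: "(\<And>i. x$i \<in> \<int>) \<Longrightarrow> echar n x = 1"
  by (intro echar_eq_1 ndot_Ints)

definition vfrac :: "real^2 \<Rightarrow> real^2" where
  "vfrac x = (\<chi> i. frac (x$i))"

lemma vfrac_eq: "vfrac x = x - (\<chi> i. of_int \<lfloor>x$i\<rfloor>)"
  by (simp add: vfrac_def frac_def vec_eq_iff)

lemma echar_vfrac: "echar n (vfrac x) = echar n x"
proof -
  have "echar n x = echar n (vfrac x + (\<chi> i. of_int \<lfloor>x$i\<rfloor>))" by (simp add: vfrac_eq)
  also have "\<dots> = echar n (vfrac x)" unfolding echar_add by (simp add: echar_of_Ints)
  finally show ?thesis ..
qed

lemma defect_Ints: "(\<And>i. x$i \<in> \<int>) \<Longrightarrow> (defect M *v x) $ i \<in> \<int>"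
  unfolding matrix_vector_mult_def
  by (auto simp: mat1_nth rmat_nth sum_2 intro!: Ints_add Ints_mult Ints_diff)

lemma vfrac_fixpts:
  assumes "\<And>i. (defect M *v x)$i \<in> \<int>"
  shows "vfrac x \<in> fixpts M"
proof -
  have "(defect M *v vfrac x) $ i \<in> \<int>" for i
    unfolding vfrac_eq matrix_vector_mult_diff_distrib vector_minus_component
    by (intro Ints_diff assms defect_Ints) simp
  moreover have "0 \<le> vfrac x $ i \<and> vfrac x $ i < 1" for i by (simp add: vfrac_def frac_lt_1)
  ultimately show ?thesis by (simp add: fixpts_iff)
qed

lemma matrix_inv_works:
  fixes A :: "real^2^2"
  assumes "det A \<noteq> 0"
  shows "A ** matrix_inv A = mat 1" "matrix_inv A ** A = mat 1"
proof -
  have "invertible A" using assms by (simp add: invertible_det_nz)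
  hence "A ** matrix_inv A = mat 1 \<and> matrix_inv A ** A = mat 1"
    unfolding invertible_def matrix_inv_def by (rule someI_ex)
  thus "A ** matrix_inv A = mat 1" "matrix_inv A ** A = mat 1" by auto
qed

text \<open>Modulo integers, the columns of the inverse of \<open>I - M\<close> are themselves fixed
  points, because \<open>I - M\<close> maps them to unit vectors. Hence \<open>k\<close> pairs with
  them to integers, which are the coordinates of \<open>n\<close>.\<close>

lemma in_dual_lattice:
  assumes det: "det (defect M) \<noteq> 0" and k: "\<And>x. x \<in> fixpts M \<Longrightarrow> ndot k x \<in> \<int>"
  shows "\<exists>n. k = n - transpose M *v n"
proof -
  let ?A = "defect M" and ?B = "matrix_inv (defect M)"
  have AB: "?A ** ?B = mat 1" by (rule matrix_inv_works(1)[OF det])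
  have AB': "?A *v (?B *v x) = x" for x
    by (simp add: matrix_vector_mul_assoc AB)
  have B: "ndot k (?B *v axis j 1) \<in> \<int>" for j
  proof -
    let ?y = "?B *v axis j 1"
    have "vfrac ?y \<in> fixpts M" by (rule vfrac_fixpts) (simp add: AB' axis_def)
    hence "ndot k (vfrac ?y) \<in> \<int>" by (rule k)
    moreover have "ndot k ?y = ndot k (vfrac ?y) + ndot k (\<chi> i. of_int \<lfloor>?y$i\<rfloor>)"
      by (simp add: vfrac_eq flip: ndot_add)
    ultimately show ?thesis by (simp add: ndot_Ints)
  qed
  define n where "n = (\<chi> j. \<lfloor>ndot k (?B *v axis j 1)\<rfloor>)"
  have n: "real_of_int (n$j) = ndot k (?B *v axis j 1)" for j
    using B[of j] by (auto simp: n_def elim: Ints_cases)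
  have lin: "ndot k (?B *v y) = ndot n y" for y
  proof -
    have y: "y = (y$1) *\<^sub>R axis 1 1 + (y$2) *\<^sub>R axis 2 1"
      by (simp add: vec_eq_iff forall_2 axis_def)
    have sc: "ndot k (c *\<^sub>R x) = c * ndot k x" for c x by (simp add: ndot_2 algebra_simps)
    have "ndot k (?B *v y) = y$1 * n$1 + y$2 * n$2"
      by (subst y, simp only: matrix_vector_right_distrib matrix_vector_mult_scaleR ndot_add sc n)
    thus ?thesis by (simp add: ndot_2 mult.commute)
  qed
  have BA: "?B ** ?A = mat 1" by (rule matrix_inv_works(2)[OF det])
  have "ndot k x = ndot (n - transpose M *v n) x" for x
    using lin[of "?A *v x"] by (simp add: matrix_vector_mul_assoc BA ndot_defect)
  hence "real_of_int (k$j) = real_of_int ((n - transpose M *v n)$j)" for j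
    using ndot_axis by metis
  hence "k = n - transpose M *v n"
    unfolding of_int_eq_iff by (subst vec_eq_iff) blast
  thus ?thesis ..
qed

text \<open>Modulo integers the fixed points form a finite group. A character trivial on it sums to
  the order of the group; any other takes a value different from 1 at some \<open>x0\<close>, and
  translation by \<open>x0\<close> permutes the group while multiplying the sum by that value. The
  trivial characters are those of the dual lattice.\<close>

lemma sum_echar_fixpts:
  assumes det: "det (defect M) \<noteq> 0"
  shows "(\<Sum>x\<in>fixpts M. echar k x) = (if \<exists>n. k = n - transpose M *v n then of_real (NM M) else 0)"
proof (cases "\<exists>n. k = n - transpose M *v n")
  case True
  then obtain n where n: "k = n - transpose M *v n" ..
  have "echar k x = 1" if "x \<in> fixpts M" for x
    unfolding n by (rule echar_eq_1, subst ndot_defect[symmetric], rule ndot_Ints)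
      (use that in \<open>simp add: fixpts_iff\<close>)
  hence "(\<Sum>x\<in>fixpts M. echar k x) = of_nat (card (fixpts M))" by simp
  also have "\<dots> = of_real (NM M)" using card_fixpts(2)[OF det] by (metis of_real_of_nat_eq)
  finally show ?thesis using True by simp
next
  case False
  then obtain x0 where x0: "x0 \<in> fixpts M" "ndot k x0 \<notin> \<int>" using in_dual_lattice[OF det] by blast
  have ne: "echar k x0 \<noteq> 1"
  proof
    assume "echar k x0 = 1"
    hence "cos (2 * pi * ndot k x0) = 1" by (simp add: echar_def complex_eq_iff)
    then obtain m :: int where "2 * pi * ndot k x0 = m * 2 * pi" using cos_one_2pi_int by auto
    hence "ndot k x0 = m" by simp
    thus False using x0(2) by simp
  qed
  let ?h = "\<lambda>x. vfrac (x + x0)"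
  have inj: "inj_on ?h (fixpts M)"
  proof (rule inj_onI)
    fix x y assume xy: "x \<in> fixpts M" "y \<in> fixpts M" and eq: "?h x = ?h y"
    have "x$i = y$i" for i
    proof -
      have "frac (x$i + x0$i) = frac (y$i + x0$i)" using eq by (simp add: vfrac_def vec_eq_iff)
      hence "x$i - y$i = of_int (\<lfloor>x$i + x0$i\<rfloor> - \<lfloor>y$i + x0$i\<rfloor>)" by (simp add: frac_def)
      moreover have "\<bar>x$i - y$i\<bar> < 1" using xy by (auto simp: fixpts_iff abs_less_iff) (smt (verit, best))+
      ultimately have "\<bar>\<lfloor>x$i + x0$i\<rfloor> - \<lfloor>y$i + x0$i\<rfloor>\<bar> < 1" by linarith
      thus ?thesis using \<open>x$i - y$i = _\<close> by simp
    qed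
    thus "x = y" by (simp add: vec_eq_iff)
  qed
  have sub: "?h ` fixpts M \<subseteq> fixpts M"
  proof clarify
    fix x assume x: "x \<in> fixpts M"
    show "vfrac (x + x0) \<in> fixpts M"
      by (rule vfrac_fixpts) (use x x0(1) in \<open>auto simp: fixpts_iff matrix_vector_right_distrib\<close>)
  qed
  have img: "?h ` fixpts M = fixpts M"
    by (rule endo_inj_surj[OF card_fixpts(1)[OF det] sub inj])
  have "(\<Sum>x\<in>fixpts M. echar k x) = (\<Sum>x\<in>?h ` fixpts M. echar k x)" by (simp only: img)
  also have "\<dots> = (\<Sum>x\<in>fixpts M. echar k x * echar k x0)"
    by (subst sum.reindex[OF inj]) (simp add: echar_vfrac echar_add)
  also have "\<dots> = (\<Sum>x\<in>fixpts M. echar k x) * echar k x0" by (simp add: sum_distrib_right)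
  finally have "(\<Sum>x\<in>fixpts M. echar k x) * (1 - echar k x0) = 0" by (simp add: algebra_simps)
  hence "(\<Sum>x\<in>fixpts M. echar k x) = 0" using ne by simp
  thus ?thesis using False by simp
qed

section \<open>The linear response functional\<close>

lemma axis_in_strip: "z \<in> strip r \<Longrightarrow> z + axis j 1 \<in> strip r"
  by (auto simp: strip_def axis_def)

lemma sepholo_shift:
  assumes F: "sepholo r F"
  shows "sepholo r (\<lambda>z. F (z + axis j 1))"
  unfolding sepholo_def
proof (intro conjI ballI allI)
  show "continuous_on (strip r) (\<lambda>z. F (z + axis j 1))"
    by (rule continuous_on_compose2[of "strip r" F])
       (use F axis_in_strip in \<open>auto simp: sepholo_def intro!: continuous_intros\<close>)
next
  fix z i assume z: "z \<in> strip r"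
  have "(\<lambda>\<zeta>. F (z + axis j 1 + \<zeta> *s axis i 1)) holomorphic_on {\<zeta>. \<bar>Im ((z + axis j 1)$i + \<zeta>)\<bar> < r}"
    using F axis_in_strip[OF z] unfolding sepholo_def by blast
  moreover have "Im ((z + axis j 1)$i + \<zeta>) = Im (z$i + \<zeta>)" for \<zeta> by (simp add: axis_def)
  moreover have "z + axis j 1 + \<zeta> *s axis i 1 = z + \<zeta> *s axis i 1 + axis j 1" for \<zeta> by (simp add: add_ac)
  ultimately show "(\<lambda>\<zeta>. F (z + \<zeta> *s axis i 1 + axis j 1)) holomorphic_on {\<zeta>. \<bar>Im (z$i + \<zeta>)\<bar> < r}"
    by simp
qed

lemma is_ext_sepholo: "is_ext r \<psi> \<Psi> \<Longrightarrow> sepholo r (\<lambda>z. \<Psi> z $ j)"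
  by (intro sepholo_of_cholo) (simp add: is_ext_def)

lemma is_ext_cvec: "is_ext r \<psi> \<Psi> \<Longrightarrow> \<Psi> (cvec x) = cvec (\<psi> x)"
  by (simp add: is_ext_def)

text \<open>Each component of the difference vanishes on the real plane, hence on the strip. As a
  consequence \<open>Bnorm\<close>, which is defined through a chosen extension, can be computed
  from any extension.\<close>

lemma is_ext_unique:
  assumes "is_ext r \<psi> \<Psi>" "is_ext r \<psi> \<Phi>" "z \<in> strip r"
  shows "\<Psi> z = \<Phi> z"
proof -
  have "\<Psi> z $ j - \<Phi> z $ j = 0" for j
    by (rule sepholo_zero[of r "\<lambda>z. \<Psi> z $ j - \<Phi> z $ j"])
       (use assms in \<open>auto intro!: is_ext_sepholo simp: is_ext_cvec\<close>)
  thus ?thesis by (simp add: vec_eq_iff)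
qed

lemma Bspace_axis: "\<psi> \<in> Bspace r \<Longrightarrow> \<psi> (x + axis j 1) = \<psi> x"
proof -
  assume "\<psi> \<in> Bspace r"
  hence "\<psi> (x + ivec (axis j 1)) = \<psi> x" unfolding Bspace_def by blast
  moreover have "ivec (axis j 1) = axis j 1" by (simp add: ivec_def axis_def vec_eq_iff)
  ultimately show ?thesis by simp
qed

text \<open>Periodicity is assumed only on the real plane; it passes to the strip because the
  difference of the extension and its translate vanishes at real points.\<close>

lemma is_ext_periodic:
  assumes "\<psi> \<in> Bspace r" "is_ext r \<psi> \<Psi>" "z \<in> strip r"
  shows "\<Psi> (z + axis j 1) = \<Psi> z"
proof -
  have "\<Psi> (z + axis j 1) $ i - \<Psi> z $ i = 0" for i
  proof (rule sepholo_zero[of r "\<lambda>z. \<Psi> (z + axis j 1) $ i - \<Psi> z $ i"])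
    show "sepholo r (\<lambda>z. \<Psi> (z + axis j 1) $ i - \<Psi> z $ i)"
      by (intro sepholo_diff sepholo_shift[where F = "\<lambda>z. \<Psi> z $ i"] is_ext_sepholo[OF assms(2)])
    show "\<Psi> (cvec x + axis j 1) $ i - \<Psi> (cvec x) $ i = 0" for x
      using is_ext_cvec[OF assms(2), of "x + axis j 1"] is_ext_cvec[OF assms(2), of x]
        Bspace_axis[OF assms(1)] by (simp add: cvec_axis)
  qed (rule assms)
  thus ?thesis by (simp add: vec_eq_iff)
qed

lemma Bnorm_bound:
  assumes "is_ext r \<psi> \<Psi>" "z \<in> strip r"
  shows "norm (\<Psi> z) \<le> Bnorm r \<psi>"
proof -
  let ?\<Phi> = "SOME \<Psi>. is_ext r \<psi> \<Psi>"
  have ext: "is_ext r \<psi> ?\<Phi>" by (rule someI[of "is_ext r \<psi>", OF assms(1)])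
  have "bounded (?\<Phi> ` strip r)" using ext by (simp add: is_ext_def)
  hence "bdd_above ((\<lambda>z. norm (?\<Phi> z)) ` strip r)"
    unfolding bounded_iff bdd_above_def by auto
  hence "norm (?\<Phi> z) \<le> Bnorm r \<psi>" unfolding Bnorm_def by (rule cSUP_upper[OF assms(2)])
  thus ?thesis using is_ext_unique[OF ext assms(1,2)] by simp
qed

lemma Bnorm_le:
  assumes "is_ext r \<psi> \<Psi>" "r > 0" "\<And>z. z \<in> strip r \<Longrightarrow> norm (\<Psi> z) \<le> b"
  shows "Bnorm r \<psi> \<le> b"
proof -
  let ?\<Phi> = "SOME \<Psi>. is_ext r \<psi> \<Psi>"
  have ext: "is_ext r \<psi> ?\<Phi>" by (rule someI[of "is_ext r \<psi>", OF assms(1)])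
  show ?thesis unfolding Bnorm_def
  proof (rule cSUP_least)
    show "strip r \<noteq> {}" using cvec_in_strip[OF assms(2)] by blast
    show "norm (?\<Phi> z) \<le> b" if "z \<in> strip r" for z
      using is_ext_unique[OF ext assms(1) that] assms(3)[OF that] by simp
  qed
qed

lemma Bspace_has_derivative:
  assumes ext: "is_ext r \<psi> \<Psi>" and r: "r > 0"
  shows "(\<psi> has_derivative frechet_derivative \<psi> (at x)) (at x)"
proof -
  obtain D where D: "(\<Psi> has_derivative D) (at (cvec x))"
    using ext cvec_in_strip[OF r, of x] unfolding is_ext_def cholo_def by blast
  have lin: "bounded_linear (cvec :: real^2 \<Rightarrow> complex^2)"
    by (intro linear_conv_bounded_linear[THEN iffD1] linearI)
       (simp_all add: vec_eq_iff complex_eq_iff)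
  have "bounded_linear (\<lambda>w::complex^2. (\<chi> i. Re (w$i)) :: real^2)"
    by (intro linear_conv_bounded_linear[THEN iffD1] linearI) (simp_all add: vec_eq_iff)
  moreover have "((\<lambda>x. \<Psi> (cvec x)) has_derivative (\<lambda>h. D (cvec h))) (at x)"
    by (rule has_derivative_compose[OF bounded_linear_imp_has_derivative[OF lin] D])
  ultimately have "((\<lambda>x. (\<chi> i. Re (\<Psi> (cvec x) $ i)) :: real^2) has_derivative
      (\<lambda>h. \<chi> i. Re (D (cvec h) $ i))) (at x)"
    by (rule bounded_linear.has_derivative)
  moreover have "(\<lambda>x. (\<chi> i. Re (\<Psi> (cvec x) $ i)) :: real^2) = \<psi>"
    by (simp add: is_ext_cvec[OF ext] vec_eq_iff fun_eq_iff)
  ultimately have "\<psi> differentiable (at x)" by (auto simp: differentiable_def)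
  thus ?thesis by (simp add: frechet_derivative_works)
qed

lemma Bspace_continuous:
  assumes "is_ext r \<psi> \<Psi>" "r > 0"
  shows "continuous_on UNIV \<psi>"
  using Bspace_has_derivative[OF assms] has_derivative_continuous
  by (intro continuous_at_imp_continuous_on) blast

section \<open>Fourier coefficients of periodic analytic maps\<close>

definition coef :: "(real^2 \<Rightarrow> real^2) \<Rightarrow> 2 \<Rightarrow> int^2 \<Rightarrow> complex" where
  "coef \<psi> j k = fourier (\<lambda>x. of_real (\<psi> x $ j)) k"

lemma norm_coef_le:
  assumes psi: "\<psi> \<in> Bspace r" and ext: "is_ext r \<psi> \<Psi>" and B: "\<And>z. z \<in> strip r \<Longrightarrow> norm (\<Psi> z) \<le> B"
    and rho: "0 \<le> \<rho>" "\<rho> < r"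
  shows "norm (coef \<psi> j k) \<le> B * exp (- 2 * pi * \<rho> * nn k)"
proof -
  have "norm (fourier (\<lambda>x. \<Psi> (cvec x) $ j) k) \<le> B * exp (- 2 * pi * \<rho> * (\<bar>real_of_int (k$1)\<bar> + \<bar>real_of_int (k$2)\<bar>))"
  proof (rule norm_fourier_le[OF is_ext_sepholo[OF ext] _ _ rho])
    show "\<Psi> (z + axis i 1) $ j = \<Psi> z $ j" if "z \<in> strip r" for z i
      using is_ext_periodic[OF psi ext that] by simp
    show "norm (\<Psi> z $ j) \<le> B" if "z \<in> strip r" for z
      by (rule order_trans[OF Finite_Cartesian_Product.norm_nth_le B[OF that]])
  qed
  thus ?thesis by (simp add: coef_def nn_2 is_ext_cvec[OF ext])
qed

text \<open>The weight controls at once the series itself, its termwise derivative and the quadratic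
  Taylor remainder. It is absorbed by half of the decay available at radius
  \<open>r / 2\<close>.\<close>

lemma coef_abs_summable:
  assumes psi: "\<psi> \<in> Bspace r" and ext: "is_ext r \<psi> \<Psi>" and r: "r > 0"
  shows "(\<lambda>k. (1 + nn k + nn k ^ 2) * norm (coef \<psi> j k)) summable_on UNIV"
proof -
  obtain B where B: "\<And>z. z \<in> strip r \<Longrightarrow> norm (\<Psi> z) \<le> B" using Bnorm_bound[OF ext] by blast
  define a where "a = 2 * pi * (r / 2)"
  have a: "a > 0" using r by (simp add: a_def)
  define C where "C = 1 + 4 / a + (4 / a)\<^sup>2"
  have B0: "B \<ge> 0" using B[OF cvec_in_strip[OF r, of 0]] norm_ge_zero order_trans by blast
  have poly: "(1 + nn k + nn k ^ 2) \<le> C * exp (a * nn k / 2)" for k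
  proof -
    have x: "nn k \<le> 4 / a * exp (a * nn k / 4)"
      using linear_le_exp[of "a / 2" "nn k"] a by (simp add: mult.commute)
    have "nn k ^ 2 \<le> (4 / a * exp (a * nn k / 4)) ^ 2" by (rule power_mono[OF x]) simp
    also have "\<dots> = (4 / a)\<^sup>2 * exp (a * nn k / 2)"
      by (simp add: power_mult_distrib power_divide flip: exp_double)
    finally have 2: "nn k ^ 2 \<le> (4 / a)\<^sup>2 * exp (a * nn k / 2)" .
    have "exp (a * nn k / 4) \<le> exp (a * nn k / 2)" using a by simp
    hence "nn k \<le> 4 / a * exp (a * nn k / 2)"
      by (intro order_trans[OF x] mult_left_mono) (use a in auto)
    moreover have "1 \<le> exp (a * nn k / 2)" using a by simp
    ultimately show ?thesis using 2 unfolding C_def distrib_right by linarith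
  qed
  have C: "C \<ge> 0" unfolding C_def using a by simp
  show ?thesis
  proof (rule summable_on_comparison_test)
    show "(\<lambda>k. C * B * exp (- (a / 2) * nn k)) summable_on UNIV"
      by (intro summable_on_cmult_right summable_on_exp_nn) (use a in auto)
    fix k
    have "(1 + nn k + nn k ^ 2) * norm (coef \<psi> j k) \<le> (C * exp (a * nn k / 2)) * (B * exp (- 2 * pi * (r / 2) * nn k))"
      by (intro mult_mono poly norm_coef_le[OF psi ext B]) (use r C in auto)
    also have "\<dots> = C * B * exp (- (a / 2) * nn k)"
      by (simp add: a_def field_simps flip: exp_add)
    finally show "(1 + nn k + nn k ^ 2) * norm (coef \<psi> j k) \<le> C * B * exp (- (a / 2) * nn k)" .
  qed simp_all
qed

lemma coef_has_sum:
  assumes psi: "\<psi> \<in> Bspace r" and ext: "is_ext r \<psi> \<Psi>" and r: "r > 0"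
  shows "((\<lambda>k. coef \<psi> j k * echar k x) has_sum of_real (\<psi> x $ j)) UNIV"
  unfolding coef_def
proof (rule fourier_inversion)
  show "continuous_on UNIV (\<lambda>x. complex_of_real (\<psi> x $ j))"
    by (intro continuous_intros Bspace_continuous[OF ext r])
  show "complex_of_real (\<psi> (x + axis i 1) $ j) = complex_of_real (\<psi> x $ j)" for x i
    by (simp add: Bspace_axis[OF psi])
  show "(\<lambda>k. norm (fourier (\<lambda>x. complex_of_real (\<psi> x $ j)) k)) summable_on UNIV"
  proof (rule summable_on_comparison_test[OF coef_abs_summable[OF psi ext r, of j]])
    fix k
    have "1 * norm (coef \<psi> j k) \<le> (1 + nn k + nn k ^ 2) * norm (coef \<psi> j k)"
      by (intro mult_right_mono) (simp_all add: add_nonneg_nonneg)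
    thus "norm (fourier (\<lambda>x. complex_of_real (\<psi> x $ j)) k) \<le> (1 + nn k + nn k ^ 2) * norm (coef \<psi> j k)"
      by (simp add: coef_def)
  qed simp
qed

lemma norm_cis_minus_linear: "norm (cis \<theta> - 1 - \<i> * of_real \<theta>) \<le> \<theta>\<^sup>2"
  using Taylor_exp[of "\<i> * of_real \<theta>" 1]
  by (simp add: cis_conv_exp norm_mult power_mult_distrib diff_diff_eq power2_eq_square)

text \<open>Each term along a coordinate direction differs from its linearisation by at most a
  multiple of \<open>t^2\<close>, and the multiples are summable. The termwise derivative series is
  therefore the derivative of the sum, and uniqueness of derivatives identifies it with the entry of
  the Frechet derivative.\<close>

lemma partial_has_sum:
  assumes psi: "\<psi> \<in> Bspace r" and ext: "is_ext r \<psi> \<Psi>" and r: "r > 0"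
  shows "((\<lambda>k. 2 * pi * \<i> * of_int (k$i) * coef \<psi> j k * echar k x) has_sum
     of_real (frechet_derivative \<psi> (at x) (axis i 1) $ j)) UNIV"
proof -
  let ?g = "\<lambda>k. 2 * pi * \<i> * of_int (k$i) * coef \<psi> j k * echar k x"
  define f where "f t = complex_of_real (\<psi> (x + t *\<^sub>R axis i 1) $ j)" for t
  define S where "S = (\<Sum>\<^sub>\<infinity>k. ?g k)"
  have ki: "\<bar>real_of_int (k$i)\<bar> \<le> nn k" for k using exhaust_2[of i] by (auto simp: nn_2)
  note sm = coef_abs_summable[OF psi ext r, of j]
  have pol: "nn k \<le> 1 + nn k + nn k ^ 2" "nn k ^ 2 \<le> 1 + nn k + nn k ^ 2" for k by simp_all
  have "(\<lambda>k. norm (?g k)) summable_on UNIV"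
  proof (rule summable_on_comparison_test[OF summable_on_cmult_right[OF sm, of "2 * pi"]])
    fix k
    have "\<bar>real_of_int (k$i)\<bar> * norm (coef \<psi> j k) \<le> (1 + nn k + nn k ^ 2) * norm (coef \<psi> j k)"
      by (intro mult_right_mono order_trans[OF ki pol(1)]) simp
    thus "norm (?g k) \<le> 2 * pi * ((1 + nn k + nn k ^ 2) * norm (coef \<psi> j k))"
      by (simp add: norm_mult)
  qed simp
  hence S: "(?g has_sum S) UNIV"
    unfolding S_def by (intro has_sum_infsum) (rule abs_summable_summable)
  define Q where "Q = (\<Sum>\<^sub>\<infinity>k. (2 * pi)\<^sup>2 * ((1 + nn k + nn k ^ 2) * norm (coef \<psi> j k)))"
  have Q: "((\<lambda>k. (2 * pi)\<^sup>2 * ((1 + nn k + nn k ^ 2) * norm (coef \<psi> j k))) has_sum Q) UNIV"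
    unfolding Q_def by (intro has_sum_infsum summable_on_cmult_right sm)
  have f: "((\<lambda>k. coef \<psi> j k * (echar k x * cis (2 * pi * (of_int (k$i) * t)))) has_sum f t) UNIV" for t
    using coef_has_sum[OF psi ext r, of j "x + t *\<^sub>R axis i 1"]
    unfolding f_def echar_add by (simp add: echar_def[of _ "_ *\<^sub>R _"] ndot_scale_axis)
  have quad: "norm (f t - f 0 - of_real t * S) \<le> t\<^sup>2 * Q" for t
  proof -
    have hs: "((\<lambda>k. coef \<psi> j k * (echar k x * cis (2 * pi * (of_int (k$i) * t)))
        - coef \<psi> j k * (echar k x * cis (2 * pi * (of_int (k$i) * 0))) - of_real t * ?g k)
        has_sum (f t - f 0 - of_real t * S)) UNIV"
      unfolding diff_conv_add_uminus
      by (intro has_sum_add f has_sum_uminusI has_sum_cmult_right S)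
    show ?thesis
    proof (rule norm_infsum_le[OF hs has_sum_cmult_right[OF Q, of "t\<^sup>2"]])
      fix k
      define \<theta> where "\<theta> = 2 * pi * (of_int (k$i) * t)"
      have e: "coef \<psi> j k * (echar k x * cis (2 * pi * (of_int (k$i) * t)))
        - coef \<psi> j k * (echar k x * cis (2 * pi * (of_int (k$i) * 0))) - of_real t * ?g k
         = coef \<psi> j k * echar k x * (cis \<theta> - 1 - \<i> * of_real \<theta>)"
        by (simp add: \<theta>_def algebra_simps)
      have "norm (coef \<psi> j k * echar k x * (cis \<theta> - 1 - \<i> * of_real \<theta>)) \<le> norm (coef \<psi> j k) * \<theta>\<^sup>2"
        unfolding norm_mult using norm_cis_minus_linear[of \<theta>] by (simp add: mult_left_mono)
      also have "\<theta>\<^sup>2 \<le> t\<^sup>2 * ((2 * pi)\<^sup>2 * (1 + nn k + nn k ^ 2))"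
      proof -
        have "\<bar>real_of_int (k$i)\<bar>\<^sup>2 \<le> nn k ^ 2" by (intro power_mono ki) simp
        also have "\<dots> \<le> 1 + nn k + nn k ^ 2" by simp
        finally have "(t\<^sup>2 * (2 * pi)\<^sup>2) * (real_of_int (k$i))\<^sup>2 \<le> (t\<^sup>2 * (2 * pi)\<^sup>2) * (1 + nn k + nn k ^ 2)"
          by (intro mult_left_mono) auto
        thus ?thesis by (simp add: \<theta>_def power_mult_distrib mult_ac)
      qed
      finally have "norm (coef \<psi> j k * echar k x * (cis \<theta> - 1 - \<i> * of_real \<theta>))
          \<le> norm (coef \<psi> j k) * (t\<^sup>2 * ((2 * pi)\<^sup>2 * (1 + nn k + nn k ^ 2)))"
        by (simp add: mult_left_mono)
      thus "norm (coef \<psi> j k * (echar k x * cis (2 * pi * (of_int (k$i) * t)))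
        - coef \<psi> j k * (echar k x * cis (2 * pi * (of_int (k$i) * 0))) - of_real t * ?g k)
        \<le> t\<^sup>2 * ((2 * pi)\<^sup>2 * ((1 + nn k + nn k ^ 2) * norm (coef \<psi> j k)))"
        unfolding e by (simp only: mult_ac)
    qed
  qed
  have Q0: "Q \<ge> 0" by (rule has_sum_nonneg[OF Q]) (simp add: add_nonneg_nonneg)
  have "(f has_vector_derivative S) (at 0)"
    unfolding has_vector_derivative_def has_derivative_at
  proof (intro conjI)
    show "bounded_linear (\<lambda>h. h *\<^sub>R S)" by (rule bounded_linear_scaleR_left)
    show "(\<lambda>h. norm (f (0 + h) - f 0 - h *\<^sub>R S) / norm h) \<midarrow>0\<rightarrow> 0"
    proof (rule Lim_null_comparison)
      have "((\<lambda>h::real. \<bar>h\<bar> * Q) \<longlongrightarrow> \<bar>0\<bar> * Q) (at 0)" by (intro tendsto_intros)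
      thus "((\<lambda>h::real. \<bar>h\<bar> * Q) \<longlongrightarrow> 0) (at 0)" by simp
      show "\<forall>\<^sub>F h in at 0. norm (norm (f (0 + h) - f 0 - h *\<^sub>R S) / norm h) \<le> \<bar>h\<bar> * Q"
      proof (rule always_eventually, rule allI)
        fix h :: real
        show "norm (norm (f (0 + h) - f 0 - h *\<^sub>R S) / norm h) \<le> \<bar>h\<bar> * Q"
        proof (cases "h = 0")
          case False
          have "norm (f h - f 0 - h *\<^sub>R S) \<le> \<bar>h\<bar> * Q * \<bar>h\<bar>"
            using quad[of h] by (simp add: scaleR_conv_of_real power2_eq_square mult_ac)
          thus ?thesis using False by (simp add: divide_le_eq)
        qed simp
      qed
    qed
  qed
  moreover have "(f has_vector_derivative of_real (frechet_derivative \<psi> (at x) (axis i 1) $ j)) (at 0)"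
  proof -
    have "((\<lambda>t. x + t *\<^sub>R axis i 1) has_derivative (\<lambda>t. t *\<^sub>R axis i 1)) (at 0)"
      by (auto intro!: derivative_eq_intros)
    moreover have "(\<psi> has_derivative frechet_derivative \<psi> (at x)) (at (x + 0 *\<^sub>R axis i 1))"
      using Bspace_has_derivative[OF ext r, of x] by simp
    ultimately have "((\<lambda>t. \<psi> (x + t *\<^sub>R axis i 1)) has_derivative
        (\<lambda>t. frechet_derivative \<psi> (at x) (t *\<^sub>R axis i 1))) (at 0)"
      by (rule has_derivative_compose)
    moreover have "bounded_linear (\<lambda>v::real^2. complex_of_real (v $ j))"
      by (intro bounded_linear_compose[OF bounded_linear_of_real] bounded_linear_vec_nth)
    ultimately have "((\<lambda>t. complex_of_real (\<psi> (x + t *\<^sub>R axis i 1) $ j)) has_derivative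
        (\<lambda>t. complex_of_real (frechet_derivative \<psi> (at x) (t *\<^sub>R axis i 1) $ j))) (at 0)"
      by (rule bounded_linear.has_derivative[rotated])
    moreover have lin: "linear (frechet_derivative \<psi> (at x))"
      using Bspace_has_derivative[OF ext r, of x] has_derivative_linear by blast
    have "(\<lambda>t. complex_of_real (frechet_derivative \<psi> (at x) (t *\<^sub>R axis i 1) $ j))
        = (\<lambda>t. t *\<^sub>R complex_of_real (frechet_derivative \<psi> (at x) (axis i 1) $ j))"
      by (simp add: linear_scale[OF lin] complex_eq_iff fun_eq_iff)
    ultimately show ?thesis
      unfolding has_vector_derivative_def f_def[symmetric] by simp
  qed
  ultimately have "S = of_real (frechet_derivative \<psi> (at x) (axis i 1) $ j)"
    by (rule vector_derivative_unique_at)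
  thus ?thesis using S by simp
qed

text \<open>The first-order coefficient in \<open>\<epsilon>\<close> of the diagonal entry at
  \<open>n\<close>; \<open>n - transpose M *v n\<close> is the frequency which that entry picks out
  of the perturbation.\<close>

definition BM_term :: "int^2^2 \<Rightarrow> (real^2 \<Rightarrow> real^2) \<Rightarrow> int^2 \<Rightarrow> complex" where
  "BM_term M \<psi> n = 2 * pi * \<i> * (\<Sum>l\<in>UNIV. of_int (n$l) * coef \<psi> l (n - transpose M *v n))"

text \<open>Let \<open>g k\<close> be the Fourier coefficients of the trace of
  \<open>(I - M)^{-1} D \<psi>\<close>. Averaging over the fixed points keeps exactly the
  frequencies \<open>h n\<close> of the dual lattice, and \<open>h\<close> is injective, so the
  surviving sum can be indexed by \<open>n\<close>.\<close>

lemma BM_has_sum: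
  assumes psi: "\<psi> \<in> Bspace r" and ext: "is_ext r \<psi> \<Psi>" and r: "r > 0"
    and det: "det (defect M) \<noteq> 0"
  shows "(BM_term M \<psi> has_sum of_real (BM M \<psi>)) UNIV"
proof -
  let ?B = "matrix_inv (defect M)"
  let ?D = "\<lambda>x. frechet_derivative \<psi> (at x)"
  define h where "h n = n - transpose M *v n" for n
  define g where "g k = (\<Sum>i\<in>UNIV. \<Sum>l\<in>UNIV. of_real (?B$i$l) * (2 * pi * \<i> * of_int (k$i) * coef \<psi> l k))" for k
  have nd: "ndot (h n) (?B *v y) = ndot n y" for n y
    unfolding h_def ndot_defect[symmetric]
    by (simp add: matrix_vector_mul_assoc matrix_inv_works(1)[OF det])
  have inj: "inj h"
  proof (rule injI)
    fix m n assume "h m = h n"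
    hence "ndot m y = ndot n y" for y using nd by metis
    hence "real_of_int (m$j) = real_of_int (n$j)" for j using ndot_axis by metis
    thus "m = n" unfolding of_int_eq_iff by (subst vec_eq_iff) blast
  qed
  \<comment> \<open>At \<open>k = h n\<close> the transposed inverse of \<open>I - M\<close> takes
    \<open>k\<close> back to \<open>n\<close>, so the double sum with the entries of the inverse
    collapses to integer coefficients.\<close>
  have gh: "g (h n) = BM_term M \<psi> n" for n
  proof -
    have n: "of_int (n$l) = complex_of_real (\<Sum>i\<in>UNIV. ?B$i$l * of_int (h n$i))" for l
    proof -
      have "real_of_int (n$l) = ndot (h n) (?B *v axis l 1)" by (simp add: nd ndot_axis)
      also have "\<dots> = (\<Sum>i\<in>UNIV. ?B$i$l * of_int (h n$i))"
        unfolding ndot_def by (simp add: matrix_vector_mult_basis column_def mult.commute)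
      finally show ?thesis by (metis of_real_of_int_eq)
    qed
    have "g (h n) = (\<Sum>l\<in>UNIV. \<Sum>i\<in>UNIV. of_real (?B$i$l) * (2 * pi * \<i> * of_int (h n$i) * coef \<psi> l (h n)))"
      unfolding g_def by (rule sum.swap)
    also have "\<dots> = (\<Sum>l\<in>UNIV. 2 * pi * \<i> * (of_int (n$l) * coef \<psi> l (h n)))"
      unfolding n by (simp add: sum_distrib_left sum_distrib_right mult_ac)
    finally show ?thesis by (simp add: BM_term_def h_def sum_distrib_left)
  qed
  have tr: "((\<lambda>k. g k * echar k x) has_sum of_real (trace (?B ** matrix (?D x)))) UNIV" for x
  proof -
    have "of_real (trace (?B ** matrix (?D x))) = (\<Sum>i\<in>UNIV. \<Sum>l\<in>UNIV. of_real (?B$i$l) * complex_of_real (?D x (axis i 1) $ l))"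
      by (simp add: trace_def matrix_matrix_mult_def matrix_def)
    moreover have "((\<lambda>k. \<Sum>i\<in>UNIV. \<Sum>l\<in>UNIV. of_real (?B$i$l) * (2 * pi * \<i> * of_int (k$i) * coef \<psi> l k * echar k x))
       has_sum (\<Sum>i\<in>UNIV. \<Sum>l\<in>UNIV. of_real (?B$i$l) * complex_of_real (?D x (axis i 1) $ l))) UNIV"
      by (simp only: sum_2) (intro has_sum_add has_sum_cmult_right partial_has_sum[OF psi ext r])
    moreover have "g k * echar k x = (\<Sum>i\<in>UNIV. \<Sum>l\<in>UNIV. of_real (?B$i$l) * (2 * pi * \<i> * of_int (k$i) * coef \<psi> l k * echar k x))" for k
      by (simp add: g_def sum_2 algebra_simps)
    ultimately show ?thesis by (simp only:)
  qed
  have N: "NM M \<noteq> 0" using det by (simp add: NM_def)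
  have fin: "finite (fixpts M)" by (rule card_fixpts(1)[OF det])
  have "((\<lambda>k. \<Sum>x\<in>fixpts M. g k * echar k x) has_sum (\<Sum>x\<in>fixpts M. of_real (trace (?B ** matrix (?D x))))) UNIV"
    using fin by (induction rule: finite_induct) (auto intro!: has_sum_add tr)
  hence "((\<lambda>k. of_real (1 / NM M) * (\<Sum>x\<in>fixpts M. g k * echar k x)) has_sum
      of_real (1 / NM M) * (\<Sum>x\<in>fixpts M. of_real (trace (?B ** matrix (?D x))))) UNIV"
    by (rule has_sum_cmult_right)
  also have "of_real (1 / NM M) * (\<Sum>x\<in>fixpts M. of_real (trace (?B ** matrix (?D x)))) = complex_of_real (BM M \<psi>)"
    by (simp add: BM_def)
  also have "(\<lambda>k. of_real (1 / NM M) * (\<Sum>x\<in>fixpts M. g k * echar k x)) = (\<lambda>k. if k \<in> range h then g k else 0)"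
  proof
    fix k
    have "(\<exists>n. k = n - transpose M *v n) = (k \<in> range h)" by (auto simp: h_def)
    thus "of_real (1 / NM M) * (\<Sum>x\<in>fixpts M. g k * echar k x) = (if k \<in> range h then g k else 0)"
      using N by (simp add: sum_distrib_left[symmetric] sum_echar_fixpts[OF det])
  qed
  finally have "((\<lambda>k. if k \<in> range h then g k else 0) has_sum of_real (BM M \<psi>)) UNIV" .
  hence "(g has_sum of_real (BM M \<psi>)) (range h)"
    by (rule has_sum_cong_neutral[THEN iffD1, rotated -1]) auto
  hence "(g \<circ> h has_sum of_real (BM M \<psi>)) UNIV" using has_sum_reindex[OF inj] by blast
  moreover have "g \<circ> h = BM_term M \<psi>" by (rule HOL.ext) (simp add: gh)
  ultimately show ?thesis by simp
qed

section \<open>Linearity and continuity of the functional\<close>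

lemma is_ext_lincomb:
  assumes "is_ext r \<psi> \<Psi>" "is_ext r \<phi> \<Phi>"
  shows "is_ext r (\<lambda>x. \<psi> x + t *\<^sub>R \<phi> x) (\<lambda>z. \<Psi> z + t *\<^sub>R \<Phi> z)"
  unfolding is_ext_def cholo_def
proof (intro conjI ballI allI)
  fix z assume z: "z \<in> strip r"
  obtain D where D: "(\<Psi> has_derivative D) (at z)" "\<And>(a::complex) v. D (a *s v) = a *s D v"
    using assms(1) z unfolding is_ext_def cholo_def by blast
  obtain E where E: "(\<Phi> has_derivative E) (at z)" "\<And>(a::complex) v. E (a *s v) = a *s E v"
    using assms(2) z unfolding is_ext_def cholo_def by blast
  have "((\<lambda>z. \<Psi> z + t *\<^sub>R \<Phi> z) has_derivative (\<lambda>v. D v + t *\<^sub>R E v)) (at z)"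
    by (intro has_derivative_add has_derivative_scaleR_right D E)
  moreover have "D (a *s v) + t *\<^sub>R E (a *s v) = a *s (D v + t *\<^sub>R E v)" for a :: complex and v
    by (simp add: D(2) E(2) vec_eq_iff algebra_simps)
  ultimately show "\<exists>D. ((\<lambda>z. \<Psi> z + t *\<^sub>R \<Phi> z) has_derivative D) (at z) \<and> (\<forall>(a::complex) v. D (a *s v) = a *s D v)"
    by blast
next
  have "bounded (\<Psi> ` strip r)" "bounded (\<Phi> ` strip r)" using assms by (auto simp: is_ext_def)
  hence "bounded ((\<lambda>z. \<Psi> z + t *\<^sub>R \<Phi> z) ` strip r)"
    by (intro bounded_plus_comp bounded_scaleR_comp)
  thus "bounded ((\<lambda>z. \<Psi> z + t *\<^sub>R \<Phi> z) ` strip r)" .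
next
  fix x show "\<Psi> (cvec x) + t *\<^sub>R \<Phi> (cvec x) = cvec (\<psi> x + t *\<^sub>R \<phi> x)"
    using assms by (simp add: is_ext_def vec_eq_iff complex_eq_iff)
qed

lemma Bspace_ext: "\<psi> \<in> Bspace r \<Longrightarrow> \<exists>\<Psi>. is_ext r \<psi> \<Psi>"
  by (simp add: Bspace_def)

lemma Bspace_lincomb:
  assumes "\<psi> \<in> Bspace r" "\<phi> \<in> Bspace r"
  shows "(\<lambda>x. \<psi> x + t *\<^sub>R \<phi> x) \<in> Bspace r"
  using assms is_ext_lincomb unfolding Bspace_def by fastforce

text \<open>Linearity is inherited from the Fourier coefficients through the series for the
  functional.\<close>

lemma BM_lincomb:
  assumes psi: "\<psi> \<in> Bspace r" "\<phi> \<in> Bspace r" and r: "r > 0" and det: "det (defect M) \<noteq> 0"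
  shows "BM M (\<lambda>x. \<psi> x + t *\<^sub>R \<phi> x) = BM M \<psi> + t * BM M \<phi>"
proof -
  obtain \<Psi> \<Phi> where ext: "is_ext r \<psi> \<Psi>" "is_ext r \<phi> \<Phi>" using psi Bspace_ext by blast
  have co: "coef (\<lambda>x. \<psi> x + t *\<^sub>R \<phi> x) l k = coef \<psi> l k + of_real t * coef \<phi> l k" for l k
  proof -
    have pc: "continuous_on ubox \<psi>" "continuous_on ubox \<phi>"
      using continuous_on_subset[OF Bspace_continuous[OF ext(1) r]]
        continuous_on_subset[OF Bspace_continuous[OF ext(2) r]] by auto
    have c: "continuous_on ubox (\<lambda>x. complex_of_real (\<psi> x $ l) * echar (- k) x)"
      "continuous_on ubox (\<lambda>x. complex_of_real t * (complex_of_real (\<phi> x $ l) * echar (- k) x))"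
      by (intro continuous_intros pc)+
    have "coef (\<lambda>x. \<psi> x + t *\<^sub>R \<phi> x) l k = integral ubox (\<lambda>x. complex_of_real (\<psi> x $ l) * echar (- k) x
        + complex_of_real t * (complex_of_real (\<phi> x $ l) * echar (- k) x))"
      unfolding coef_def fourier_echar by (intro integral_cong) (simp add: algebra_simps)
    also have "\<dots> = integral ubox (\<lambda>x. complex_of_real (\<psi> x $ l) * echar (- k) x)
        + integral ubox (\<lambda>x. complex_of_real t * (complex_of_real (\<phi> x $ l) * echar (- k) x))"
      by (intro integral_add integrable_continuous c)
    finally show ?thesis unfolding coef_def fourier_echar by simp
  qed
  have "BM_term M (\<lambda>x. \<psi> x + t *\<^sub>R \<phi> x) = (\<lambda>n. BM_term M \<psi> n + of_real t * BM_term M \<phi> n)"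
    by (simp add: BM_term_def co sum_2 fun_eq_iff algebra_simps)
  moreover have "((\<lambda>n. BM_term M \<psi> n + of_real t * BM_term M \<phi> n) has_sum
      (of_real (BM M \<psi>) + of_real t * of_real (BM M \<phi>))) UNIV"
    by (intro has_sum_add has_sum_cmult_right BM_has_sum[OF psi(1) ext(1) r det] BM_has_sum[OF psi(2) ext(2) r det])
  ultimately have "(BM_term M (\<lambda>x. \<psi> x + t *\<^sub>R \<phi> x) has_sum
      (of_real (BM M \<psi>) + of_real t * of_real (BM M \<phi>))) UNIV" by simp
  from has_sum_unique[OF BM_has_sum[OF Bspace_lincomb[OF psi] is_ext_lincomb[OF ext] r det] this]
  have "complex_of_real (BM M (\<lambda>x. \<psi> x + t *\<^sub>R \<phi> x)) = complex_of_real (BM M \<psi> + t * BM M \<phi>)"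
    by simp
  thus ?thesis by (rule of_real_eq_iff[THEN iffD1])
qed

text \<open>The coefficient in term \<open>n\<close> is exponentially small in the size of
  \<open>n - transpose M *v n\<close>, which grows at least linearly in \<open>n\<close>. This beats
  the factor \<open>n\<close>, and the resulting bound depends on \<open>\<psi>\<close> only through
  its norm.\<close>

lemma BM_bounded:
  assumes det: "det M = 1" and hyp: "hyperbolic M" and r: "r > 0"
  obtains Q where "Q \<ge> 0" "\<And>\<psi>. \<psi> \<in> Bspace r \<Longrightarrow> \<bar>BM M \<psi>\<bar> \<le> Q * Bnorm r \<psi>"
proof -
  obtain \<kappa> K where kK: "0 < \<kappa>" "0 < K"
    "\<And>m n. normM M (icvec n) - normM M (icvec m) \<le> - \<kappa> * nn n + K * nn (m - transpose M *v n)"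
    by (rule normM_drop[OF det hyp]) (rule that, assumption+)
  \<comment> \<open>The escape inequality with \<open>m = n\<close> has left side 0 and so bounds
    \<open>n\<close> by its displacement.\<close>
  have low: "\<kappa> / K * nn n \<le> nn (n - transpose M *v n)" for n
    using kK(3)[of n n] kK(2) by (simp add: field_simps)
  define a where "a = 2 * pi * (r / 2) * (\<kappa> / K)"
  have a: "a > 0" using r kK by (simp add: a_def)
  define T where "T n = 2 * pi * (2 / a) * exp (- (a / 2) * nn n)" for n
  have T: "(T has_sum infsum T UNIV) UNIV"
    unfolding T_def[abs_def] by (intro has_sum_infsum summable_on_cmult_right summable_on_exp_nn) (use a in auto)
  show ?thesis
  proof (rule that)
    show "infsum T UNIV \<ge> 0" by (rule infsum_nonneg) (use a in \<open>simp add: T_def\<close>)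
    fix \<psi> assume psi: "\<psi> \<in> Bspace r"
    then obtain \<Psi> where ext: "is_ext r \<psi> \<Psi>" using Bspace_ext by blast
    let ?B = "Bnorm r \<psi>"
    have B0: "?B \<ge> 0" using Bnorm_bound[OF ext cvec_in_strip[OF r, of 0]] norm_ge_zero order_trans by blast
    have "norm (complex_of_real (BM M \<psi>)) \<le> infsum T UNIV * ?B"
    proof (rule norm_infsum_le[OF BM_has_sum[OF psi ext r det_defect_nz[OF det hyp]] has_sum_cmult_left[OF T]])
      fix n
      let ?e = "?B * exp (- 2 * pi * (r / 2) * nn (n - transpose M *v n))"
      have c: "norm (coef \<psi> l (n - transpose M *v n)) \<le> ?e" for l
        by (rule norm_coef_le[OF psi ext Bnorm_bound[OF ext]]) (use r in auto)
      have "norm (BM_term M \<psi> n) \<le> 2 * pi * (\<bar>real_of_int (n$1)\<bar> * ?e + \<bar>real_of_int (n$2)\<bar> * ?e)"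
      proof -
        have "norm (of_int (n$l) * coef \<psi> l (n - transpose M *v n)) \<le> \<bar>real_of_int (n$l)\<bar> * ?e" for l
          unfolding norm_mult norm_of_int by (rule mult_left_mono[OF c]) simp
        hence "norm (of_int (n$1) * coef \<psi> 1 (n - transpose M *v n) + of_int (n$2) * coef \<psi> 2 (n - transpose M *v n))
            \<le> \<bar>real_of_int (n$1)\<bar> * ?e + \<bar>real_of_int (n$2)\<bar> * ?e"
          by (intro order_trans[OF norm_triangle_ineq] add_mono)
        moreover have "norm (complex_of_real (2 * pi) * \<i>) = 2 * pi" by (simp add: norm_mult)
        ultimately show ?thesis
          unfolding BM_term_def sum_2 norm_mult[of "complex_of_real (2 * pi) * \<i>"]
          by (simp only:) (rule mult_left_mono, simp_all)
      qed
      also have "\<dots> = 2 * pi * (nn n * ?e)" by (simp add: nn_2 algebra_simps)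
      also have "\<dots> \<le> 2 * pi * ((2 / a * exp (a * nn n / 2)) * (?B * exp (- a * nn n)))"
      proof (intro mult_left_mono mult_mono)
        show "nn n \<le> 2 / a * exp (a * nn n / 2)" by (rule linear_le_exp[OF a])
        have "2 * pi * (r / 2) * (\<kappa> / K * nn n) \<le> 2 * pi * (r / 2) * nn (n - transpose M *v n)"
          by (intro mult_left_mono low) (use r in auto)
        thus "exp (- 2 * pi * (r / 2) * nn (n - transpose M *v n)) \<le> exp (- a * nn n)"
          by (simp add: a_def mult_ac)
      qed (use a B0 in auto)
      also have "\<dots> = T n * ?B"
      proof -
        have "exp (- (a / 2) * nn n) = exp (a * nn n / 2) * exp (- a * nn n)"
          by (simp flip: exp_add)
        thus ?thesis unfolding T_def by (simp only:) (simp only: mult_ac)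
      qed
      finally show "norm (BM_term M \<psi> n) \<le> T n * ?B" .
    qed
    thus "\<bar>BM M \<psi>\<bar> \<le> infsum T UNIV * ?B" by simp
  qed
qed

section \<open>Weighted matrix entries\<close>

text \<open>The entry in row \<open>m\<close> and column \<open>n\<close> for unnormalised
  characters. The linear part of the map shifts the frequency by \<open>transpose M *v n\<close>,
  leaving a coefficient of the perturbation phase alone.\<close>

definition kmat :: "int^2^2 \<Rightarrow> (real^2 \<Rightarrow> real^2) \<Rightarrow> real \<Rightarrow> int^2 \<Rightarrow> int^2 \<Rightarrow> complex" where
  "kmat M \<psi> \<epsilon> m n = fourier (\<lambda>x. cis (2 * pi * (\<epsilon> * ndot n (\<psi> x)))) (m - transpose M *v n)"

lemma rmat_mul_nth:
  "(rmat M *v x) $ 1 = of_int (M$1$1) * x$1 + of_int (M$1$2) * x$2"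
  "(rmat M *v x) $ 2 = of_int (M$2$1) * x$1 + of_int (M$2$2) * x$2"
  by (simp_all add: matrix_vector_mult_def sum_2 rmat_nth)

lemma ndot_Tmap: "ndot n (Tmap M \<epsilon> \<psi> x) = ndot (transpose M *v n) x + \<epsilon> * ndot n (\<psi> x)"
  unfolding ndot_2 Tmap_def vector_add_component vector_scaleR_component rmat_mul_nth tmul_int_nth
  by (simp add: algebra_simps)

lemma fourier_Tmap: "fourier (\<lambda>x. cis (2 * pi * ndot n (Tmap M \<epsilon> \<psi> x))) m = kmat M \<psi> \<epsilon> m n"
proof -
  have "cis (2 * pi * ndot n (Tmap M \<epsilon> \<psi> x)) * echar (- m) x
      = cis (2 * pi * (\<epsilon> * ndot n (\<psi> x))) * echar (- (m - transpose M *v n)) x" for x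
    by (simp add: ndot_Tmap echar_def cis_mult ndot_minus_left ndot_diff_left algebra_simps)
  thus ?thesis unfolding kmat_def fourier_echar by (intro integral_cong) auto
qed

lemma fourier_const: "fourier (\<lambda>x. c) k = (if k = 0 then c else 0)"
proof -
  have "fourier (\<lambda>x. c) k = c * fourier (echar 0) k"
    unfolding fourier_echar by simp
  thus ?thesis by (simp add: fourier_of_echar)
qed

lemma fourier_diff:
  assumes "continuous_on UNIV f" "continuous_on UNIV g"
  shows "fourier (\<lambda>x. f x - g x) k = fourier f k - fourier g k"
  unfolding fourier_echar left_diff_distrib
  by (intro integral_diff integrable_continuous continuous_intros
      continuous_on_subset[OF assms(1)] continuous_on_subset[OF assms(2)]) auto

lemma kmat_0: "kmat M \<psi> \<epsilon> m 0 = (if m = 0 then 1 else 0)"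
  by (simp add: kmat_def fourier_const)

lemma exp_remainders:
  fixes w :: complex
  assumes "norm w \<le> b"
  shows "norm (exp w) \<le> exp b" "norm (exp w - 1) \<le> b * exp b" "norm (exp w - 1 - w) \<le> b\<^sup>2 * exp b"
proof -
  have re: "\<bar>Re w\<bar> \<le> b" using abs_Re_le_cmod assms order_trans by blast
  have b: "b \<ge> 0" using assms norm_ge_zero order_trans by blast
  show "norm (exp w) \<le> exp b" using re by simp
  have "norm (exp w - 1) \<le> exp \<bar>Re w\<bar> * norm w" using Taylor_exp[of w 0] by simp
  also have "\<dots> \<le> exp b * b" using re assms by (intro mult_mono) auto
  finally show "norm (exp w - 1) \<le> b * exp b" by (simp add: mult.commute)
  have "norm (exp w - 1 - w) \<le> exp \<bar>Re w\<bar> * (norm w)\<^sup>2"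
    using Taylor_exp[of w 1] by (simp add: diff_diff_eq power2_eq_square)
  also have "\<dots> \<le> exp b * b\<^sup>2" using re assms by (intro mult_mono power_mono) auto
  finally show "norm (exp w - 1 - w) \<le> b\<^sup>2 * exp b" by (simp add: mult.commute)
qed

text \<open>The phase extends to the strip as an exponential whose exponent has modulus at most
  \<open>b\<close>. The exponential and its Taylor remainders of first and second order are bounded
  accordingly, and the contour shift with \<open>\<rho> = r / 2\<close> gives all three the same
  decay \<open>exp (- pi * r * nn k)\<close>.\<close>

lemma kmat_bounds:
  fixes n m :: "int^2" and M :: "int^2^2"
  assumes psi: "\<psi> \<in> Bspace r" and ext: "is_ext r \<psi> \<Psi>" and r: "r > 0"
    and B: "\<And>z. z \<in> strip r \<Longrightarrow> norm (\<Psi> z) \<le> B" and eps: "\<epsilon> \<ge> 0"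
  defines "b \<equiv> 2 * pi * \<epsilon> * B * nn n" and "k \<equiv> m - transpose M *v n"
  shows "norm (kmat M \<psi> \<epsilon> m n) \<le> exp b * exp (- pi * r * nn k)"
    "norm (kmat M \<psi> \<epsilon> m n - (if k = 0 then 1 else 0)) \<le> b * exp b * exp (- pi * r * nn k)"
    "norm (kmat M \<psi> \<epsilon> m n - (if k = 0 then 1 else 0)
        - of_real \<epsilon> * (2 * pi * \<i> * (\<Sum>l\<in>UNIV. of_int (n$l) * coef \<psi> l k)))
      \<le> b\<^sup>2 * exp b * exp (- pi * r * nn k)"
proof -
  define w where "w z = complex_of_real (2 * pi * \<epsilon>) * \<i> * (of_int (n$1) * \<Psi> z $ 1 + of_int (n$2) * \<Psi> z $ 2)" for z
  have B0: "B \<ge> 0" using B[OF cvec_in_strip[OF r, of 0]] norm_ge_zero order_trans by blast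
  have wb: "norm (w z) \<le> b" if z: "z \<in> strip r" for z
  proof -
    have c: "norm (of_int (n$l) * \<Psi> z $ l) \<le> \<bar>real_of_int (n$l)\<bar> * B" for l
      unfolding norm_mult norm_of_int
      by (intro mult_left_mono order_trans[OF Finite_Cartesian_Product.norm_nth_le B[OF z]]) simp
    have "norm (of_int (n$1) * \<Psi> z $ 1 + of_int (n$2) * \<Psi> z $ 2)
        \<le> \<bar>real_of_int (n$1)\<bar> * B + \<bar>real_of_int (n$2)\<bar> * B"
      by (intro order_trans[OF norm_triangle_ineq] add_mono c)
    also have "\<dots> = B * nn n" by (simp add: nn_2 algebra_simps)
    finally have "(2 * pi * \<epsilon>) * norm (of_int (n$1) * \<Psi> z $ 1 + of_int (n$2) * \<Psi> z $ 2) \<le> (2 * pi * \<epsilon>) * (B * nn n)"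
      using eps by (intro mult_left_mono) auto
    moreover have "norm (w z) = (2 * pi * \<epsilon>) * norm (of_int (n$1) * \<Psi> z $ 1 + of_int (n$2) * \<Psi> z $ 2)"
      using eps by (simp add: w_def norm_mult)
    ultimately show ?thesis by (simp add: b_def mult_ac)
  qed
  have sw: "sepholo r w"
    unfolding w_def by (intro sepholo_mult sepholo_add sepholo_const is_ext_sepholo[OF ext])
  have perw: "w (z + axis j 1) = w z" if "z \<in> strip r" for z j
    by (simp add: w_def is_ext_periodic[OF psi ext that])
  have wr: "w (cvec x) = \<i> * of_real (2 * pi * (\<epsilon> * ndot n (\<psi> x)))" for x
    by (simp add: w_def is_ext_cvec[OF ext] ndot_2 algebra_simps)
  have ew: "exp (w (cvec x)) = cis (2 * pi * (\<epsilon> * ndot n (\<psi> x)))" for x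
    by (simp add: wr cis_conv_exp)
  have cpsi: "continuous_on UNIV \<psi>" by (rule Bspace_continuous[OF ext r])
  have c1: "continuous_on UNIV (\<lambda>x. cis (2 * pi * (\<epsilon> * ndot n (\<psi> x))))"
    by (intro continuous_intros cpsi)
  have c2: "continuous_on UNIV (\<lambda>x. cis (2 * pi * (\<epsilon> * ndot n (\<psi> x))) - 1)"
    by (intro continuous_intros c1)
  have c3: "continuous_on UNIV (\<lambda>x. w (cvec x))"
    unfolding wr by (intro continuous_intros cpsi)
  have e: "exp (- 2 * pi * (r / 2) * (\<bar>real_of_int (k$1)\<bar> + \<bar>real_of_int (k$2)\<bar>)) = exp (- pi * r * nn k)"
    by (simp add: nn_2)
  have f1: "fourier (\<lambda>x. exp (w (cvec x))) k = kmat M \<psi> \<epsilon> m n"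
    by (simp add: ew kmat_def k_def)
  have f2: "fourier (\<lambda>x. exp (w (cvec x)) - 1) k = kmat M \<psi> \<epsilon> m n - (if k = 0 then 1 else 0)"
    using fourier_diff[OF c1, of "\<lambda>_. 1" k] by (simp add: ew fourier_const kmat_def k_def)
  have f3: "fourier (\<lambda>x. w (cvec x)) k = of_real \<epsilon> * (2 * pi * \<i> * (\<Sum>l\<in>UNIV. of_int (n$l) * coef \<psi> l k))"
  proof -
    have i: "(\<lambda>x. (of_real (2 * pi * \<epsilon>) * \<i> * of_int (n$l)) * (complex_of_real (\<psi> x $ l) * echar (- k) x)) integrable_on ubox" for l
      by (intro integrable_continuous continuous_intros continuous_on_subset[OF cpsi] subset_UNIV)
    have "fourier (\<lambda>x. w (cvec x)) k = integral ubox (\<lambda>x.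
        (of_real (2 * pi * \<epsilon>) * \<i> * of_int (n$1)) * (complex_of_real (\<psi> x $ 1) * echar (- k) x)
      + (of_real (2 * pi * \<epsilon>) * \<i> * of_int (n$2)) * (complex_of_real (\<psi> x $ 2) * echar (- k) x))"
      unfolding fourier_echar by (intro integral_cong) (simp add: w_def is_ext_cvec[OF ext] algebra_simps)
    also have "\<dots> = (of_real (2 * pi * \<epsilon>) * \<i> * of_int (n$1)) * coef \<psi> 1 k
        + (of_real (2 * pi * \<epsilon>) * \<i> * of_int (n$2)) * coef \<psi> 2 k"
      unfolding integral_add[OF i i] by (simp add: coef_def fourier_echar)
    finally show ?thesis by (simp add: sum_2 algebra_simps)
  qed
  have f4: "fourier (\<lambda>x. exp (w (cvec x)) - 1 - w (cvec x)) k = kmat M \<psi> \<epsilon> m n - (if k = 0 then 1 else 0)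
        - of_real \<epsilon> * (2 * pi * \<i> * (\<Sum>l\<in>UNIV. of_int (n$l) * coef \<psi> l k))"
    using fourier_diff[OF c2 c3, of k] f2 f3 by (simp add: ew)
  have "norm (fourier (\<lambda>x. exp (w (cvec x))) k) \<le> exp b * exp (- pi * r * nn k)"
    unfolding e[symmetric]
    by (rule norm_fourier_le) (use sw perw r exp_remainders(1)[OF wb] in auto)
  thus "norm (kmat M \<psi> \<epsilon> m n) \<le> exp b * exp (- pi * r * nn k)" unfolding f1 .
  have "norm (fourier (\<lambda>x. exp (w (cvec x)) - 1) k) \<le> b * exp b * exp (- pi * r * nn k)"
    unfolding e[symmetric]
    by (rule norm_fourier_le) (use sw perw r exp_remainders(2)[OF wb] in auto)
  thus "norm (kmat M \<psi> \<epsilon> m n - (if k = 0 then 1 else 0)) \<le> b * exp b * exp (- pi * r * nn k)" unfolding f2 .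
  have "norm (fourier (\<lambda>x. exp (w (cvec x)) - 1 - w (cvec x)) k) \<le> b\<^sup>2 * exp b * exp (- pi * r * nn k)"
    unfolding e[symmetric]
    by (rule norm_fourier_le[where F = "\<lambda>z. exp (w z) - 1 - w z"])
       (use sw perw r exp_remainders(3)[OF wb] in \<open>auto intro!: sepholo_diff sepholo_exp sepholo_const\<close>)
  thus "norm (kmat M \<psi> \<epsilon> m n - (if k = 0 then 1 else 0)
        - of_real \<epsilon> * (2 * pi * \<i> * (\<Sum>l\<in>UNIV. of_int (n$l) * coef \<psi> l k)))
      \<le> b\<^sup>2 * exp b * exp (- pi * r * nn k)" unfolding f4 .
qed

text \<open>The factor between a character and the basis vector \<open>rho\<close>; the weight
  \<open>wt\<close> is its inverse square. Passing to the orthonormal basis multiplies the entry in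
  row \<open>m\<close> and column \<open>n\<close> by \<open>ew n / ew m\<close>.\<close>

definition ew :: "int^2^2 \<Rightarrow> real \<Rightarrow> int^2 \<Rightarrow> real" where
  "ew M c n = exp (2 * pi * c * normM M (icvec n))"

lemma ew_pos [simp]: "ew M c n > 0" by (simp add: ew_def)

lemma ew_nonzero [simp]: "ew M c n \<noteq> 0" by (simp add: ew_def)

lemma nn_tmul_le: "\<exists>L\<ge>0. \<forall>n. nn (transpose M *v n) \<le> L * nn n" for M :: "int^2^2"
proof -
  let ?L = "real_of_int (\<bar>M$1$1\<bar> + \<bar>M$2$1\<bar> + \<bar>M$1$2\<bar> + \<bar>M$2$2\<bar>)"
  have "nn (transpose M *v n) \<le> ?L * nn n" for n
  proof -
    have "\<bar>M$1$1 * n$1 + M$2$1 * n$2\<bar> \<le> \<bar>M$1$1\<bar> * \<bar>n$1\<bar> + \<bar>M$2$1\<bar> * \<bar>n$2\<bar>"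
      by (rule order_trans[OF abs_triangle_ineq]) (simp add: abs_mult)
    moreover have "\<bar>M$1$2 * n$1 + M$2$2 * n$2\<bar> \<le> \<bar>M$1$2\<bar> * \<bar>n$1\<bar> + \<bar>M$2$2\<bar> * \<bar>n$2\<bar>"
      by (rule order_trans[OF abs_triangle_ineq]) (simp add: abs_mult)
    moreover have "0 \<le> \<bar>M$1$1\<bar> * \<bar>n$2\<bar>" "0 \<le> \<bar>M$2$1\<bar> * \<bar>n$1\<bar>" "0 \<le> \<bar>M$1$2\<bar> * \<bar>n$2\<bar>" "0 \<le> \<bar>M$2$2\<bar> * \<bar>n$1\<bar>" by simp_all
    ultimately have "\<bar>M$1$1 * n$1 + M$2$1 * n$2\<bar> + \<bar>M$1$2 * n$1 + M$2$2 * n$2\<bar>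
        \<le> (\<bar>M$1$1\<bar> + \<bar>M$2$1\<bar> + \<bar>M$1$2\<bar> + \<bar>M$2$2\<bar>) * (\<bar>n$1\<bar> + \<bar>n$2\<bar>)"
      unfolding distrib_left distrib_right by linarith
    hence "real_of_int (\<bar>M$1$1 * n$1 + M$2$1 * n$2\<bar> + \<bar>M$1$2 * n$1 + M$2$2 * n$2\<bar>)
        \<le> real_of_int ((\<bar>M$1$1\<bar> + \<bar>M$2$1\<bar> + \<bar>M$1$2\<bar> + \<bar>M$2$2\<bar>) * (\<bar>n$1\<bar> + \<bar>n$2\<bar>))"
      by (subst of_int_le_iff)
    thus ?thesis unfolding nn_2 tmul_int_nth by simp
  qed
  moreover have "?L \<ge> 0" by simp
  ultimately show ?thesis by blast
qed

text \<open>Three levels of precision: the size of the entries gives nuclearity, the distance to the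
  unperturbed entries gives the contraction, and the second-order expansion of the diagonal gives
  the trace. On the diagonal the weights cancel.\<close>

definition weighted_bounds :: "int^2^2 \<Rightarrow> real \<Rightarrow> real \<Rightarrow> (real^2 \<Rightarrow> real^2) \<Rightarrow> real \<Rightarrow> real \<Rightarrow> bool" where
  "weighted_bounds M c a \<psi> C \<epsilon> \<longleftrightarrow> (\<forall>m n.
       ew M c n / ew M c m * norm (kmat M \<psi> \<epsilon> m n) \<le> exp (- a * nn m) * exp (- a * nn n) \<and>
       ew M c n / ew M c m * norm (kmat M \<psi> \<epsilon> m n - (if m = transpose M *v n then 1 else 0))
         \<le> \<epsilon> * C * (exp (- a * nn m) * exp (- a * nn n)) \<and>
       norm (kmat M \<psi> \<epsilon> n n - (if n = 0 then 1 else 0) - of_real \<epsilon> * BM_term M \<psi> n)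
         \<le> \<epsilon>\<^sup>2 * C * (exp (- a * nn n) * exp (- a * nn n)))"

text \<open>Conjugating by the weights turns the decay of the Fourier coefficients away from the graph of
  \<open>transpose M\<close> into decay in both indices. The constant \<open>c\<close> is chosen so small that the Lipschitz
  error of the escape function is paid for by the analyticity radius \<open>r\<close>.\<close>

lemma weighted_kmat:
  assumes det: "det M = 1" and hyp: "hyperbolic M" and r: "r > 0"
  obtains c a q where "c > 0" "a > 0" "q < 1"
    "\<And>n. n \<noteq> 0 \<Longrightarrow> ew M c n / ew M c (transpose M *v n) \<le> q"
    "\<And>\<psi>. \<psi> \<in> Bspace r \<Longrightarrow> \<exists>\<epsilon>1>0. \<exists>C\<ge>0. \<forall>\<epsilon>. 0 \<le> \<epsilon> \<and> \<epsilon> < \<epsilon>1 \<longrightarrow> weighted_bounds M c a \<psi> C \<epsilon>"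
proof -
  obtain \<kappa> K where kK: "0 < \<kappa>" "\<kappa> \<le> 1" "0 < K"
    "\<And>m n. normM M (icvec n) - normM M (icvec m) \<le> - \<kappa> * nn n + K * nn (m - transpose M *v n)"
    by (rule normM_drop[OF det hyp]) (rule that, assumption+)
  obtain L where L: "L \<ge> 0" "\<And>n. nn (transpose M *v n) \<le> L * nn n" using nn_tmul_le[of M] by blast
  \<comment> \<open>With this choice the Lipschitz error costs the rate
    \<open>2 * pi * c * K = pi * r / 2\<close>, half of the decay \<open>pi * r\<close> of the
    entries.\<close>
  define c where "c = r / (4 * K)"
  have c: "c > 0" using r kK by (simp add: c_def)
  have cK: "c * K = r / 4" using kK by (simp add: c_def)
  \<comment> \<open>The rate left in both \<open>n\<close> and \<open>m - transpose M *v n\<close>.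
    Since \<open>m\<close> is bounded by \<open>L\<close> times \<open>n\<close> plus the deviation,
    dividing by \<open>L + 1\<close> converts it into a rate \<open>a\<close> common to
    \<open>m\<close> and \<open>n\<close>.\<close>
  define b' where "b' = min (pi * c * \<kappa>) (pi * r / 2)"
  have b': "b' > 0" using c kK r by (simp add: b'_def)
  define a where "a = b' / (L + 1)"
  have a: "a > 0" using b' L by (simp add: a_def)
  have wr: "ew M c n / ew M c m \<le> exp (- 2 * pi * c * \<kappa> * nn n + pi * r / 2 * nn (m - transpose M *v n))" for m n
  proof -
    have "ew M c n / ew M c m = exp (2 * pi * c * (normM M (icvec n) - normM M (icvec m)))"
      by (simp add: ew_def exp_diff[symmetric] algebra_simps)
    also have "\<dots> \<le> exp (2 * pi * c * (- \<kappa> * nn n + K * nn (m - transpose M *v n)))"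
      using c by (intro exp_le_cancel_iff[THEN iffD2] mult_left_mono kK) auto
    also have "2 * pi * c * (- \<kappa> * nn n + K * nn (m - transpose M *v n))
        = - 2 * pi * c * \<kappa> * nn n + 2 * pi * (c * K) * nn (m - transpose M *v n)"
      by (simp add: algebra_simps)
    finally show ?thesis unfolding cK by (simp add: algebra_simps)
  qed
  have fin: "exp (- pi * c * \<kappa> * nn n - pi * r / 2 * nn (m - transpose M *v n)) \<le> exp (- a * nn m) * exp (- a * nn n)" for m n
  proof -
    let ?D = "nn (m - transpose M *v n)"
    have "nn m \<le> L * nn n + ?D" using nn_le_diff[of m "transpose M *v n"] L(2)[of n] by linarith
    hence "nn m + nn n \<le> (L * nn n + ?D) + nn n" by simp
    also have "\<dots> \<le> (L + 1) * (nn n + ?D)" using L(1) by (simp add: algebra_simps)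
    finally have "a * (nn m + nn n) \<le> a * ((L + 1) * (nn n + ?D))" using a by (intro mult_left_mono) auto
    also have "\<dots> = b' * nn n + b' * ?D" using L(1) by (simp add: a_def field_simps)
    also have "\<dots> \<le> pi * c * \<kappa> * nn n + pi * r / 2 * ?D"
      by (intro add_mono mult_right_mono) (auto simp: b'_def)
    finally show ?thesis by (simp add: algebra_simps flip: exp_add)
  qed
  define q where "q = exp (- 2 * pi * c * \<kappa>)"
  \<comment> \<open>A quarter of the rate gained from the weights. Growth
    \<open>exp (b0 * nn n)\<close> can be afforded twice, once for the exponential of the phase and
    once for the polynomial prefactor, and half of the gain remains.\<close>
  define b0 where "b0 = pi * c * \<kappa> / 2"
  have b0: "b0 > 0" using c kK by (simp add: b0_def)
  show ?thesis
  proof (rule that[OF c a, of q])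
    show "q < 1" using c kK by (simp add: q_def)
    show "ew M c n / ew M c (transpose M *v n) \<le> q" if "n \<noteq> 0" for n
    proof -
      have "ew M c n / ew M c (transpose M *v n) \<le> exp (- 2 * pi * c * \<kappa> * nn n)"
        using wr[of n "transpose M *v n"] by simp
      also have "\<dots> \<le> q"
      proof -
        have "2 * pi * c * \<kappa> * 1 \<le> 2 * pi * c * \<kappa> * nn n"
          by (intro mult_left_mono nn_ge_1[OF that]) (use c kK in auto)
        thus ?thesis by (simp add: q_def)
      qed
      finally show ?thesis .
    qed
    fix \<psi> assume psi: "\<psi> \<in> Bspace r"
    then obtain \<Psi> where ext: "is_ext r \<psi> \<Psi>" using Bspace_ext by blast
    define B where "B = Bnorm r \<psi>"
    have B: "norm (\<Psi> z) \<le> B" if "z \<in> strip r" for z using Bnorm_bound[OF ext that] by (simp add: B_def)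
    have B0: "B \<ge> 0" using B[OF cvec_in_strip[OF r, of 0]] norm_ge_zero order_trans by blast
    \<comment> \<open>Chosen so that \<open>2 * pi * \<epsilon> * B \<le> b0\<close>: the phase in
      the complex strip then grows no faster than the weights can absorb.\<close>
    define \<epsilon>1 where "\<epsilon>1 = c * \<kappa> / (4 * (B + 1))"
    have e1: "\<epsilon>1 > 0" using c kK B0 by (simp add: \<epsilon>1_def)
    \<comment> \<open>The sum of the first-order constant and its square, to dominate the constants
      of both the first-order and the second-order bound.\<close>
    define C where "C = (2 * pi * B * (2 / b0)) + (2 * pi * B * (2 / b0))\<^sup>2"
    have C0: "2 * pi * B * (2 / b0) \<ge> 0" using B0 b0 by simp
    have C: "2 * pi * B * (2 / b0) \<le> C" "(2 * pi * B * (2 / b0))\<^sup>2 \<le> C" "C \<ge> 0"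
      using C0 by (simp_all add: C_def)
    show "\<exists>\<epsilon>1>0. \<exists>C\<ge>0. \<forall>\<epsilon>. 0 \<le> \<epsilon> \<and> \<epsilon> < \<epsilon>1 \<longrightarrow> weighted_bounds M c a \<psi> C \<epsilon>"
      unfolding weighted_bounds_def
    proof (rule exI[of _ \<epsilon>1], rule conjI[OF e1], rule exI[of _ C], rule conjI[OF C(3)], intro allI impI)
      fix \<epsilon> :: real and m n :: "int^2" assume eps: "0 \<le> \<epsilon> \<and> \<epsilon> < \<epsilon>1"
      have eB: "\<epsilon> * B \<le> c * \<kappa> / 4"
      proof -
        have "\<epsilon> * B \<le> \<epsilon>1 * (B + 1)" using eps B0 by (intro mult_mono) auto
        also have "\<dots> = c * \<kappa> / 4" using B0 by (auto simp: \<epsilon>1_def divide_simps algebra_simps)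
        finally show ?thesis .
      qed
      have bb: "2 * pi * \<epsilon> * B * nn n \<le> b0 * nn n" for n
      proof -
        have "(2 * pi * nn n) * (\<epsilon> * B) \<le> (2 * pi * nn n) * (c * \<kappa> / 4)" by (intro mult_left_mono eB) simp
        thus ?thesis by (simp add: b0_def mult_ac)
      qed
      have lin: "2 * pi * \<epsilon> * B * nn n \<le> \<epsilon> * (2 * pi * B * (2 / b0)) * exp (b0 * nn n / 2)" for n
      proof -
        have "(2 * pi * \<epsilon> * B) * nn n \<le> (2 * pi * \<epsilon> * B) * (2 / b0 * exp (b0 * nn n / 2))"
          by (intro mult_left_mono linear_le_exp[OF b0]) (use eps B0 in auto)
        thus ?thesis by (simp add: mult_ac)
      qed
      have lin0: "0 \<le> 2 * pi * \<epsilon> * B * nn n" for n using eps B0 by simp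
      have e2b0: "exp (b0 * nn n / 2) * exp (b0 * nn n / 2) = exp (b0 * nn n)" for n
        by (simp flip: exp_add)
      have comb: "ew M c n / ew M c m * (p * exp (2 * pi * \<epsilon> * B * nn n) * exp (- pi * r * nn (m - transpose M *v n)))
          \<le> s * (exp (- a * nn m) * exp (- a * nn n))"
        if p: "0 \<le> p" "p \<le> s * exp (b0 * nn n)" and s: "0 \<le> s" for p s and m n :: "int^2"
      proof -
        let ?D = "nn (m - transpose M *v n)"
        have 1: "p * exp (2 * pi * \<epsilon> * B * nn n) \<le> s * exp (b0 * nn n) * exp (b0 * nn n)"
          by (rule mult_mono[OF p(2)]) (simp_all only: exp_le_cancel_iff bb exp_ge_zero mult_nonneg_nonneg s)
        have 2: "p * exp (2 * pi * \<epsilon> * B * nn n) * exp (- pi * r * ?D)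
          \<le> s * exp (b0 * nn n) * exp (b0 * nn n) * exp (- pi * r * ?D)"
          by (rule mult_right_mono[OF 1]) simp
        have "ew M c n / ew M c m * (p * exp (2 * pi * \<epsilon> * B * nn n) * exp (- pi * r * ?D))
          \<le> exp (- 2 * pi * c * \<kappa> * nn n + pi * r / 2 * ?D) * (s * exp (b0 * nn n) * exp (b0 * nn n) * exp (- pi * r * ?D))"
          by (rule mult_mono[OF wr 2]) (use p in auto)
        also have "\<dots> = s * exp (- pi * c * \<kappa> * nn n - pi * r / 2 * ?D)"
          by (simp add: b0_def algebra_simps flip: exp_add)
        also have "\<dots> \<le> s * (exp (- a * nn m) * exp (- a * nn n))" by (intro mult_left_mono fin s)
        finally show ?thesis .
      qed
      note kb = kmat_bounds[OF psi ext r B, where \<epsilon> = \<epsilon> and M = M]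
      have ewp: "0 \<le> ew M c n / ew M c m" for m n by (simp add: less_imp_le)
      show "ew M c n / ew M c m * norm (kmat M \<psi> \<epsilon> m n) \<le> exp (- a * nn m) * exp (- a * nn n) \<and>
       ew M c n / ew M c m * norm (kmat M \<psi> \<epsilon> m n - (if m = transpose M *v n then 1 else 0))
         \<le> \<epsilon> * C * (exp (- a * nn m) * exp (- a * nn n)) \<and>
       norm (kmat M \<psi> \<epsilon> n n - (if n = 0 then 1 else 0) - of_real \<epsilon> * BM_term M \<psi> n)
         \<le> \<epsilon>\<^sup>2 * C * (exp (- a * nn n) * exp (- a * nn n))"
      proof (intro conjI)
        have "ew M c n / ew M c m * norm (kmat M \<psi> \<epsilon> m n)
          \<le> ew M c n / ew M c m * (1 * exp (2 * pi * \<epsilon> * B * nn n) * exp (- pi * r * nn (m - transpose M *v n)))"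
          using kb(1)[where n = n and m = m] eps by (intro mult_left_mono ewp) auto
        also have "\<dots> \<le> 1 * (exp (- a * nn m) * exp (- a * nn n))"
          by (rule comb) (use b0 in auto)
        finally show "ew M c n / ew M c m * norm (kmat M \<psi> \<epsilon> m n) \<le> exp (- a * nn m) * exp (- a * nn n)" by simp
      next
        have k0: "(m - transpose M *v n = 0) = (m = transpose M *v n)" by simp
        have "ew M c n / ew M c m * norm (kmat M \<psi> \<epsilon> m n - (if m = transpose M *v n then 1 else 0))
          \<le> ew M c n / ew M c m * ((2 * pi * \<epsilon> * B * nn n) * exp (2 * pi * \<epsilon> * B * nn n) * exp (- pi * r * nn (m - transpose M *v n)))"
          using kb(2)[where n = n and m = m] eps unfolding k0 by (intro mult_left_mono ewp) auto
        also have "\<dots> \<le> (\<epsilon> * C) * (exp (- a * nn m) * exp (- a * nn n))"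
        proof (rule comb[OF lin0])
          have "2 * pi * \<epsilon> * B * nn n \<le> \<epsilon> * (2 * pi * B * (2 / b0)) * exp (b0 * nn n / 2)" by (rule lin)
          also have "\<dots> \<le> \<epsilon> * C * exp (b0 * nn n)"
            using eps C b0 C0 by (intro mult_mono) auto
          finally show "2 * pi * \<epsilon> * B * nn n \<le> \<epsilon> * C * exp (b0 * nn n)" .
        qed (use eps C in auto)
        finally show "ew M c n / ew M c m * norm (kmat M \<psi> \<epsilon> m n - (if m = transpose M *v n then 1 else 0))
         \<le> \<epsilon> * C * (exp (- a * nn m) * exp (- a * nn n))" .
      next
        \<comment> \<open>The escape inequality with \<open>m = n\<close> shows that only 0 is fixed
          by the transpose.\<close>
        have k0: "(n - transpose M *v n = 0) = (n = 0)"
        proof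
          assume "n - transpose M *v n = 0"
          hence "0 \<le> - \<kappa> * nn n" using kK(4)[of n n] by simp
          hence "nn n \<le> 0" using kK(1) by (simp add: mult_le_0_iff)
          thus "n = 0" using nn_ge_1[of n] by auto
        qed simp
        have "norm (kmat M \<psi> \<epsilon> n n - (if n = 0 then 1 else 0) - of_real \<epsilon> * BM_term M \<psi> n)
          \<le> ew M c n / ew M c n * ((2 * pi * \<epsilon> * B * nn n)\<^sup>2 * exp (2 * pi * \<epsilon> * B * nn n) * exp (- pi * r * nn (n - transpose M *v n)))"
          using kb(3)[where n = n and m = n] eps unfolding k0 BM_term_def by simp
        also have "\<dots> \<le> (\<epsilon>\<^sup>2 * C) * (exp (- a * nn n) * exp (- a * nn n))"
        proof (rule comb)
          have "(2 * pi * \<epsilon> * B * nn n)\<^sup>2 \<le> (\<epsilon> * (2 * pi * B * (2 / b0)) * exp (b0 * nn n / 2))\<^sup>2"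
            by (rule power_mono[OF lin lin0])
          also have "\<dots> = \<epsilon>\<^sup>2 * (2 * pi * B * (2 / b0))\<^sup>2 * exp (b0 * nn n)"
            unfolding e2b0[symmetric] by (simp add: power2_eq_square mult_ac)
          also have "\<dots> \<le> \<epsilon>\<^sup>2 * C * exp (b0 * nn n)"
            by (intro mult_mono C) (use C in auto)
          finally show "(2 * pi * \<epsilon> * B * nn n)\<^sup>2 \<le> \<epsilon>\<^sup>2 * C * exp (b0 * nn n)" .
        qed (use C in auto)
        finally show "norm (kmat M \<psi> \<epsilon> n n - (if n = 0 then 1 else 0) - of_real \<epsilon> * BM_term M \<psi> n)
         \<le> \<epsilon>\<^sup>2 * C * (exp (- a * nn n) * exp (- a * nn n))" .
      qed
    qed
  qed
qed

section \<open>Operators with exponentially decaying matrices\<close>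

lemma wt_ew: "wt M c n = 1 / (ew M c n)\<^sup>2"
  by (simp add: wt_def ew_def field_simps exp_minus_inverse flip: exp_double)

lemma rho_ew: "rho M c n = (\<lambda>k. if k = n then of_real (ew M c n) else 0)"
  unfolding rho_def ew_def ..

lemma wt_norm: "wt M c n * (norm z)\<^sup>2 = (norm z / ew M c n)\<^sup>2"
  by (simp add: wt_ew power_divide)

lemma Hsp_iff: "g \<in> Hsp M c \<longleftrightarrow> (\<lambda>n. (norm (g n) / ew M c n)\<^sup>2) summable_on UNIV"
  by (simp add: Hsp_def wt_norm)

lemma Hnorm_eq: "Hnorm M c g = sqrt (\<Sum>\<^sub>\<infinity>n. (norm (g n) / ew M c n)\<^sup>2)"
  by (simp add: Hnorm_def wt_norm)

lemma Hnorm_nonneg [simp]: "0 \<le> Hnorm M c g"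
  by (simp add: Hnorm_eq infsum_nonneg)

lemma coord_le_Hnorm:
  assumes "g \<in> Hsp M c"
  shows "norm (g n) / ew M c n \<le> Hnorm M c g"
proof -
  have "(\<Sum>n\<in>{n}. (norm (g n) / ew M c n)\<^sup>2) \<le> (\<Sum>\<^sub>\<infinity>n. (norm (g n) / ew M c n)\<^sup>2)"
    by (rule finite_sum_le_infsum) (use assms in \<open>auto simp: Hsp_iff\<close>)
  thus ?thesis unfolding Hnorm_eq by (intro real_le_rsqrt) simp
qed

lemma finite_support_Hsp: "finite {n. g n \<noteq> 0} \<Longrightarrow> g \<in> Hsp M c"
  unfolding Hsp_iff by (rule finite_nonzero_values_imp_summable_on) (auto elim: finite_subset[rotated])

lemma rho_Hsp: "rho M c n \<in> Hsp M c"
  by (rule finite_support_Hsp) (auto simp: rho_ew intro: finite_subset[of _ "{n}"])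

lemma Hnorm_rho: "Hnorm M c (rho M c n) = 1"
proof -
  have "((\<lambda>k. (norm (rho M c n k) / ew M c k)\<^sup>2) has_sum 1) UNIV"
    by (rule has_sum_finite_neutralI[of "{n}"]) (auto simp: rho_ew less_imp_le)
  thus ?thesis unfolding Hnorm_eq by (simp add: infsumI)
qed

lemma Hinner_rho: "Hinner M c (rho M c n) g = g n / ew M c n"
proof -
  have "((\<lambda>k. complex_of_real (wt M c k) * cnj (rho M c n k) * g k) has_sum g n / ew M c n) UNIV"
    by (rule has_sum_finite_neutralI[of "{n}"]) (auto simp: rho_ew wt_ew power2_eq_square)
  thus ?thesis unfolding Hinner_def by (rule infsumI)
qed

lemma summable_on_exp_nn_pair:
  assumes "a > 0"
  shows "(\<lambda>(m, n). exp (- a * nn m) * exp (- a * nn n)) summable_on UNIV"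
proof -
  let ?U = "\<Sum>\<^sub>\<infinity>n. exp (- a * nn n)"
  have "(\<lambda>(m, n). exp (- a * nn m) * exp (- a * nn n)) summable_on (SIGMA m:UNIV. UNIV)"
  proof (rule summable_on_SigmaI)
    show "((\<lambda>n. case (m, n) of (m, n) \<Rightarrow> exp (- a * nn m) * exp (- a * nn n)) has_sum exp (- a * nn m) * ?U) UNIV" for m
      by (simp, rule has_sum_cmult_right, rule has_sum_infsum) (use summable_on_exp_nn[OF assms] in simp)
    show "(\<lambda>m. exp (- a * nn m) * ?U) summable_on UNIV"
      by (intro summable_on_cmult_left summable_on_exp_nn assms)
  qed auto
  thus ?thesis by simp
qed

lemma infinite_UNIV_int2: "infinite (UNIV :: (int^2) set)"
proof
  assume "finite (UNIV :: (int^2) set)"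
  hence "finite (range (\<lambda>i::int. (\<chi> j. i) :: int^2))" by (rule finite_subset[rotated]) simp
  moreover have "inj (\<lambda>i::int. (\<chi> j. i) :: int^2)"
    by (rule injI) (simp add: vec_eq_iff)
  ultimately show False using finite_imageD infinite_UNIV_int by blast
qed

lemma nat_enum:
  assumes "infinite (UNIV :: 'a::countable set)"
  obtains h :: "nat \<Rightarrow> 'a::countable" where "bij h"
proof -
  obtain e :: "'a \<Rightarrow> nat" where "bij_betw e UNIV UNIV"
    using countableE_infinite[OF countableI_type assms] by blast
  thus ?thesis using that bij_imp_bij_inv by blast
qed

section \<open>Boundedness, nuclearity and trace\<close>

locale decaying_matrix =
  fixes M :: "int^2^2" and c :: real and k :: "int^2 \<Rightarrow> int^2 \<Rightarrow> complex" and a :: real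
  assumes a: "a > 0"
    and decay: "\<And>m n. ew M c n / ew M c m * norm (k m n) \<le> exp (- a * nn m) * exp (- a * nn n)"
begin

definition u :: "int^2 \<Rightarrow> real" where "u n = exp (- a * nn n)"

definition L :: op where "L g m = (\<Sum>\<^sub>\<infinity>n. k m n * g n)"

lemma u_pos [simp]: "0 < u n" by (simp add: u_def)

lemma u_le_1: "u n \<le> 1" using a by (simp add: u_def)

lemma u_summable: "u summable_on UNIV"
  unfolding u_def[abs_def] by (rule summable_on_exp_nn[OF a])

lemma u2_summable: "(\<lambda>n. (u n)\<^sup>2) summable_on UNIV"
  using u_le_1 by (intro summable_on_comparison_test[OF u_summable])
    (auto simp: power2_eq_square mult_left_le less_imp_le)

lemma k_bound: "norm (k m n) \<le> ew M c m * (u m * u n) / ew M c n"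
  using decay[of n m] by (simp add: u_def field_simps)

lemma term_bound:
  assumes "norm (g n) / ew M c n \<le> G"
  shows "norm (k m n * g n) \<le> ew M c m * u m * G * u n"
proof -
  have "norm (k m n * g n) \<le> (ew M c m * (u m * u n) / ew M c n) * norm (g n)"
    unfolding norm_mult by (rule mult_right_mono[OF k_bound]) simp
  also have "\<dots> = (ew M c m * u m * u n) * (norm (g n) / ew M c n)" by simp
  also have "\<dots> \<le> (ew M c m * u m * u n) * G"
    by (intro mult_left_mono assms) (simp add: less_imp_le)
  finally show ?thesis by (simp add: mult_ac)
qed

text \<open>Boundedness of the weighted coordinates suffices here, which holds for every element of
  the space. The wider form also serves the candidate eigenvector, to which \<open>L\<close> is
  applied before it is shown to lie in the space.\<close>

lemma L_has_sum_bounded: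
  assumes "\<And>n. norm (g n) / ew M c n \<le> G"
  shows "((\<lambda>n. k m n * g n) has_sum L g m) UNIV" "(\<lambda>n. norm (k m n * g n)) summable_on UNIV"
    "norm (L g m) \<le> ew M c m * u m * G * infsum u UNIV"
proof -
  have s: "(\<lambda>n. ew M c m * u m * G * u n) summable_on UNIV"
    by (intro summable_on_cmult_right u_summable)
  show ns: "(\<lambda>n. norm (k m n * g n)) summable_on UNIV"
    by (rule summable_on_comparison_test[OF s]) (use term_bound assms in auto)
  show hs: "((\<lambda>n. k m n * g n) has_sum L g m) UNIV"
    unfolding L_def by (rule has_sum_infsum, rule abs_summable_summable, rule ns)
  have "((\<lambda>n. ew M c m * u m * G * u n) has_sum ew M c m * u m * G * infsum u UNIV) UNIV"
    by (intro has_sum_cmult_right has_sum_infsum u_summable)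
  from norm_infsum_le[OF hs this] show "norm (L g m) \<le> ew M c m * u m * G * infsum u UNIV"
    using term_bound assms by auto
qed

lemmas L_has_sum = L_has_sum_bounded[OF coord_le_Hnorm]

lemma L_coord: "g \<in> Hsp M c \<Longrightarrow> norm (L g m) / ew M c m \<le> u m * (Hnorm M c g * infsum u UNIV)"
  using L_has_sum(3)[of g m] by (simp add: divide_le_eq mult_ac)

lemma L_bounded: "bounded_op M c L"
  unfolding bounded_op_def
proof (intro conjI ballI allI exI)
  fix g assume g: "g \<in> Hsp M c"
  let ?C = "Hnorm M c g * infsum u UNIV"
  have le: "(norm (L g m) / ew M c m)\<^sup>2 \<le> ?C\<^sup>2 * (u m)\<^sup>2" for m
    using power_mono[OF L_coord[OF g, of m], of 2] by (simp add: power_mult_distrib mult_ac less_imp_le)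
  have s: "(\<lambda>m. ?C\<^sup>2 * (u m)\<^sup>2) summable_on UNIV" by (intro summable_on_cmult_right u2_summable)
  show Lg: "L g \<in> Hsp M c" unfolding Hsp_iff
    by (rule summable_on_comparison_test[OF s]) (use le in auto)
  have "(\<Sum>\<^sub>\<infinity>m. (norm (L g m) / ew M c m)\<^sup>2) \<le> (\<Sum>\<^sub>\<infinity>m. ?C\<^sup>2 * (u m)\<^sup>2)"
    by (rule infsum_mono[OF _ s]) (use Lg le in \<open>auto simp: Hsp_iff\<close>)
  also have "\<dots> = ?C\<^sup>2 * (\<Sum>\<^sub>\<infinity>m. (u m)\<^sup>2)" by (rule infsum_cmult_right) (simp add: u2_summable)
  finally have "Hnorm M c (L g) \<le> sqrt (?C\<^sup>2 * (\<Sum>\<^sub>\<infinity>m. (u m)\<^sup>2))"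
    unfolding Hnorm_eq[of M c "L g"] by (rule real_sqrt_le_mono)
  also have "\<dots> = (infsum u UNIV * sqrt (\<Sum>\<^sub>\<infinity>m. (u m)\<^sup>2)) * Hnorm M c g"
    by (simp add: real_sqrt_mult infsum_nonneg less_imp_le)
  finally show "Hnorm M c (L g) \<le> (infsum u UNIV * sqrt (\<Sum>\<^sub>\<infinity>m. (u m)\<^sup>2)) * Hnorm M c g" .
next
  fix f g \<alpha> \<beta> assume f: "f \<in> Hsp M c" and g: "g \<in> Hsp M c"
  show "L (\<lambda>n. \<alpha> * f n + \<beta> * g n) = (\<lambda>m. \<alpha> * L f m + \<beta> * L g m)"
  proof
    fix m
    have "((\<lambda>n. \<alpha> * (k m n * f n) + \<beta> * (k m n * g n)) has_sum \<alpha> * L f m + \<beta> * L g m) UNIV"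
      by (intro has_sum_add has_sum_cmult_right L_has_sum f g)
    thus "L (\<lambda>n. \<alpha> * f n + \<beta> * g n) m = \<alpha> * L f m + \<beta> * L g m"
      unfolding L_def[of "\<lambda>n. \<alpha> * f n + \<beta> * g n"] by (intro infsumI) (simp add: algebra_simps)
  qed
qed

text \<open>Every weighted entry contributes a rank-one operator between two basis vectors.
  Enumerating all pairs of frequencies gives the decomposition, and an exponentially decaying double
  sequence is summable to every power \<open>p > 0\<close>.\<close>

lemma L_nuclear: "nuclear0 M c L"
proof -
  have "infinite (UNIV :: ((int^2) \<times> (int^2)) set)"
  proof
    assume "finite (UNIV :: ((int^2) \<times> (int^2)) set)"
    hence "finite (range (fst :: (int^2) \<times> (int^2) \<Rightarrow> int^2))" by (rule finite_imageI)
    thus False using infinite_UNIV_int2 by simp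
  qed
  then obtain h :: "nat \<Rightarrow> (int^2) \<times> (int^2)" where h: "bij h" by (rule nat_enum)
  define A where "A p = of_real (ew M c (snd p) / ew M c (fst p)) * k (fst p) (snd p)" for p
  show ?thesis unfolding nuclear0_def
  proof (rule exI[of _ "\<lambda>j. A (h j)"], rule exI[of _ "\<lambda>j. rho M c (fst (h j))"],
      rule exI[of _ "\<lambda>j. rho M c (snd (h j))"], intro conjI allI impI ballI)
    fix p :: real assume p: "p > 0"
    have "(\<lambda>q. cmod (A q) powr p) summable_on UNIV"
    proof (rule summable_on_comparison_test)
      show "(\<lambda>(m, n). exp (- (a * p) * nn m) * exp (- (a * p) * nn n)) summable_on UNIV"
        by (rule summable_on_exp_nn_pair) (use a p in simp)
      fix q :: "(int^2) \<times> (int^2)"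
      obtain m n where q: "q = (m, n)" by (cases q)
      have "cmod (A q) = ew M c n / ew M c m * norm (k m n)"
        by (simp add: A_def q norm_mult norm_divide less_imp_le)
      also have "\<dots> \<le> exp (- a * nn m) * exp (- a * nn n)" by (rule decay)
      finally have "cmod (A q) powr p \<le> (exp (- a * nn m) * exp (- a * nn n)) powr p"
        using p by (intro powr_mono2) auto
      also have "\<dots> = exp (- (a * p) * nn m) * exp (- (a * p) * nn n)"
        by (simp add: powr_def algebra_simps ln_mult flip: exp_add)
      finally show "cmod (A q) powr p \<le> (case q of (m, n) \<Rightarrow> exp (- (a * p) * nn m) * exp (- (a * p) * nn n))"
        by (simp add: q)
    qed simp
    hence "(\<lambda>j. cmod (A (h j)) powr p) summable_on UNIV"
      using summable_on_reindex_bij_betw[OF h, of "\<lambda>q. cmod (A q) powr p"] by simp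
    thus "summable (\<lambda>j. cmod (A (h j)) powr p)" by (rule summable_on_imp_summable)
  next
    fix g m assume g: "g \<in> Hsp M c"
    let ?f = "\<lambda>p. A p * Hinner M c (rho M c (snd p)) g * rho M c (fst p) m"
    \<comment> \<open>For a fixed output coordinate \<open>m\<close> only pairs with first component
      \<open>m\<close> contribute, so the sum over all pairs reduces to a row.\<close>
    have "((?f \<circ> Pair m) has_sum L g m) UNIV"
    proof -
      have "?f (m, n) = k m n * g n" for n by (simp add: A_def Hinner_rho) (simp add: rho_ew)
      thus ?thesis using L_has_sum(1)[OF g, of m] by (simp add: o_def)
    qed
    hence "(?f has_sum L g m) (range (Pair m))"
      by (subst has_sum_reindex) (auto simp: inj_on_def)
    hence "(?f has_sum L g m) UNIV"
      by (rule has_sum_cong_neutral[THEN iffD1, rotated -1]) (auto simp: rho_ew)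
    hence "((\<lambda>j. ?f (h j)) has_sum L g m) UNIV"
      using has_sum_reindex_bij_betw[OF h, of ?f] by simp
    thus "(\<lambda>j. A (h j) * Hinner M c (rho M c (snd (h j))) g * rho M c (fst (h j)) m) sums L g m"
      by (rule has_sum_imp_sums)
  qed (simp_all add: rho_Hsp Hnorm_rho)
qed

lemma diag_bound: "norm (k n n) \<le> u n * u n"
  using decay[of n n] by (simp add: u_def)

lemma Htrace_L: "Htrace M c L = (\<Sum>\<^sub>\<infinity>n. k n n)"
  unfolding Htrace_def
proof (rule infsum_cong)
  fix n
  have "((\<lambda>j. k n j * rho M c n j) has_sum k n n * ew M c n) UNIV"
    by (rule has_sum_finite_neutralI[of "{n}"]) (auto simp: rho_ew)
  hence "L (rho M c n) n = k n n * ew M c n" unfolding L_def by (rule infsumI)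
  thus "Hinner M c (rho M c n) (L (rho M c n)) = k n n" by (simp add: Hinner_rho)
qed

lemma diag_has_sum: "((\<lambda>n. k n n) has_sum Htrace M c L) UNIV"
  unfolding Htrace_L
proof (rule has_sum_infsum, rule abs_summable_summable)
  show "(\<lambda>n. norm (k n n)) summable_on UNIV"
    by (rule summable_on_comparison_test[OF u2_summable]) (use diag_bound in \<open>auto simp: power2_eq_square\<close>)
qed

section \<open>Eigenvectors and the spectrum\<close>

lemma L_zero: "L (\<lambda>n. 0) m = 0"
  by (simp add: L_def)

lemma spectrum_of_eigenvector:
  assumes g: "g \<in> Hsp M c" and "g \<noteq> (\<lambda>n. 0)" and eig: "\<And>m. L g m = \<mu> * g m"
  shows "\<mu> \<in> Hspec M c L"
proof -
  have z: "(\<lambda>n. 0) \<in> Hsp M c" by (rule finite_support_Hsp) simp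
  have "\<not> inj_on (\<lambda>g m. L g m - \<mu> * g m) (Hsp M c)"
  proof
    assume inj: "inj_on (\<lambda>g m. L g m - \<mu> * g m) (Hsp M c)"
    have "(\<lambda>m. L g m - \<mu> * g m) = (\<lambda>m. L (\<lambda>n. 0) m - \<mu> * 0)"
      using L_zero by (simp add: eig)
    from inj_onD[OF inj this g z]
    show False using assms(2) by simp
  qed
  thus ?thesis unfolding Hspec_def bij_betw_def by simp
qed

text \<open>The constants split off as an invariant line with eigenvalue 1. The compression to the
  remaining Fourier modes has trace \<open>tr - 1\<close>, so it has a nonzero eigenvalue as soon as \<open>tr \<noteq> 1\<close>;
  since the compression is a contraction in the weighted sup norm, that eigenvalue is not 1.\<close>

lemma spectrum_nontrivial:
  assumes k0: "\<And>m. k m 0 = (if m = 0 then 1 else 0)" and tr: "Htrace M c L \<noteq> 1"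
    and small: "\<And>V S m. \<lbrakk>V 0 = 0; \<And>n. norm (V n) \<le> S; m \<noteq> 0\<rbrakk> \<Longrightarrow>
        norm (\<Sum>\<^sub>\<infinity>n. of_real (ew M c n / ew M c m) * k m n * V n) \<le> \<theta> * S" and th: "\<theta> < 1"
  shows "Hspec M c L - {0, 1} \<noteq> {}"
proof -
  obtain h :: "nat \<Rightarrow> int^2" where h: "bij h" by (rule nat_enum[OF infinite_UNIV_int2])
  \<comment> \<open>The matrix in the orthonormal basis with row and column 0 erased but kept as
    indices; a nonzero eigenvalue automatically gives \<open>V 0 = 0\<close>.\<close>
  define A where "A m n = (if m = 0 \<or> n = 0 then 0 else of_real (ew M c n / ew M c m) * k m n)" for m n
  have Ab: "norm (A m n) \<le> u m * u n" for m n
    using decay[of n m] by (auto simp: A_def norm_mult norm_divide u_def less_imp_le)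
  have sum_u: "summable (\<lambda>i. sqrt (u (h i)))"
  proof (rule summable_on_imp_summable)
    have "sqrt (u n) = exp (- (a / 2) * nn n)" for n
      unfolding u_def by (rule real_sqrt_unique) (simp_all flip: exp_double)
    hence "(\<lambda>n. sqrt (u n)) summable_on UNIV" using summable_on_exp_nn[of "a / 2"] a by simp
    thus "(\<lambda>i. sqrt (u (h i))) summable_on UNIV"
      using summable_on_reindex_bij_betw[OF h, of "\<lambda>n. sqrt (u n)"] by simp
  qed
  have "((\<lambda>n. A n n) has_sum (Htrace M c L - 1)) UNIV"
  proof -
    have "((\<lambda>n::int^2. if n = 0 then 1 else 0 :: complex) has_sum 1) UNIV"
      by (rule has_sum_finite_neutralI[of "{0}"]) auto
    hence "((\<lambda>n. k n n + - (if n = 0 then 1 else 0)) has_sum (Htrace M c L + - 1)) UNIV"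
      by (intro has_sum_add diag_has_sum has_sum_uminusI)
    moreover have "(\<lambda>n. k n n + - (if n = 0 then 1 else 0)) = (\<lambda>n. A n n)"
      by (auto simp: A_def k0 fun_eq_iff)
    ultimately show ?thesis by simp
  qed
  hence "((\<lambda>i. A (h i) (h i)) has_sum (Htrace M c L - 1)) UNIV"
    using has_sum_reindex_bij_betw[OF h, of "\<lambda>n. A n n"] by simp
  hence "(\<Sum>i. A (h i) (h i)) = Htrace M c L - 1" by (rule sums_unique[symmetric, OF has_sum_imp_sums])
  hence trA: "(\<Sum>i. A (h i) (h i)) \<noteq> 0" using tr by simp
  obtain \<mu> v K where ev: "\<mu> \<noteq> 0" "\<exists>i. v i \<noteq> 0" "\<And>i. norm (v i) \<le> K * u (h i)"
    "\<And>i. (\<lambda>j. A (h i) (h j) * v j) sums (\<mu> * v i)"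
    by (rule eigenvalue_of_nonzero_trace[of "\<lambda>i j. A (h i) (h j)" "\<lambda>i. u (h i)"])
       (use Ab u_le_1 sum_u trA in \<open>auto simp: less_imp_le\<close>)
  define h' where "h' = inv_into UNIV h"
  define V where "V n = v (h' n)" for n
  have hi: "h (h' n) = n" for n using h by (simp add: h'_def bij_is_surj surj_f_inv_f)
  have ih: "h' (h i) = i" for i using h by (simp add: h'_def bij_is_inj inv_f_f)
  have Vb: "norm (V n) \<le> K * u n" for n using ev(3)[of "h' n"] by (simp add: V_def hi)
  have K0: "0 \<le> K" using Vb[of 0] norm_ge_zero[of "V 0"] u_pos[of 0] by (smt (verit) mult_neg_pos)
  have AV: "norm (A m n * V n) \<le> u m * K * u n" for m n
  proof -
    have "norm (A m n) * norm (V n) \<le> (u m * u n) * K"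
      using Ab Vb[of n] u_le_1[of n] K0
      by (intro mult_mono) (auto intro: order_trans mult_left_le simp: less_imp_le)
    thus ?thesis by (simp add: norm_mult mult_ac)
  qed
  have AVs: "((\<lambda>n. A m n * V n) has_sum (\<mu> * V m)) UNIV" for m
  proof -
    have "(\<lambda>n. norm (A m n * V n)) summable_on UNIV"
      by (rule summable_on_comparison_test[OF summable_on_cmult_right[OF u_summable, of "u m * K"]]) (use AV in auto)
    from abs_summable_summable[OF this] obtain S where S: "((\<lambda>n. A m n * V n) has_sum S) UNIV"
      by (auto simp: summable_on_def)
    hence "((\<lambda>i. A m (h i) * V (h i)) has_sum S) UNIV"
      using has_sum_reindex_bij_betw[OF h, of "\<lambda>n. A m n * V n"] by simp
    hence "(\<lambda>i. A m (h i) * V (h i)) sums S" by (rule has_sum_imp_sums)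
    moreover have "(\<lambda>i. A m (h i) * V (h i)) sums (\<mu> * V m)"
      using ev(4)[of "h' m"] by (simp add: V_def hi ih)
    ultimately have "S = \<mu> * V m" by (rule sums_unique2)
    thus ?thesis using S by simp
  qed
  obtain i1 where "v i1 \<noteq> 0" using ev(2) by blast
  define n1 where "n1 = h i1"
  have n1: "V n1 \<noteq> 0" using \<open>v i1 \<noteq> 0\<close> by (simp add: n1_def V_def ih)
  have V0: "V 0 = 0"
  proof -
    have "((\<lambda>n::int^2. 0::complex) has_sum (\<mu> * V 0)) UNIV" using AVs[of 0] by (simp add: A_def)
    hence "\<mu> * V 0 = 0" by (rule has_sum_unique[OF _ has_sum_0_simp])
    thus ?thesis using ev(1) by simp
  qed
  have AV_eq: "A m n * V n = of_real (ew M c n / ew M c m) * k m n * V n" if "m \<noteq> 0" for m n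
    using that V0 by (auto simp: A_def)
  have mu1: "\<mu> \<noteq> 1"
  proof
    assume "\<mu> = 1"
    define S where "S = (SUP n. norm (V n))"
    have "norm (V n) \<le> K" for n using Vb[of n] mult_left_le[OF u_le_1[of n] K0] by linarith
    hence bdd: "bdd_above (range (\<lambda>n. norm (V n)))" by (rule bdd_aboveI2)
    have VS: "norm (V n) \<le> S" for n unfolding S_def by (rule cSUP_upper[OF UNIV_I bdd])
    have Spos: "S > 0" using VS[of n1] n1 by (meson less_le_trans zero_less_norm_iff)
    \<comment> \<open>The constant \<open>\<theta>\<close> is only known to be below 1; the maximum
      with 0 covers a negative value.\<close>
    have "norm (V m) \<le> max \<theta> 0 * S" for m
    proof (cases "m = 0")
      case False
      have "V m = (\<Sum>\<^sub>\<infinity>n. of_real (ew M c n / ew M c m) * k m n * V n)"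
        using infsumI[OF AVs[of m]] \<open>\<mu> = 1\<close> by (simp add: AV_eq[OF False])
      hence "norm (V m) \<le> \<theta> * S" using small[of V S m, OF V0 VS False] by simp
      also have "\<dots> \<le> max \<theta> 0 * S" using Spos by (intro mult_right_mono) auto
      finally show ?thesis .
    qed (use V0 Spos in simp)
    hence "S \<le> max \<theta> 0 * S" unfolding S_def by (intro cSUP_least) auto
    moreover have "max \<theta> 0 * S < 1 * S" using Spos th by (intro mult_strict_right_mono) auto
    ultimately show False by simp
  qed
  define F where "F n = of_real (ew M c n) * V n" for n
  have Fb: "norm (F n) / ew M c n \<le> K" for n
    using Vb[of n] mult_left_le[OF u_le_1[of n] K0] by (simp add: F_def norm_mult less_imp_le)
  \<comment> \<open>The eigenvector of the compression is lifted by choosing its constant mode so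
    that \<open>G0 + L F 0 = \<mu> * G0\<close>, which is solvable because
    \<open>\<mu> \<noteq> 1\<close>. Column 0 is the unit vector, so the other equations are not
    disturbed.\<close>
  define G0 where "G0 = L F 0 / (\<mu> - 1)"
  define G where "G n = (if n = 0 then G0 else F n)" for n
  have F0: "F 0 = 0" by (simp add: F_def V0)
  have LF: "L F m = \<mu> * F m" if "m \<noteq> 0" for m
  proof -
    have "((\<lambda>n. of_real (ew M c m) * (A m n * V n)) has_sum (of_real (ew M c m) * (\<mu> * V m))) UNIV"
      by (rule has_sum_cmult_right[OF AVs])
    moreover have "(\<lambda>n. of_real (ew M c m) * (A m n * V n)) = (\<lambda>n. k m n * F n)"
      unfolding AV_eq[OF that] F_def by auto
    ultimately have "L F m = of_real (ew M c m) * (\<mu> * V m)" unfolding L_def by (simp add: infsumI)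
    thus ?thesis by (simp add: F_def)
  qed
  have LG: "L G m = k m 0 * G0 + L F m" for m
  proof -
    have "((\<lambda>n. if n = 0 then k m 0 * G0 else 0) has_sum (k m 0 * G0)) UNIV"
      by (rule has_sum_finite_neutralI[of "{0}"]) auto
    hence "((\<lambda>n. (if n = 0 then k m 0 * G0 else 0) + k m n * F n) has_sum (k m 0 * G0 + L F m)) UNIV"
      by (intro has_sum_add L_has_sum_bounded(1)[of F K] Fb)
    moreover have "(\<lambda>n. (if n = 0 then k m 0 * G0 else 0) + k m n * F n) = (\<lambda>n. k m n * G n)"
      by (auto simp: G_def F0)
    ultimately show ?thesis unfolding L_def[of G] by (simp add: infsumI)
  qed
  have eig: "L G m = \<mu> * G m" for m
  proof (cases "m = 0")
    case True
    thus ?thesis unfolding LG k0 using mu1 by (simp add: G_def G0_def field_simps)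
  next
    case False
    thus ?thesis unfolding LG k0 using LF by (simp add: G_def)
  qed
  have "G \<in> Hsp M c" unfolding Hsp_iff
  proof (rule summable_on_comparison_test)
    show "(\<lambda>n. K\<^sup>2 * (u n)\<^sup>2 + (if n = 0 then (norm G0 / ew M c 0)\<^sup>2 else 0)) summable_on UNIV"
      by (intro summable_on_add summable_on_cmult_right u2_summable finite_nonzero_values_imp_summable_on)
         (auto intro: finite_subset[of _ "{0}"])
    fix n
    have "norm (F n) / ew M c n \<le> K * u n" using Vb[of n] by (simp add: F_def norm_mult less_imp_le)
    hence "(norm (F n) / ew M c n)\<^sup>2 \<le> (K * u n)\<^sup>2" by (rule power_mono) (simp add: less_imp_le)
    thus "(norm (G n) / ew M c n)\<^sup>2 \<le> K\<^sup>2 * (u n)\<^sup>2 + (if n = 0 then (norm G0 / ew M c 0)\<^sup>2 else 0)"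
      by (auto simp: G_def power_mult_distrib)
  qed simp
  moreover have "G \<noteq> (\<lambda>n. 0)"
  proof -
    have "n1 \<noteq> 0" using n1 V0 by auto
    hence "G n1 \<noteq> 0" using n1 by (simp add: G_def F_def)
    thus ?thesis by auto
  qed
  ultimately have "\<mu> \<in> Hspec M c L" using spectrum_of_eigenvector eig by blast
  thus ?thesis using ev(1) mu1 by auto
qed

end

section \<open>The Koopman operator\<close>

definition sine_map :: "int^2 \<Rightarrow> real^2 \<Rightarrow> real^2" where
  "sine_map n x = sin (2 * pi * ndot n x) *\<^sub>R axis 1 1"

lemma norm_sin_le_exp_Im: "norm (sin w) \<le> exp \<bar>Im w\<bar>" for w :: complex
proof -
  have "norm (sin w) = norm (exp (\<i> * w) - exp (- (\<i> * w))) / 2"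
    by (simp add: sin_exp_eq norm_divide norm_mult)
  also have "\<dots> \<le> (norm (exp (\<i> * w)) + norm (exp (- (\<i> * w)))) / 2"
    by (intro divide_right_mono norm_triangle_ineq4) simp
  also have "\<dots> \<le> (exp \<bar>Im w\<bar> + exp \<bar>Im w\<bar>) / 2"
    by (intro divide_right_mono add_mono) auto
  finally show ?thesis by simp
qed

lemma sine_map_Bspace: "sine_map n \<in> Bspace r"
proof -
  define X :: "complex^2 \<Rightarrow> complex^2"
    where "X z = (\<chi> i. if i = 1 then sin (2 * pi * kdot n z) else 0)" for z :: "complex^2"
  have kl: "bounded_linear (kdot n)"
    by (intro linear_conv_bounded_linear[THEN iffD1] linearI)
       (simp_all add: kdot_def algebra_simps)
  have der: "(X has_derivative (\<lambda>v. \<chi> i. if i = 1 then cos (2 * pi * kdot n z) * (2 * pi * kdot n v) else 0)) (at z)" for z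
  proof -
    have k: "(kdot n has_derivative kdot n) (at z)" by (rule bounded_linear_imp_has_derivative[OF kl])
    have k2: "((\<lambda>z. 2 * pi * kdot n z) has_derivative (\<lambda>v. 2 * pi * kdot n v)) (at z)"
      by (rule has_derivative_mult_right[OF k])
    have s: "((\<lambda>z. sin (2 * pi * kdot n z)) has_derivative (\<lambda>v. cos (2 * pi * kdot n z) * (2 * pi * kdot n v))) (at z)"
      by (rule has_derivative_compose[OF k2]) (rule DERIV_sin[unfolded has_field_derivative_def])
    have bl: "bounded_linear (\<lambda>w::complex. (\<chi> i. if i = 1 then w else 0) :: complex^2)"
      by (intro linear_conv_bounded_linear[THEN iffD1] linearI)
         (simp_all add: vec_eq_iff)
    show ?thesis using bounded_linear.has_derivative[OF bl s] unfolding X_def .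
  qed
  have "is_ext r (sine_map n) X" unfolding is_ext_def cholo_def
  proof (intro conjI ballI allI)
    fix z
    let ?D = "\<lambda>v. (\<chi> i. if i = 1 then cos (2 * pi * kdot n z) * (2 * pi * kdot n v) else 0) :: complex^2"
    have "?D (a *s v) = a *s ?D v" for a v
      by (simp add: vec_eq_iff kdot_def algebra_simps)
    thus "\<exists>D. (X has_derivative D) (at z) \<and> (\<forall>a v. D (a *s v) = a *s D v)" using der by blast
  next
    have "norm (X z) \<le> exp (2 * pi * (nn n * r))" if z: "z \<in> strip r" for z
    proof -
      have zi: "\<bar>Im (z$i)\<bar> \<le> r" for i using z by (simp add: strip_def less_imp_le)
      have "norm (X z) \<le> norm (X z $ 1) + norm (X z $ 2)"
        unfolding norm_vec_def using L2_set_le_sum[of UNIV "\<lambda>i. norm (X z $ i)"] by (simp add: sum_2)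
      also have "\<dots> = norm (sin (2 * pi * kdot n z))" by (simp add: X_def)
      also have "\<dots> \<le> exp \<bar>Im (2 * pi * kdot n z)\<bar>" by (rule norm_sin_le_exp_Im)
      also have "\<bar>Im (2 * pi * kdot n z)\<bar> = 2 * pi * \<bar>real_of_int (n$1) * Im (z$1) + real_of_int (n$2) * Im (z$2)\<bar>"
        by (simp add: kdot_def abs_mult)
      also have "\<bar>real_of_int (n$1) * Im (z$1) + real_of_int (n$2) * Im (z$2)\<bar> \<le> \<bar>real_of_int (n$1)\<bar> * r + \<bar>real_of_int (n$2)\<bar> * r"
        by (intro order_trans[OF abs_triangle_ineq] add_mono) (auto simp: abs_mult intro!: mult_left_mono zi)
      also have "\<dots> = nn n * r" by (simp add: nn_2 algebra_simps)
      finally show ?thesis by simp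
    qed
    thus "bounded (X ` strip r)" unfolding bounded_iff by blast
  next
    fix x
    have "kdot n (cvec x) = of_real (ndot n x)" by (simp add: kdot_def ndot_2)
    hence "sin (2 * pi * kdot n (cvec x)) = of_real (sin (2 * pi * ndot n x))"
      by (simp flip: sin_of_real)
    thus "X (cvec x) = cvec (sine_map n x)"
      by (simp add: X_def sine_map_def vec_eq_iff axis_def)
  qed
  moreover have "sine_map n (x + ivec k) = sine_map n x" for x k
  proof -
    have "ndot n (ivec k) \<in> \<int>" by (rule ndot_Ints) (simp add: ivec_def)
    then obtain j :: int where "ndot n (ivec k) = j" by (auto elim: Ints_cases)
    hence "sin (2 * pi * ndot n (x + ivec k)) = sin (2 * pi * ndot n x + 2 * pi * j)"
      by (simp add: ndot_add algebra_simps)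
    also have "\<dots> = sin (2 * pi * ndot n x)"
      using sin_int_2pin[of j] cos_int_2pin[of j] by (simp add: sin_add mult_ac)
    finally show ?thesis by (simp add: sine_map_def)
  qed
  ultimately show ?thesis unfolding Bspace_def by blast
qed

text \<open>The chosen frequency takes integer values at all fixed points, so the cosine in the
  derivative is 1 at each of them. The derivative is then \<open>2 * pi\<close> times a rank-one
  matrix whose product with the inverse of \<open>I - M\<close> has trace \<open>2 * pi\<close>, by
  duality with the first unit vector; no cancellation between fixed points can occur.\<close>

lemma BM_sine_map:
  assumes det: "det (defect M) \<noteq> 0"
  shows "BM M (sine_map (axis 1 1 - transpose M *v axis 1 1)) = 2 * pi"
proof -
  let ?e = "axis 1 1 :: int^2" and ?B = "matrix_inv (defect M)"
  let ?n = "?e - transpose M *v ?e"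
  have nl: "bounded_linear (ndot ?n)"
    by (intro linear_conv_bounded_linear[THEN iffD1] linearI) (simp_all add: ndot_2 algebra_simps)
  have tr: "trace (?B ** matrix (frechet_derivative (sine_map ?n) (at x))) = 2 * pi" if x: "x \<in> fixpts M" for x
  proof -
    have "ndot ?n x \<in> \<int>" unfolding ndot_defect[symmetric]
      by (rule ndot_Ints) (use x in \<open>simp add: fixpts_iff\<close>)
    then obtain j :: int where "ndot ?n x = j" by (auto elim: Ints_cases)
    hence c1: "cos (2 * pi * ndot ?n x) = 1" using cos_int_2pin[of j] by (simp add: mult_ac)
    have k: "(ndot ?n has_derivative ndot ?n) (at x)" by (rule bounded_linear_imp_has_derivative[OF nl])
    have k2: "((\<lambda>x. 2 * pi * ndot ?n x) has_derivative (\<lambda>v. 2 * pi * ndot ?n v)) (at x)"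
      by (rule has_derivative_mult_right[OF k])
    have s: "((\<lambda>x. sin (2 * pi * ndot ?n x)) has_derivative (\<lambda>v. cos (2 * pi * ndot ?n x) * (2 * pi * ndot ?n v))) (at x)"
      by (rule has_derivative_compose[OF k2]) (rule DERIV_sin[unfolded has_field_derivative_def])
    have "(sine_map ?n has_derivative (\<lambda>v. (cos (2 * pi * ndot ?n x) * (2 * pi * ndot ?n v)) *\<^sub>R axis 1 1)) (at x)"
      unfolding sine_map_def[abs_def] by (rule has_derivative_scaleR_left[OF s])
    hence D: "frechet_derivative (sine_map ?n) (at x) = (\<lambda>v. (2 * pi * ndot ?n v) *\<^sub>R axis 1 1)"
      unfolding c1 using frechet_derivative_at by (metis (no_types, lifting) mult_1)
    have "trace (?B ** matrix (frechet_derivative (sine_map ?n) (at x)))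
        = 2 * pi * (real_of_int (?n$1) * ?B$1$1 + real_of_int (?n$2) * ?B$2$1)"
      unfolding D by (simp add: trace_def matrix_matrix_mult_def matrix_def sum_2 axis_def ndot_2 algebra_simps)
    also have "real_of_int (?n$1) * ?B$1$1 + real_of_int (?n$2) * ?B$2$1 = ndot ?n (?B *v axis 1 1)"
      by (simp add: ndot_2 matrix_vector_mult_basis column_def)
    also have "\<dots> = ndot ?e (axis 1 1)"
      unfolding ndot_defect[symmetric] by (simp add: matrix_vector_mul_assoc matrix_inv_works(1)[OF det])
    also have "\<dots> = 1" by (simp only: ndot_axis) (simp add: axis_def)
    finally show ?thesis by simp
  qed
  have "NM M \<noteq> 0" using det by (simp add: NM_def)
  thus ?thesis unfolding BM_def using card_fixpts(2)[OF det] by (simp add: tr)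
qed

text \<open>The adjugate is the integer inverse when the determinant is 1. This leaves at most one
  unperturbed entry in each row of the Koopman matrix.\<close>

lemma tmul_int_inj:
  fixes M :: "int^2^2"
  assumes "det M = 1" "transpose M *v m = transpose M *v n"
  shows "m = n"
proof -
  have d: "M$1$1 * M$2$2 - M$1$2 * M$2$1 = 1" using assms(1) by (simp add: det_2)
  have e: "M$1$1 * m$1 + M$2$1 * m$2 = M$1$1 * n$1 + M$2$1 * n$2"
    "M$1$2 * m$1 + M$2$2 * m$2 = M$1$2 * n$1 + M$2$2 * n$2"
    using assms(2) tmul_int_nth by metis+
  have 1: "x = M$2$2 * (M$1$1 * x + M$2$1 * y) - M$2$1 * (M$1$2 * x + M$2$2 * y)" for x y
  proof -
    have "M$2$2 * (M$1$1 * x + M$2$1 * y) - M$2$1 * (M$1$2 * x + M$2$2 * y)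
        = (M$1$1 * M$2$2 - M$1$2 * M$2$1) * x" by (simp add: algebra_simps)
    thus ?thesis by (simp add: d)
  qed
  have 2: "y = M$1$1 * (M$1$2 * x + M$2$2 * y) - M$1$2 * (M$1$1 * x + M$2$1 * y)" for x y
  proof -
    have "M$1$1 * (M$1$2 * x + M$2$2 * y) - M$1$2 * (M$1$1 * x + M$2$1 * y)
        = (M$1$1 * M$2$2 - M$1$2 * M$2$1) * y" by (simp add: algebra_simps)
    thus ?thesis by (simp add: d)
  qed
  have "m$1 = n$1" using 1[of "m$1" "m$2"] 1[of "n$1" "n$2"] e by simp
  moreover have "m$2 = n$2" using 2[of "m$2" "m$1"] 2[of "n$2" "n$1"] e by simp
  ultimately show ?thesis by (simp add: vec_eq_iff forall_2)
qed

section \<open>Agreement with composition on trigonometric polynomials\<close>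

lemma fourier_tp_eval:
  assumes a: "trigpoly a" and T: "continuous_on UNIV T"
  shows "fourier (\<lambda>x. tp_eval a (T x)) m
    = (\<Sum>n\<in>{n. a n \<noteq> 0}. a n * fourier (\<lambda>x. cis (2 * pi * ndot n (T x))) m)"
proof -
  have fin: "finite {n. a n \<noteq> 0}" using a by (simp add: trigpoly_def)
  have i: "(\<lambda>x. a n * (cis (2 * pi * ndot n (T x)) * echar (- m) x)) integrable_on ubox" for n
    by (intro integrable_continuous continuous_intros continuous_on_subset[OF T] subset_UNIV)
  have "fourier (\<lambda>x. tp_eval a (T x)) m
      = integral ubox (\<lambda>x. \<Sum>n\<in>{n. a n \<noteq> 0}. a n * (cis (2 * pi * ndot n (T x)) * echar (- m) x))"
    unfolding fourier_echar tp_eval_def by (simp only: sum_distrib_right mult.assoc)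
  also have "\<dots> = (\<Sum>n\<in>{n. a n \<noteq> 0}. integral ubox (\<lambda>x. a n * (cis (2 * pi * ndot n (T x)) * echar (- m) x)))"
    by (rule integral_sum[OF fin i])
  finally show ?thesis by (simp add: fourier_echar)
qed

lemma koopman_ext_kmat:
  assumes "decaying_matrix M c (kmat M \<psi> \<epsilon>) a" and cont: "continuous_on UNIV \<psi>"
  shows "koopman_ext M c (Tmap M \<epsilon> \<psi>) (decaying_matrix.L (kmat M \<psi> \<epsilon>))"
proof -
  interpret D: decaying_matrix M c "kmat M \<psi> \<epsilon>" a by fact
  have cT: "continuous_on UNIV (Tmap M \<epsilon> \<psi>)"
    unfolding Tmap_def[abs_def]
    by (intro continuous_intros cont linear_continuous_on matrix_vector_mul_bounded_linear)
  have "D.L f = fourier (\<lambda>x. tp_eval f (Tmap M \<epsilon> \<psi> x))" if f: "trigpoly f" for f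
  proof
    fix m
    have "((\<lambda>n. kmat M \<psi> \<epsilon> m n * f n) has_sum (\<Sum>n\<in>{n. f n \<noteq> 0}. kmat M \<psi> \<epsilon> m n * f n)) UNIV"
      by (rule has_sum_finite_neutralI) (use f in \<open>auto simp: trigpoly_def\<close>)
    hence "D.L f m = (\<Sum>n\<in>{n. f n \<noteq> 0}. kmat M \<psi> \<epsilon> m n * f n)" unfolding D.L_def by (rule infsumI)
    thus "D.L f m = fourier (\<lambda>x. tp_eval f (Tmap M \<epsilon> \<psi> x)) m"
      unfolding fourier_tp_eval[OF f cT] fourier_Tmap by (simp add: mult.commute)
  qed
  thus ?thesis unfolding koopman_ext_def using D.L_bounded by blast
qed

section \<open>Openness and density of the nonvanishing set\<close>

lemma BM_nonzero_open:
  assumes det: "det M = 1" and hyp: "hyperbolic M" and r: "r > 0"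
  shows "Bopen r {\<psi> \<in> Bspace r. BM M \<psi> \<noteq> 0}"
  unfolding Bopen_def
proof
  obtain Q where Q: "Q \<ge> 0" "\<And>\<psi>. \<psi> \<in> Bspace r \<Longrightarrow> \<bar>BM M \<psi>\<bar> \<le> Q * Bnorm r \<psi>"
    by (rule BM_bounded[OF det hyp r]) (rule that, assumption+)
  fix \<psi> assume psi: "\<psi> \<in> {\<psi> \<in> Bspace r. BM M \<psi> \<noteq> 0}"
  \<comment> \<open>A perturbation of norm below this changes the functional by less than its value
    at \<open>\<psi>\<close>; the added 1 covers \<open>Q = 0\<close>.\<close>
  define \<delta> where "\<delta> = \<bar>BM M \<psi>\<bar> / (Q + 1)"
  have "\<delta> > 0" using psi Q(1) by (simp add: \<delta>_def)
  moreover have "\<phi> \<in> {\<psi> \<in> Bspace r. BM M \<psi> \<noteq> 0}" if phi: "\<phi> \<in> Bspace r" "Bnorm r (\<phi> - \<psi>) < \<delta>" for \<phi>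
  proof -
    have e: "\<phi> - \<psi> = (\<lambda>x. \<phi> x + (-1) *\<^sub>R \<psi> x)" by (simp add: fun_eq_iff)
    have diff: "\<phi> - \<psi> \<in> Bspace r" unfolding e by (rule Bspace_lincomb) (use phi psi in auto)
    have B: "BM M (\<phi> - \<psi>) = BM M \<phi> - BM M \<psi>"
      unfolding e using BM_lincomb[OF phi(1) _ r det_defect_nz[OF det hyp], of \<psi> "-1"] psi by simp
    have "BM M \<phi> \<noteq> 0"
    proof
      assume "BM M \<phi> = 0"
      hence "\<bar>BM M \<psi>\<bar> \<le> Q * Bnorm r (\<phi> - \<psi>)" using Q(2)[OF diff] B by simp
      also have "\<dots> \<le> Q * \<delta>" using phi Q(1) by (intro mult_left_mono) auto
      also have "\<dots> < (Q + 1) * \<delta>" using \<open>\<delta> > 0\<close> by simp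
      also have "\<dots> = \<bar>BM M \<psi>\<bar>" using Q(1) by (simp add: \<delta>_def)
      finally show False by simp
    qed
    thus ?thesis using phi by simp
  qed
  ultimately show "\<exists>\<delta>>0. \<forall>\<phi>\<in>Bspace r. Bnorm r (\<phi> - \<psi>) < \<delta> \<longrightarrow> \<phi> \<in> {\<psi> \<in> Bspace r. BM M \<psi> \<noteq> 0}"
    by blast
qed

lemma Bnorm_scale_le:
  assumes psi: "\<psi> \<in> Bspace r" and r: "r > 0"
  shows "Bnorm r (\<lambda>x. t *\<^sub>R \<psi> x) \<le> \<bar>t\<bar> * Bnorm r \<psi>"
proof -
  obtain \<Psi> where ext: "is_ext r \<psi> \<Psi>" using Bspace_ext[OF psi] ..
  have z: "is_ext r (\<lambda>x. 0) (\<lambda>z. 0)"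
  proof -
    have "((\<lambda>z. 0::complex^2) has_derivative (\<lambda>v. 0)) (at z)" for z :: "complex^2" by simp
    moreover have "(0::complex^2) = a *s 0" for a by simp
    ultimately have "cholo (\<lambda>z. 0) (strip r)" unfolding cholo_def by metis
    moreover have "cvec 0 = 0" by (simp add: vec_eq_iff)
    moreover have "bounded ((\<lambda>z. 0::complex^2) ` strip r)"
      by (rule bounded_subset[of "{0}"]) auto
    ultimately show ?thesis by (simp add: is_ext_def)
  qed
  have "is_ext r (\<lambda>x. t *\<^sub>R \<psi> x) (\<lambda>z. t *\<^sub>R \<Psi> z)"
    using is_ext_lincomb[OF z ext, of t] by simp
  thus ?thesis
  proof (rule Bnorm_le[OF _ r])
    show "norm (t *\<^sub>R \<Psi> z) \<le> \<bar>t\<bar> * Bnorm r \<psi>" if "z \<in> strip r" for z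
      using Bnorm_bound[OF ext that] by (simp add: mult_left_mono)
  qed
qed

lemma BM_nonzero_dense:
  assumes det: "det M = 1" and hyp: "hyperbolic M" and r: "r > 0"
  shows "Bdense r {\<psi> \<in> Bspace r. BM M \<psi> \<noteq> 0}"
  unfolding Bdense_def
proof (intro ballI allI impI)
  fix \<psi> and \<delta> :: real assume psi: "\<psi> \<in> Bspace r" and d: "\<delta> > 0"
  define s where "s = sine_map (axis 1 1 - transpose M *v axis 1 1)"
  have s: "s \<in> Bspace r" "BM M s \<noteq> 0"
    using sine_map_Bspace BM_sine_map[OF det_defect_nz[OF det hyp]] by (simp_all add: s_def)
  have Bs: "Bnorm r s \<ge> 0"
  proof -
    obtain \<Psi> where "is_ext r s \<Psi>" using Bspace_ext[OF s(1)] ..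
    from Bnorm_bound[OF this cvec_in_strip[OF r, of 0]] show ?thesis using norm_ge_zero order_trans by blast
  qed
  \<comment> \<open>No perturbation is made if the functional is already nonzero; otherwise the
    multiple of the sine map is scaled to have norm at most half of \<open>\<delta>\<close>.\<close>
  define t where "t = (if BM M \<psi> = 0 then \<delta> / (2 * (Bnorm r s + 1)) else 0)"
  define \<phi> where "\<phi> = (\<lambda>x. \<psi> x + t *\<^sub>R s x)"
  have "\<phi> \<in> Bspace r" unfolding \<phi>_def by (rule Bspace_lincomb[OF psi s(1)])
  moreover have "BM M \<phi> \<noteq> 0"
    unfolding \<phi>_def BM_lincomb[OF psi s(1) r det_defect_nz[OF det hyp]]
    using s(2) d Bs by (auto simp: t_def)
  moreover have "Bnorm r (\<phi> - \<psi>) < \<delta>"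
  proof -
    have "\<phi> - \<psi> = (\<lambda>x. t *\<^sub>R s x)" by (simp add: \<phi>_def fun_eq_iff)
    hence "Bnorm r (\<phi> - \<psi>) \<le> \<bar>t\<bar> * Bnorm r s" using Bnorm_scale_le[OF s(1) r] by simp
    also have "\<dots> \<le> \<delta> / (2 * (Bnorm r s + 1)) * (Bnorm r s + 1)"
      using Bs d by (intro mult_mono) (auto simp: t_def)
    also have "\<dots> = \<delta> / 2"
    proof -
      have "\<delta> / (2 * b) * b = \<delta> / 2" if "b \<noteq> 0" for b :: real using that by simp
      moreover have "Bnorm r s + 1 \<noteq> 0" using Bs by simp
      ultimately show ?thesis by blast
    qed
    also have "\<dots> < \<delta>" using d by simp
    finally show ?thesis .
  qed
  ultimately show "\<exists>\<phi>\<in>{\<psi> \<in> Bspace r. BM M \<psi> \<noteq> 0}. Bnorm r (\<phi> - \<psi>) < \<delta>" by blast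
qed

theorem theorem4p3:
  fixes M :: "int^2^2" and r :: real
  assumes "det M = 1" and "hyperbolic M" and "r > 0"
  shows "\<exists>c>0. \<exists>G. G \<subseteq> Bspace r \<and> Bopen r G \<and> Bdense r G \<and> (\<forall>\<psi>\<in>G. BM M \<psi> \<noteq> 0) \<and>
    (\<forall>\<psi>\<in>G. \<exists>\<epsilon>0>0. \<exists>L::real \<Rightarrow> op.
       (\<forall>\<epsilon>. 0 < \<epsilon> \<and> \<epsilon> < \<epsilon>0 \<longrightarrow>
          koopman_ext M c (Tmap M \<epsilon> \<psi>) (L \<epsilon>) \<and> nuclear0 M c (L \<epsilon>) \<and>
          Hspec M c (L \<epsilon>) - {0, 1} \<noteq> {}) \<and>
       (\<lambda>\<epsilon>. Htrace M c (L \<epsilon>) - 1 - complex_of_real (\<epsilon> * BM M \<psi>))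
          \<in> O[at_right 0](\<lambda>\<epsilon>. complex_of_real (\<epsilon>\<^sup>2)))"
proof -
  obtain c a q where c: "c > 0" and a: "a > 0" and q: "q < 1"
    and contract: "\<And>n. n \<noteq> 0 \<Longrightarrow> ew M c n / ew M c (transpose M *v n) \<le> q"
    and entries: "\<And>\<psi>. \<psi> \<in> Bspace r \<Longrightarrow> \<exists>\<epsilon>1>0. \<exists>C\<ge>0. \<forall>\<epsilon>. 0 \<le> \<epsilon> \<and> \<epsilon> < \<epsilon>1 \<longrightarrow> weighted_bounds M c a \<psi> C \<epsilon>"
    by (rule weighted_kmat[OF assms]) (rule that, assumption+)
  let ?G = "{\<psi> \<in> Bspace r. BM M \<psi> \<noteq> 0}"
  have "\<exists>\<epsilon>0>0. \<exists>L::real \<Rightarrow> op.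
       (\<forall>\<epsilon>. 0 < \<epsilon> \<and> \<epsilon> < \<epsilon>0 \<longrightarrow>
          koopman_ext M c (Tmap M \<epsilon> \<psi>) (L \<epsilon>) \<and> nuclear0 M c (L \<epsilon>) \<and>
          Hspec M c (L \<epsilon>) - {0, 1} \<noteq> {}) \<and>
       (\<lambda>\<epsilon>. Htrace M c (L \<epsilon>) - 1 - complex_of_real (\<epsilon> * BM M \<psi>))
          \<in> O[at_right 0](\<lambda>\<epsilon>. complex_of_real (\<epsilon>\<^sup>2))" if psi: "\<psi> \<in> ?G" for \<psi>
  proof -
    from psi have psiB: "\<psi> \<in> Bspace r" and BM0: "BM M \<psi> \<noteq> 0" by auto
    obtain \<Psi> where ext: "is_ext r \<psi> \<Psi>" using Bspace_ext[OF psiB] ..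
    obtain \<epsilon>1 C where e1: "\<epsilon>1 > 0" and C: "C \<ge> 0"
      and wb: "\<And>\<epsilon>. 0 \<le> \<epsilon> \<and> \<epsilon> < \<epsilon>1 \<Longrightarrow> weighted_bounds M c a \<psi> C \<epsilon>"
      using entries[OF psiB] by blast
    note en = wb[unfolded weighted_bounds_def, rule_format, THEN conjunct1]
      wb[unfolded weighted_bounds_def, rule_format, THEN conjunct2, THEN conjunct1]
      wb[unfolded weighted_bounds_def, rule_format, THEN conjunct2, THEN conjunct2]
    define U where "U = (\<Sum>\<^sub>\<infinity>n. exp (- a * nn n))"
    have U: "((\<lambda>n. exp (- a * nn n)) has_sum U) UNIV"
      unfolding U_def by (intro has_sum_infsum summable_on_exp_nn a)
    have U0: "U \<ge> 0" by (rule has_sum_nonneg[OF U]) simp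
    define U2 where "U2 = (\<Sum>\<^sub>\<infinity>n. exp (- a * nn n) * exp (- a * nn n))"
    have U2: "((\<lambda>n. exp (- a * nn n) * exp (- a * nn n)) has_sum U2) UNIV"
    proof -
      have "(\<lambda>n. exp (- (2 * a) * nn n)) summable_on UNIV" by (rule summable_on_exp_nn) (use a in simp)
      thus ?thesis unfolding U2_def by (intro has_sum_infsum) (simp add: mult.assoc flip: exp_add)
    qed
    have U20: "U2 \<ge> 0" by (rule has_sum_nonneg[OF U2]) simp
    \<comment> \<open>The contraction bound itself supplies positivity, since it dominates a ratio
      of positive weights at a nonzero frequency.\<close>
    have q0: "q > 0"
    proof -
      have "0 < ew M c (axis 1 1) / ew M c (transpose M *v axis 1 1)" by simp
      also have "\<dots> \<le> q" by (rule contract) (simp add: axis_eq_0_iff)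
      finally show ?thesis .
    qed
    let ?L = "\<lambda>\<epsilon>. decaying_matrix.L (kmat M \<psi> \<epsilon>)"
    have dm: "decaying_matrix M c (kmat M \<psi> \<epsilon>) a" if "0 \<le> \<epsilon> \<and> \<epsilon> < \<epsilon>1" for \<epsilon>
      by unfold_locales (use a en(1)[OF that] in auto)
    have trace: "norm (Htrace M c (?L \<epsilon>) - 1 - complex_of_real (\<epsilon> * BM M \<psi>)) \<le> \<epsilon>\<^sup>2 * C * U2"
      if e: "0 \<le> \<epsilon> \<and> \<epsilon> < \<epsilon>1" for \<epsilon>
    proof -
      interpret D: decaying_matrix M c "kmat M \<psi> \<epsilon>" a by (rule dm[OF e])
      have one: "((\<lambda>n::int^2. if n = 0 then 1 else 0 :: complex) has_sum 1) UNIV"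
        by (rule has_sum_finite_neutralI[of "{0}"]) auto
      have "((\<lambda>n. kmat M \<psi> \<epsilon> n n - (if n = 0 then 1 else 0) - of_real \<epsilon> * BM_term M \<psi> n) has_sum
          (Htrace M c D.L - 1 - of_real \<epsilon> * of_real (BM M \<psi>))) UNIV"
        unfolding diff_conv_add_uminus
        by (intro has_sum_add D.diag_has_sum has_sum_uminusI one has_sum_cmult_right
            BM_has_sum[OF psiB ext assms(3) det_defect_nz[OF assms(1,2)]])
      from norm_infsum_le[OF this has_sum_cmult_right[OF U2, of "\<epsilon>\<^sup>2 * C"]] en(3)[OF e]
      show ?thesis by simp
    qed
    \<comment> \<open>Three requirements: the entry bounds hold, the contraction factor
      \<open>q + \<epsilon> * (C * U)\<close> stays below 1, and the first-order term exceeds the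
      remainder, so that the trace differs from 1. The added 1s keep the denominators
      positive.\<close>
    define \<epsilon>0 where "\<epsilon>0 = min \<epsilon>1 (min ((1 - q) / (2 * (C * U + 1))) (\<bar>BM M \<psi>\<bar> / (C * U2 + 1)))"
    have CU: "C * U \<ge> 0" "C * U2 \<ge> 0" using C U0 U20 by simp_all
    have e0: "\<epsilon>0 > 0" using e1 q BM0 CU by (simp add: \<epsilon>0_def add_nonneg_pos)
    have spec: "Hspec M c (?L \<epsilon>) - {0, 1} \<noteq> {}" if e: "0 < \<epsilon> \<and> \<epsilon> < \<epsilon>0" for \<epsilon>
    proof -
      have e': "0 \<le> \<epsilon> \<and> \<epsilon> < \<epsilon>1" using e by (simp add: \<epsilon>0_def)
      interpret D: decaying_matrix M c "kmat M \<psi> \<epsilon>" a by (rule dm[OF e'])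
      have small1: "\<epsilon> * (C * U) < (1 - q) / 2"
      proof -
        have "\<epsilon> * (C * U + 1) < (1 - q) / 2"
          using e CU by (simp add: \<epsilon>0_def field_simps add_nonneg_pos)
        moreover have "\<epsilon> * (C * U) \<le> \<epsilon> * (C * U + 1)" using e by (intro mult_left_mono) auto
        ultimately show ?thesis by linarith
      qed
      have small2: "\<epsilon> * (C * U2) < \<bar>BM M \<psi>\<bar>"
      proof -
        have "\<epsilon> * (C * U2 + 1) < \<bar>BM M \<psi>\<bar>"
          using e CU by (simp add: \<epsilon>0_def field_simps add_nonneg_pos)
        moreover have "\<epsilon> * (C * U2) \<le> \<epsilon> * (C * U2 + 1)" using e by (intro mult_left_mono) auto
        ultimately show ?thesis by linarith
      qed
      show ?thesis
      proof (rule D.spectrum_nontrivial[where \<theta> = "q + \<epsilon> * (C * U)"])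
        show "kmat M \<psi> \<epsilon> m 0 = (if m = 0 then 1 else 0)" for m by (rule kmat_0)
        show "q + \<epsilon> * (C * U) < 1" using small1 q by (simp add: field_simps)
        show "Htrace M c D.L \<noteq> 1"
        proof
          assume "Htrace M c D.L = 1"
          hence "\<epsilon> * \<bar>BM M \<psi>\<bar> \<le> \<epsilon>\<^sup>2 * C * U2" using trace[OF e'] e by (simp add: norm_mult)
          also have "\<dots> = \<epsilon> * (\<epsilon> * (C * U2))" by (simp add: power2_eq_square)
          also have "\<dots> < \<epsilon> * \<bar>BM M \<psi>\<bar>" using small2 e by (intro mult_strict_left_mono) auto
          finally show False by simp
        qed
      next
        fix V :: "int^2 \<Rightarrow> complex" and S :: real and m :: "int^2"
        assume V0: "V 0 = 0" and VS: "\<And>n. norm (V n) \<le> S" and m: "m \<noteq> 0"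
        have S0: "S \<ge> 0" using VS[of 0] V0 by simp
        let ?f = "\<lambda>n. of_real (ew M c n / ew M c m) * kmat M \<psi> \<epsilon> m n * V n"
        let ?g = "\<lambda>n. (if m = transpose M *v n then q else 0) * S + \<epsilon> * C * S * exp (- a * nn n)"
        have fg: "norm (?f n) \<le> ?g n" for n
        proof (cases "n = 0")
          case True
          thus ?thesis using V0 S0 q0 C e by simp
        next
          case False
          let ?w = "ew M c n / ew M c m" and ?d = "if m = transpose M *v n then 1 else 0 :: complex"
          have "norm (kmat M \<psi> \<epsilon> m n) \<le> norm ?d + norm (kmat M \<psi> \<epsilon> m n - ?d)"
            by (rule norm_triangle_sub)
          hence "?w * norm (kmat M \<psi> \<epsilon> m n) \<le> ?w * (norm ?d + norm (kmat M \<psi> \<epsilon> m n - ?d))"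
            by (intro mult_left_mono) (simp_all add: less_imp_le)
          also have "\<dots> = ?w * norm ?d + ?w * norm (kmat M \<psi> \<epsilon> m n - ?d)" by (simp add: distrib_left)
          also have "?w * norm ?d \<le> (if m = transpose M *v n then q else 0)"
            using contract[OF False] by simp
          also have "?w * norm (kmat M \<psi> \<epsilon> m n - ?d) \<le> \<epsilon> * C * (exp (- a * nn m) * exp (- a * nn n))"
            by (rule en(2)[OF e'])
          also have "\<dots> \<le> \<epsilon> * C * (1 * exp (- a * nn n))"
            using e C a by (intro mult_left_mono mult_right_mono) auto
          finally have k: "?w * norm (kmat M \<psi> \<epsilon> m n) \<le> (if m = transpose M *v n then q else 0) + \<epsilon> * C * exp (- a * nn n)"
            by simp
          have "norm (?f n) = ?w * norm (kmat M \<psi> \<epsilon> m n) * norm (V n)"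
            by (simp add: norm_mult norm_divide less_imp_le)
          also have "\<dots> \<le> ((if m = transpose M *v n then q else 0) + \<epsilon> * C * exp (- a * nn n)) * S"
            using e C q0 by (intro mult_mono k VS) auto
          finally show ?thesis by (simp add: algebra_simps)
        qed
        obtain s where s: "((\<lambda>n. if m = transpose M *v n then q else 0) has_sum s) UNIV" "s \<le> q"
        proof (cases "\<exists>n. m = transpose M *v n")
          case True
          then obtain n where n: "m = transpose M *v n" ..
          have "((\<lambda>n. if m = transpose M *v n then q else 0) has_sum q) UNIV"
            by (rule has_sum_finite_neutralI[of "{n}"])
               (use n tmul_int_inj[OF assms(1)] in auto)
          thus ?thesis using that by blast
        next
          case False
          hence "(\<lambda>n. if m = transpose M *v n then q else 0) = (\<lambda>n. 0)" by auto
          thus ?thesis using that[of 0] q0 by simp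
        qed
        have g: "(?g has_sum (s * S + \<epsilon> * C * S * U)) UNIV"
          by (intro has_sum_add has_sum_cmult_left[OF s(1)] has_sum_cmult_right U)
        have "(\<lambda>n. norm (?f n)) summable_on UNIV"
          by (rule summable_on_comparison_test[OF has_sum_imp_summable[OF g]]) (use fg in auto)
        hence "(?f has_sum infsum ?f UNIV) UNIV"
          by (intro has_sum_infsum) (rule abs_summable_summable)
        from norm_infsum_le[OF this g] fg
        have "norm (infsum ?f UNIV) \<le> s * S + \<epsilon> * C * S * U" by blast
        also have "\<dots> \<le> q * S + \<epsilon> * C * S * U" using mult_right_mono[OF s(2) S0] by simp
        finally show "norm (infsum ?f UNIV) \<le> (q + \<epsilon> * (C * U)) * S" by (simp add: algebra_simps)
      qed
    qed
    have "(\<lambda>\<epsilon>. Htrace M c (?L \<epsilon>) - 1 - complex_of_real (\<epsilon> * BM M \<psi>))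
          \<in> O[at_right 0](\<lambda>\<epsilon>. complex_of_real (\<epsilon>\<^sup>2))"
    proof (rule bigoI)
      show "\<forall>\<^sub>F \<epsilon> in at_right 0. norm (Htrace M c (?L \<epsilon>) - 1 - complex_of_real (\<epsilon> * BM M \<psi>))
          \<le> (C * U2) * norm (complex_of_real (\<epsilon>\<^sup>2))"
      proof (rule eventually_at_rightI[OF _ e1])
        fix \<epsilon> assume "\<epsilon> \<in> {0<..<\<epsilon>1}"
        hence "0 \<le> \<epsilon> \<and> \<epsilon> < \<epsilon>1" by simp
        from trace[OF this] show "norm (Htrace M c (?L \<epsilon>) - 1 - complex_of_real (\<epsilon> * BM M \<psi>))
          \<le> (C * U2) * norm (complex_of_real (\<epsilon>\<^sup>2))"
          by (simp add: norm_power mult_ac)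
      qed
    qed
    moreover have "koopman_ext M c (Tmap M \<epsilon> \<psi>) (?L \<epsilon>) \<and> nuclear0 M c (?L \<epsilon>)" if e: "0 < \<epsilon> \<and> \<epsilon> < \<epsilon>0" for \<epsilon>
    proof -
      have e': "0 \<le> \<epsilon> \<and> \<epsilon> < \<epsilon>1" using e by (simp add: \<epsilon>0_def)
      show ?thesis
        using koopman_ext_kmat[OF dm[OF e'] Bspace_continuous[OF ext assms(3)]]
          decaying_matrix.L_nuclear[OF dm[OF e']] by blast
    qed
    ultimately show ?thesis using e0 spec by (intro exI[of _ \<epsilon>0] conjI exI[of _ ?L]) blast+
  qed
  thus ?thesis
    using c BM_nonzero_open[OF assms] BM_nonzero_dense[OF assms]
    by (intro exI[of _ c] conjI exI[of _ ?G]) blast+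
qed

end
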